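(* Fix $\beta,\gamma>0$. There is an absolute constant $C>0$ such that for all sufficiently large $n$, every $D$-regular (unweighted) graph $G$ on $n$ nodes with $D\geq\beta n$ and $\phi(G)\geq\gamma D$ contains a weighted subgraph $H$ which is $d$-regular in weighted degrees, with $d\le(\log n)^{C/(\beta\gamma^2)}$, with $\phi(H)\geq\frac13$, and with all edge weights in $\{1,2\}$. Moreover, $H$ can be found in randomized polynomial time.
   Context: Graphs are undirected. For a weighted graph with nonnegative edge weights, the weighted degree of a vertex is the sum of weights of its incident edges; the graph is $d$-regular in weighted degrees if every vertex has weighted degree $d$. The edge-expansion of a weighted graph $G(V,E,w)$ is $\phi(G)=\min\{w(S,\bar S)/|S| : S\subset V,\ 0<|S|\leq|V|/2\}$, where $w(S,\bar S)$ is the total weight of edges with exactly one endpoint in $S$ (for an unweighted graph all weights are $1$). A weighted subgraph of $G$ means a subgraph of $G$ whose edges are assigned weights. *)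

theory Defs
  imports "HOL-Probability.Probability" "HOL-Computational_Algebra.Polynomial"
begin

section \<open>Weighted graphs\<close>

text \<open>
  A weighted graph is given by a vertex set V, a set E of two-element subsets of V and a weight
  function w on edges; values of w outside E are irrelevant. An unweighted graph carries the
  constant weight 1.
\<close>

definition simple_graph :: "'a set \<Rightarrow> 'a set set \<Rightarrow> bool" where
  "simple_graph V E \<longleftrightarrow> finite V \<and> (\<forall>e\<in>E. e \<subseteq> V \<and> card e = 2)"

definition weighted_degree :: "'a set set \<Rightarrow> ('a set \<Rightarrow> real) \<Rightarrow> 'a \<Rightarrow> real" where
  "weighted_degree E w v = (\<Sum>e\<in>{e\<in>E. v \<in> e}. w e)"

definition weighted_regular :: "'a set \<Rightarrow> 'a set set \<Rightarrow> ('a set \<Rightarrow> real) \<Rightarrow> real \<Rightarrow> bool" where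
  "weighted_regular V E w d \<longleftrightarrow> (\<forall>v\<in>V. weighted_degree E w v = d)"

definition cut_weight :: "'a set set \<Rightarrow> ('a set \<Rightarrow> real) \<Rightarrow> 'a set \<Rightarrow> real" where
  "cut_weight E w S = (\<Sum>e\<in>{e\<in>E. card (e \<inter> S) = 1}. w e)"

text \<open>The minimum is over a nonempty set exactly when V has at least two elements.\<close>

definition edge_expansion :: "'a set \<Rightarrow> 'a set set \<Rightarrow> ('a set \<Rightarrow> real) \<Rightarrow> real" where
  "edge_expansion V E w =
     Min {cut_weight E w S / real (card S) | S. S \<subset> V \<and> 0 < card S \<and> real (card S) \<le> real (card V) / 2}"

definition dense_expander :: "real \<Rightarrow> real \<Rightarrow> 'a set \<Rightarrow> 'a set set \<Rightarrow> bool" where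
  "dense_expander \<beta> \<gamma> V E \<longleftrightarrow>
     simple_graph V E \<and>
     (\<exists>D::nat. weighted_regular V E (\<lambda>_. 1) (real D) \<and>
        real D \<ge> \<beta> * real (card V) \<and>
        edge_expansion V E (\<lambda>_. 1) \<ge> \<gamma> * real D)"

text \<open>
  The weighted graph (V, F, w) is a subgraph of (V, E). It is spanning: without this requirement
  a single edge would always qualify.
\<close>

definition regular_expander_subgraph ::
    "real \<Rightarrow> 'a set \<Rightarrow> 'a set set \<Rightarrow> 'a set set \<Rightarrow> ('a set \<Rightarrow> real) \<Rightarrow> bool" where
  "regular_expander_subgraph b V E F w \<longleftrightarrow>
     F \<subseteq> E \<and>
     (\<forall>e\<in>F. w e \<in> {1, 2}) \<and>
     (\<exists>d. weighted_regular V F w d \<and> d \<le> b) \<and>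
     edge_expansion V F w \<ge> 1 / 3"


section \<open>Randomized random access machines\<close>

text \<open>
  The model of computation is a structured random access machine with coin flips. Memory consists
  of arrays of natural numbers, addressed by a name and a list of indices (a scalar is an array
  with empty index list). The only arithmetic operations are addition and truncated subtraction.
  There is deliberately no multiplication: under unit cost, bit lengths grow by only a constant
  per step, so time on this machine is polynomially related to time on a probabilistic Turing
  machine.
\<close>

type_synonym state = "string \<Rightarrow> nat list \<Rightarrow> nat"

datatype aexp =
    Num nat
  | Read string "aexp list"
  | Add aexp aexp
  | Sub aexp aexp

fun aval :: "state \<Rightarrow> aexp \<Rightarrow> nat" where
  "aval s (Num k) = k"
| "aval s (Read x ix) = s x (map (aval s) ix)"
| "aval s (Add a b) = aval s a + aval s b"
| "aval s (Sub a b) = aval s a - aval s b"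

datatype com =
    Skip
  | Assign string "aexp list" aexp
  | Flip string "aexp list"
  | Seq com com
  | Cond aexp com com
  | While aexp com

definition store :: "state \<Rightarrow> string \<Rightarrow> nat list \<Rightarrow> nat \<Rightarrow> state" where
  "store s x ix v = s(x := (s x)(ix := v))"

text \<open>
  exec c (s, r) t (s', r') means that c, started in s with the sequence r of coin tosses still
  to be used, halts after t steps in s' with r' unused. Execution is stuck if the coins run out.
  Expressions have a size fixed by the program, so evaluating one is charged to its command.
\<close>

inductive exec :: "com \<Rightarrow> state \<times> bool list \<Rightarrow> nat \<Rightarrow> state \<times> bool list \<Rightarrow> bool" where
  exec_Skip: "exec Skip \<sigma> 1 \<sigma>"
| exec_Assign: "exec (Assign x ix a) (s, r) 1 (store s x (map (aval s) ix) (aval s a), r)"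
| exec_Flip: "exec (Flip x ix) (s, b # r) 1 (store s x (map (aval s) ix) (of_bool b), r)"
| exec_Seq: "exec c \<sigma> t \<sigma>' \<Longrightarrow> exec c' \<sigma>' t' \<sigma>'' \<Longrightarrow> exec (Seq c c') \<sigma> (t + t') \<sigma>''"
| exec_CondTrue: "aval s a \<noteq> 0 \<Longrightarrow> exec c (s, r) t \<sigma>' \<Longrightarrow> exec (Cond a c c') (s, r) (Suc t) \<sigma>'"
| exec_CondFalse: "aval s a = 0 \<Longrightarrow> exec c' (s, r) t \<sigma>' \<Longrightarrow> exec (Cond a c c') (s, r) (Suc t) \<sigma>'"
| exec_WhileFalse: "aval s a = 0 \<Longrightarrow> exec (While a c) (s, r) 1 (s, r)"
| exec_WhileTrue: "aval s a \<noteq> 0 \<Longrightarrow> exec c (s, r) t \<sigma>' \<Longrightarrow> exec (While a c) \<sigma>' t' \<sigma>'' \<Longrightarrow>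
    exec (While a c) (s, r) (Suc (t + t')) \<sigma>''"

inductive_cases exec_SkipE: "exec Skip \<sigma> t \<sigma>'"
inductive_cases exec_AssignE: "exec (Assign x ix a) \<sigma> t \<sigma>'"
inductive_cases exec_FlipE: "exec (Flip x ix) \<sigma> t \<sigma>'"
inductive_cases exec_SeqE: "exec (Seq c c') \<sigma> t \<sigma>'"

lemma exec_deterministic:
  assumes "exec c \<sigma> t \<sigma>'" and "exec c \<sigma> u \<tau>"
  shows "u = t \<and> \<tau> = \<sigma>'"
  using assms
proof (induction arbitrary: u \<tau> rule: exec.induct)
  case (exec_Skip \<sigma>)
  from exec_Skip.prems show ?case by (rule exec_SkipE) simp
next
  case (exec_Assign x ix a s r)
  from exec_Assign.prems show ?case by (rule exec_AssignE) simp
next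
  case (exec_Flip x ix s b r)
  from exec_Flip.prems show ?case by (rule exec_FlipE) simp
next
  case (exec_Seq c \<sigma> t \<sigma>' c' t' \<sigma>'')
  from exec_Seq.prems obtain v v' \<rho> where
    "u = v + v'" "exec c \<sigma> v \<rho>" "exec c' \<rho> v' \<tau>"
    by (rule exec_SeqE)
  with exec_Seq.IH show ?case by metis
next
  case (exec_CondTrue s a c r t \<sigma>' c')
  from exec_CondTrue.prems exec_CondTrue.hyps(1) obtain v where
    "u = Suc v" "exec c (s, r) v \<tau>"
    by (cases rule: exec.cases) auto
  with exec_CondTrue.IH show ?case by metis
next
  case (exec_CondFalse s a c' r t \<sigma>' c)
  from exec_CondFalse.prems exec_CondFalse.hyps(1) obtain v where
    "u = Suc v" "exec c' (s, r) v \<tau>"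
    by (cases rule: exec.cases) auto
  with exec_CondFalse.IH show ?case by metis
next
  case (exec_WhileFalse s a c r)
  from exec_WhileFalse.prems exec_WhileFalse.hyps show ?case
    by (cases rule: exec.cases) auto
next
  case (exec_WhileTrue s a c r t \<sigma>' t' \<sigma>'')
  from exec_WhileTrue.prems exec_WhileTrue.hyps(1) obtain v v' \<rho> where
    "u = Suc (v + v')" "exec c (s, r) v \<rho>" "exec (While a c) \<rho> v' \<tau>"
    by (cases rule: exec.cases) auto
  with exec_WhileTrue.IH show ?case by metis
qed

text \<open>
  A graph with vertices 0, ..., n - 1 is input as n together with its adjacency matrix. A weighted
  graph is output as a matrix of weights of which only the entries above the diagonal are read;
  entry 0 means that there is no edge.
\<close>

definition input_state :: "nat \<Rightarrow> nat set set \<Rightarrow> state" where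
  "input_state n E = (\<lambda>x ix.
     if x = ''n'' \<and> ix = [] then n
     else if x = ''G'' then (case ix of [i, j] \<Rightarrow> of_bool ({i, j} \<in> E) | _ \<Rightarrow> 0)
     else 0)"

definition output_edges :: "nat \<Rightarrow> state \<Rightarrow> nat set set" where
  "output_edges n s = {{i, j} | i j. i < j \<and> j < n \<and> s ''H'' [i, j] \<noteq> 0}"

definition output_weight :: "state \<Rightarrow> nat set \<Rightarrow> real" where
  "output_weight s e = real (s ''H'' [Min e, Max e])"

text \<open>
  A program solves a search problem on graphs in randomized polynomial time if it always halts
  within a number of steps polynomial in the number n of vertices, and on every instance
  outputs a solution with probability at least 2/3. Since each toss takes a step, p(n)
  independent fair coins suffice when p(n) bounds the running time.
\<close>

definition randomized_poly_time_search ::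
    "com \<Rightarrow> (nat \<Rightarrow> nat set set \<Rightarrow> bool) \<Rightarrow>
     (nat \<Rightarrow> nat set set \<Rightarrow> nat set set \<Rightarrow> (nat set \<Rightarrow> real) \<Rightarrow> bool) \<Rightarrow> bool" where
  "randomized_poly_time_search c Inst Sol \<longleftrightarrow>
     (\<exists>p :: nat poly.
        (\<forall>n E r. simple_graph {..<n} E \<and> length r = poly p n \<longrightarrow>
           (\<exists>t \<sigma>. exec c (input_state n E, r) t \<sigma> \<and> t \<le> poly p n)) \<and>
        (\<forall>n E. simple_graph {..<n} E \<and> Inst n E \<longrightarrow>
           measure_pmf.prob (pmf_of_set {r :: bool list. length r = poly p n})
             {r. \<exists>t s r'. exec c (input_state n E, r) t (s, r') \<and>
                    Sol n E (output_edges n s) (output_weight s)} \<ge> 2 / 3))"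

end

theory Submission
  imports Defs "HOL-Real_Asymp.Real_Asymp"
begin

text \<open>
  Colour the arcs of G, seen as edges of its bipartite double cover, properly with D colours. As the
  double cover is D-regular, every colour class is a permutation of the vertices, and the union of
  any T distinct classes, read as a weighted graph, is regular of weighted degree 2T with weights in
  {1, 2}. Only expansion depends on the choice of the classes.

  For a permutation s of the vertices consider the lazy step that replaces f by the average of f and
  its composition with s. By the identity for the square of an average and Cheeger's inequality, on
  functions with sum 0 this decreases the squared norm on average over all classes by a constant
  factor 1 - c. Choosing greedily the unused class that makes the sum of the squared norms of the n
  walks started at single vertices smallest, all these walks are nearly uniform after T = O(log n)
  steps. For a set S of at most n/2 vertices a constant fraction of the mass |S| has then left S,
  while each step can move at most half a unit of mass per crossing arc; hence at least 3|S|/4 arcs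
  of the chosen classes cross.

  All of this is deterministic, so the program tosses no coins: it colours by Kempe exchanges and
  compares the norms exactly, as integers of size polynomial in n. In particular the exponent 2 of
  the logarithm suffices.
\<close>


section \<open>Total correctness of coin-free programs\<close>

text \<open>Permutations of the double cover are used, rather than matchings of G, because G itself
  need not have a perfect matching, for instance when n is odd. An edge may then be picked in both
  orientations, hence the weights 1 and 2. The obstacle is that expansion is a condition on
  exponentially many sets S. It is replaced by one computable number: once the sum of the squared
  distances of the n walks to the uniform distribution is at most 1/(16 n^2), every single entry of
  every walk is at least 3/(4n), and this serves all S at once. Distinct classes keep the weights at
  most 2. Excluding the fewer than T classes already used hardly hurts the average, because T =
  O(log n) while D >= \<beta> n; this is where density enters. As T is a constant multiple K of the
  rounded-up binary logarithm of n, the factor 2^T by which the walks are scaled to integers is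
  polynomial in n. The constant K depends on \<gamma> only, and the second power of the logarithm
  absorbs it for large n.\<close>

fun written :: "com \<Rightarrow> string set" where
  "written Skip = {}"
| "written (Assign x ix a) = {x}"
| "written (Flip x ix) = {x}"
| "written (Seq c c') = written c \<union> written c'"
| "written (Cond a c c') = written c \<union> written c'"
| "written (While a c) = written c"

lemma exec_frame:
  assumes "exec c \<sigma> t \<sigma>'" and "x \<notin> written c"
  shows "fst \<sigma>' x = fst \<sigma> x"
  using assms by (induction rule: exec.induct) (auto simp: store_def)

text \<open>Step count and final state are chosen before the coin sequence \<open>r\<close>, and
  \<open>r\<close> comes back intact: one run serves all coin sequences, so success with probability
  1 follows without any probabilistic argument.\<close>

definition wp :: "com \<Rightarrow> nat \<Rightarrow> (state \<Rightarrow> bool) \<Rightarrow> state \<Rightarrow> bool" where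
  "wp c B Q s \<longleftrightarrow> (\<exists>t s'. t \<le> B \<and> (\<forall>r. exec c (s, r) t (s', r)) \<and> Q s')"

text \<open>The consequence rule has the frame condition built in. Postconditions can therefore be
  confined to what a command changes; everything else is recovered here.\<close>

lemma wp_mono:
  assumes "wp c B Q s" and "B \<le> B'"
    and "\<And>s'. Q s' \<Longrightarrow> (\<And>x. x \<notin> written c \<Longrightarrow> s' x = s x) \<Longrightarrow> Q' s'"
  shows "wp c B' Q' s"
proof -
  from assms(1) obtain t s' where *: "t \<le> B" "\<And>r. exec c (s, r) t (s', r)" "Q s'"
    unfolding wp_def by blast
  have "s' x = s x" if "x \<notin> written c" for x
    using exec_frame[OF *(2) that] by simp
  with * assms(2,3) show ?thesis unfolding wp_def by (intro exI[of _ t] exI[of _ s']) auto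
qed

lemma wp_Seq: "wp c B (wp c' B' Q) s \<Longrightarrow> wp (Seq c c') (B + B') Q s"
  unfolding wp_def by (blast intro: add_mono exec_Seq)

lemma wp_Seq_step:
  assumes "wp c B R s"
    and "\<And>s'. R s' \<Longrightarrow> (\<And>x. x \<notin> written c \<Longrightarrow> s' x = s x) \<Longrightarrow> wp c' B' Q s'"
  shows "wp (Seq c c') (B + B') Q s"
  by (rule wp_Seq, rule wp_mono[OF assms(1) order_refl]) (rule assms(2))

lemma wp_Skip: "Q s \<Longrightarrow> 1 \<le> B \<Longrightarrow> wp Skip B Q s"
  unfolding wp_def using exec_Skip by blast

lemma wp_Cond:
  assumes "aval s a \<noteq> 0 \<Longrightarrow> wp c B Q s" and "aval s a = 0 \<Longrightarrow> wp c' B Q s"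
  shows "wp (Cond a c c') (Suc B) Q s"
proof (cases "aval s a = 0")
  case True
  then obtain t s' where "t \<le> B" "\<And>r. exec c' (s, r) t (s', r)" "Q s'"
    using assms(2) unfolding wp_def by blast
  with True show ?thesis unfolding wp_def by (intro exI[of _ "Suc t"] exI[of _ s']) (simp add: exec_CondFalse)
next
  case False
  then obtain t s' where "t \<le> B" "\<And>r. exec c (s, r) t (s', r)" "Q s'"
    using assms(1) unfolding wp_def by blast
  with False show ?thesis unfolding wp_def by (intro exI[of _ "Suc t"] exI[of _ s']) (simp add: exec_CondTrue)
qed

fun loop_free :: "com \<Rightarrow> bool" where
  "loop_free Skip = True"
| "loop_free (Assign x ix a) = True"
| "loop_free (Flip x ix) = False"
| "loop_free (Seq c c') = (loop_free c \<and> loop_free c')"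
| "loop_free (Cond a c c') = (loop_free c \<and> loop_free c')"
| "loop_free (While a c) = False"

text \<open>A functional semantics of straight-line code, so that the simplifier computes the final
  state. The equations for \<open>Flip\<close> and \<open>While\<close> are dummy values, as
  \<open>wp_run\<close> is restricted to \<open>loop_free\<close> commands.\<close>

fun run :: "com \<Rightarrow> state \<Rightarrow> state" where
  "run Skip s = s"
| "run (Assign x ix a) s = store s x (map (aval s) ix) (aval s a)"
| "run (Flip x ix) s = s"
| "run (Seq c c') s = run c' (run c s)"
| "run (Cond a c c') s = (if aval s a \<noteq> 0 then run c s else run c' s)"
| "run (While a c) s = s"

fun cost :: "com \<Rightarrow> nat" where
  "cost Skip = 1"
| "cost (Assign x ix a) = 1"
| "cost (Flip x ix) = 1"
| "cost (Seq c c') = cost c + cost c'"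
| "cost (Cond a c c') = Suc (cost c + cost c')"
| "cost (While a c) = 1"

lemma wp_run:
  assumes "loop_free c" and "cost c \<le> B" and "Q (run c s)"
  shows "wp c B Q s"
proof -
  have "\<exists>t\<le>cost c. \<forall>r. exec c (s, r) t (run c s, r)"
    using assms(1)
  proof (induction c arbitrary: s)
    case (Seq c c')
    then obtain t t' where "t \<le> cost c" "\<And>r. exec c (s, r) t (run c s, r)"
      "t' \<le> cost c'" "\<And>r. exec c' (run c s, r) t' (run c' (run c s), r)"
      by fastforce
    then show ?case by (intro exI[of _ "t + t'"]) (auto intro: exec_Seq)
  next
    case (Cond a c c')
    show ?case
    proof (cases "aval s a = 0")
      case True
      from Cond obtain t where "t \<le> cost c'" "\<And>r. exec c' (s, r) t (run c' s, r)" by fastforce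
      with True show ?thesis by (intro exI[of _ "Suc t"]) (auto intro: exec_CondTrue exec_CondFalse)
    next
      case False
      from Cond obtain t where "t \<le> cost c" "\<And>r. exec c (s, r) t (run c s, r)" by fastforce
      with False show ?thesis by (intro exI[of _ "Suc t"]) (auto intro: exec_CondTrue exec_CondFalse)
    qed
  next
    case Skip
    show ?case using exec_Skip[of "(s, _)"] by (intro exI[of _ 1]) simp
  next
    case (Assign x ix a)
    show ?case using exec_Assign[of x ix a s] by (intro exI[of _ 1]) simp
  qed simp_all
  with assms(2,3) show ?thesis unfolding wp_def by (meson order_trans)
qed

text \<open>The bound is evaluated anew before every iteration. The side condition of
  \<open>wp_For\<close> on \<open>read_names\<close> makes its value constant, so that the number of
  iterations is known in advance.\<close>

definition For :: "string \<Rightarrow> aexp \<Rightarrow> com \<Rightarrow> com" where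
  "For v b c = Seq (Assign v [] (Num 0))
     (While (Sub b (Read v [])) (Seq c (Assign v [] (Add (Read v []) (Num 1)))))"

lemma written_For [simp]: "written (For v b c) = insert v (written c)"
  by (auto simp: For_def)

fun read_names :: "aexp \<Rightarrow> string set" where
  "read_names (Num k) = {}"
| "read_names (Read x ix) = insert x (\<Union>(set (map read_names ix)))"
| "read_names (Add a b) = read_names a \<union> read_names b"
| "read_names (Sub a b) = read_names a \<union> read_names b"

lemma aval_cong: "(\<And>x. x \<in> read_names a \<Longrightarrow> s x = s' x) \<Longrightarrow> aval s a = aval s' a"
proof (induction a)
  case (Read x ix)
  then have "map (aval s) ix = map (aval s') ix" by auto
  with Read.prems[of x] show ?case by (simp del: map_eq_conv)
qed auto

text \<open>The invariant may not speak about the counter; its value is supplied separately.\<close>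

lemma wp_For:
  fixes I :: "nat \<Rightarrow> state \<Rightarrow> bool"
  assumes bound: "aval s b \<le> N" and names: "v \<notin> written c" "read_names b \<inter> insert v (written c) = {}"
    and stable: "\<And>k s m. I k s \<Longrightarrow> I k (store s v [] m)"
    and init: "I 0 s"
    and step: "\<And>k s'. k < aval s b \<Longrightarrow> I k s' \<Longrightarrow> s' v [] = k \<Longrightarrow>
       (\<And>x. x \<notin> insert v (written c) \<Longrightarrow> s' x = s x) \<Longrightarrow> wp c B (I (Suc k)) s'"
    and final: "\<And>s'. I (aval s b) s' \<Longrightarrow> (\<And>x. x \<notin> insert v (written c) \<Longrightarrow> s' x = s x) \<Longrightarrow> Q s'"
  shows "wp (For v b c) (N * (B + 2) + 2) Q s"
proof -
  let ?c = "Seq c (Assign v [] (Add (Read v []) (Num 1)))"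
  let ?W = "While (Sub b (Read v [])) ?c"
  let ?fr = "\<lambda>s'. \<forall>x. x \<notin> insert v (written c) \<longrightarrow> s' x = s x"
  let ?M = "aval s b"
  have b: "aval s' b = ?M" if "?fr s'" for s'
    by (rule aval_cong) (use that names(2) in blast)
  \<comment> \<open>Induction on the number \<open>d\<close> of remaining iterations. Each costs at
    most \<open>B\<close> for the body, one step for the increment and one for the test.\<close>
  have loop: "wp ?W (d * (B + 2) + 1) Q s'"
    if "d = ?M - k" "k \<le> ?M" "I k s'" "s' v [] = k" "?fr s'" for d k s'
    using that
  proof (induction d arbitrary: k s')
    case 0
    then have "k = ?M" by simp
    with 0 have "Q s'" by (intro final) auto
    moreover have "aval s' (Sub b (Read v [])) = 0" using 0 b[of s'] by simp
    ultimately show ?case unfolding wp_def using exec_WhileFalse by (metis le_add2)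
  next
    case (Suc d)
    then have k: "k < ?M" by simp
    from step[OF k Suc.prems(3,4)] Suc.prems(5) have "wp c B (I (Suc k)) s'" by blast
    then obtain t s1 where t: "t \<le> B" "\<And>r. exec c (s', r) t (s1, r)" "I (Suc k) s1"
      unfolding wp_def by blast
    have fr: "s1 x = s' x" if "x \<notin> written c" for x
      using exec_frame[OF t(2) that] by simp
    let ?s2 = "store s1 v [] (Suc k)"
    have "exec ?c (s', r) (t + 1) (?s2, r)" for r
    proof (rule exec_Seq[OF t(2)])
      show "exec (Assign v [] (Add (Read v []) (Num 1))) (s1, r) 1 (?s2, r)"
        using exec_Assign[of v "[]" "Add (Read v []) (Num 1)" s1 r] fr[OF names(1)] Suc.prems(4) by simp
    qed
    moreover have "wp ?W (d * (B + 2) + 1) Q ?s2"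
    proof (rule Suc.IH)
      show "d = ?M - Suc k" "Suc k \<le> ?M" using Suc.prems(1) k by auto
      show "I (Suc k) ?s2" by (rule stable[OF t(3)])
      show "?s2 v [] = Suc k" by (simp add: store_def)
      show "?fr ?s2" using fr Suc.prems(5) by (simp add: store_def)
    qed
    then obtain t' s3 where t': "t' \<le> d * (B + 2) + 1" "\<And>r. exec ?W (?s2, r) t' (s3, r)" "Q s3"
      unfolding wp_def by blast
    moreover have "aval s' (Sub b (Read v [])) \<noteq> 0" using Suc.prems(4) b[OF Suc.prems(5)] k by simp
    ultimately have "exec ?W (s', r) (Suc ((t + 1) + t')) (s3, r)" for r
      using exec_WhileTrue by blast
    moreover have "Suc ((t + 1) + t') \<le> Suc d * (B + 2) + 1" using t(1) t'(1) by simp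
    ultimately show ?case unfolding wp_def using t'(3) by blast
  qed
  have "wp ?W (?M * (B + 2) + 1) Q (store s v [] 0)"
    by (rule loop[of _ 0]) (auto intro: stable init, auto simp: store_def)
  then have "wp ?W (N * (B + 2) + 1) Q (store s v [] 0)"
    by (rule wp_mono) (use mult_le_mono1[OF bound, of "B + 2"] in simp_all)
  then have "wp (Assign v [] (Num 0)) 1 (wp ?W (N * (B + 2) + 1) Q) s"
    by - (rule wp_run, simp_all)
  then have "wp (For v b c) (1 + (N * (B + 2) + 1)) Q s"
    unfolding For_def by (rule wp_Seq)
  then show ?thesis by (simp add: algebra_simps)
qed

section \<open>Edge colouring of the bipartite double cover\<close>

text \<open>
  The table entry \<open>M [c, u] = Suc v\<close> says that the arc from u to v has colour c, and then
  \<open>N [c, v] = Suc u\<close>; the entry 0 says that u has no outgoing (v no incoming) arc of colour c.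
\<close>

definition arc_colouring ::
    "nat \<Rightarrow> nat \<Rightarrow> (nat \<times> nat) set \<Rightarrow> (nat list \<Rightarrow> nat) \<Rightarrow> (nat list \<Rightarrow> nat) \<Rightarrow> bool" where
  "arc_colouring n D A M N \<longleftrightarrow>
     A \<subseteq> {..<n} \<times> {..<n} \<and>
     (\<forall>c<D. \<forall>u<n. M [c, u] \<le> n \<and> N [c, u] \<le> n) \<and>
     (\<forall>c<D. \<forall>u<n. \<forall>v<n. M [c, u] = Suc v \<longleftrightarrow> N [c, v] = Suc u) \<and>
     (\<forall>u<n. \<forall>v<n. (u, v) \<in> A \<longleftrightarrow> (\<exists>c<D. M [c, u] = Suc v)) \<and>
     (\<forall>c<D. \<forall>c'<D. \<forall>u<n. \<forall>v<n. M [c, u] = Suc v \<and> M [c', u] = Suc v \<longrightarrow> c = c')"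

lemma arc_colouringI:
  assumes "A \<subseteq> {..<n} \<times> {..<n}"
    and "\<And>c u. c < D \<Longrightarrow> u < n \<Longrightarrow> M [c, u] \<le> n" "\<And>c u. c < D \<Longrightarrow> u < n \<Longrightarrow> N [c, u] \<le> n"
    and "\<And>c u v. c < D \<Longrightarrow> u < n \<Longrightarrow> v < n \<Longrightarrow> M [c, u] = Suc v \<longleftrightarrow> N [c, v] = Suc u"
    and "\<And>u v. u < n \<Longrightarrow> v < n \<Longrightarrow> (u, v) \<in> A \<Longrightarrow> \<exists>c<D. M [c, u] = Suc v"
    and "\<And>c u v. c < D \<Longrightarrow> u < n \<Longrightarrow> v < n \<Longrightarrow> M [c, u] = Suc v \<Longrightarrow> (u, v) \<in> A"
    and "\<And>c c' u v. c < D \<Longrightarrow> c' < D \<Longrightarrow> u < n \<Longrightarrow> v < n \<Longrightarrow>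
      M [c, u] = Suc v \<Longrightarrow> M [c', u] = Suc v \<Longrightarrow> c = c'"
  shows "arc_colouring n D A M N"
proof -
  have "(u, v) \<in> A \<longleftrightarrow> (\<exists>c<D. M [c, u] = Suc v)" if "u < n" "v < n" for u v
    using assms(5,6)[of u v] assms(6)[of _ u v] that by blast
  moreover have "M [c, u] \<le> n \<and> N [c, u] \<le> n" if "c < D" "u < n" for c u
    using assms(2,3) that by simp
  moreover have "\<forall>c<D. \<forall>u<n. \<forall>v<n. M [c, u] = Suc v \<longleftrightarrow> N [c, v] = Suc u"
    using assms(4) by simp
  moreover have "\<forall>c<D. \<forall>c'<D. \<forall>u<n. \<forall>v<n. M [c, u] = Suc v \<and> M [c', u] = Suc v \<longrightarrow> c = c'"
    using assms(7) by simp
  ultimately show ?thesis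
    unfolding arc_colouring_def using assms(1) by simp
qed

lemma arc_colouringD:
  assumes "arc_colouring n D A M N"
  shows "A \<subseteq> {..<n} \<times> {..<n}"
    and "c < D \<Longrightarrow> u < n \<Longrightarrow> M [c, u] \<le> n" and "c < D \<Longrightarrow> u < n \<Longrightarrow> N [c, u] \<le> n"
    and "c < D \<Longrightarrow> u < n \<Longrightarrow> v < n \<Longrightarrow> M [c, u] = Suc v \<longleftrightarrow> N [c, v] = Suc u"
    and "u < n \<Longrightarrow> v < n \<Longrightarrow> (u, v) \<in> A \<Longrightarrow> \<exists>c<D. M [c, u] = Suc v"
    and "c < D \<Longrightarrow> u < n \<Longrightarrow> v < n \<Longrightarrow> M [c, u] = Suc v \<Longrightarrow> (u, v) \<in> A"
    and "c < D \<Longrightarrow> c' < D \<Longrightarrow> u < n \<Longrightarrow> v < n \<Longrightarrow>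
      M [c, u] = Suc v \<Longrightarrow> M [c', u] = Suc v \<Longrightarrow> c = c'"
proof -
  from assms have 1: "A \<subseteq> {..<n} \<times> {..<n}"
    and 2: "\<forall>c<D. \<forall>u<n. M [c, u] \<le> n \<and> N [c, u] \<le> n"
    and 3: "\<forall>c<D. \<forall>u<n. \<forall>v<n. M [c, u] = Suc v \<longleftrightarrow> N [c, v] = Suc u"
    and 4: "\<forall>u<n. \<forall>v<n. (u, v) \<in> A \<longleftrightarrow> (\<exists>c<D. M [c, u] = Suc v)"
    and 5: "\<forall>c<D. \<forall>c'<D. \<forall>u<n. \<forall>v<n. M [c, u] = Suc v \<and> M [c', u] = Suc v \<longrightarrow> c = c'"
    unfolding arc_colouring_def by simp_all
  show "A \<subseteq> {..<n} \<times> {..<n}" by (rule 1)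
  show "c < D \<Longrightarrow> u < n \<Longrightarrow> M [c, u] \<le> n" "c < D \<Longrightarrow> u < n \<Longrightarrow> N [c, u] \<le> n"
    using 2 by simp_all
  show "c < D \<Longrightarrow> u < n \<Longrightarrow> v < n \<Longrightarrow> M [c, u] = Suc v \<longleftrightarrow> N [c, v] = Suc u"
    using 3 by simp
  show "u < n \<Longrightarrow> v < n \<Longrightarrow> (u, v) \<in> A \<Longrightarrow> \<exists>c<D. M [c, u] = Suc v"
    using 4 by simp
  show "c < D \<Longrightarrow> u < n \<Longrightarrow> v < n \<Longrightarrow> M [c, u] = Suc v \<Longrightarrow> (u, v) \<in> A"
    using 4 by blast
  show "c < D \<Longrightarrow> c' < D \<Longrightarrow> u < n \<Longrightarrow> v < n \<Longrightarrow>
      M [c, u] = Suc v \<Longrightarrow> M [c', u] = Suc v \<Longrightarrow> c = c'"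
    using 5[rule_format, of c c' u v] by blast
qed

lemma arc_colouring_insert:
  assumes col: "arc_colouring n D A M N" and xy: "x < n" "y < n" "c < D" "(x, y) \<notin> A"
    and free: "M [c, x] = 0" "N [c, y] = 0"
  shows "arc_colouring n D (insert (x, y) A) (M([c, x] := Suc y)) (N([c, y] := Suc x))"
proof (rule arc_colouringI)
  note D = arc_colouringD[OF col]
  let ?M = "M([c, x] := Suc y)" and ?N = "N([c, y] := Suc x)"
  show "insert (x, y) A \<subseteq> {..<n} \<times> {..<n}" using D(1) xy by auto
  show "?M [d, u] \<le> n" "?N [d, u] \<le> n" if "d < D" "u < n" for d u
    using D(2,3)[OF that] xy by auto
  show "?M [d, u] = Suc v \<longleftrightarrow> ?N [d, v] = Suc u" if "d < D" "u < n" "v < n" for d u v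
    using D(4)[OF that] free that by auto
  show "\<exists>d<D. ?M [d, u] = Suc v" if uv: "u < n" "v < n" "(u, v) \<in> insert (x, y) A" for u v
  proof (cases "(u, v) = (x, y)")
    case True
    then show ?thesis using xy by auto
  next
    case False
    then obtain d where "d < D" "M [d, u] = Suc v" using D(5)[of u v] uv by auto
    then show ?thesis using free by (intro exI[of _ d]) auto
  qed
  show new: "(u, v) \<in> insert (x, y) A" if "d < D" "u < n" "v < n" "?M [d, u] = Suc v" for d u v
    using D(6)[of d u v] that by (auto split: if_splits)
  show "d = d'" if "d < D" "d' < D" "u < n" "v < n" "?M [d, u] = Suc v" "?M [d', u] = Suc v" for d d' u v
    using D(7)[of d d' u v] D(6)[of d u v] D(6)[of d' u v] that xy by (auto split: if_splits)
qed

lemma arc_colouring_remove: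
  assumes col: "arc_colouring n D A M N" and xy: "x < n" "y < n" "c < D" "M [c, x] = Suc y"
  shows "arc_colouring n D (A - {(x, y)}) (M([c, x] := 0)) (N([c, y] := 0))"
proof (rule arc_colouringI)
  note D = arc_colouringD[OF col]
  let ?M = "M([c, x] := 0)" and ?N = "N([c, y] := 0)"
  have N: "N [c, y] = Suc x" using D(4)[of c x y] xy by simp
  show "A - {(x, y)} \<subseteq> {..<n} \<times> {..<n}" using D(1) by auto
  show "?M [d, u] \<le> n" "?N [d, u] \<le> n" if "d < D" "u < n" for d u
    using D(2,3)[OF that] by auto
  show "?M [d, u] = Suc v \<longleftrightarrow> ?N [d, v] = Suc u" if "d < D" "u < n" "v < n" for d u v
    using D(4)[OF that] N that xy by auto
  show "\<exists>d<D. ?M [d, u] = Suc v" if uv: "u < n" "v < n" "(u, v) \<in> A - {(x, y)}" for u v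
  proof -
    obtain d where d: "d < D" "M [d, u] = Suc v" using D(5)[of u v] uv by auto
    moreover have "[d, u] \<noteq> [c, x]" using d xy uv by auto
    ultimately show ?thesis by (intro exI[of _ d]) simp
  qed
  show "(u, v) \<in> A - {(x, y)}" if "d < D" "u < n" "v < n" "?M [d, u] = Suc v" for d u v
    using D(6)[of d u v] D(7)[of d c u v] that xy by (auto split: if_splits)
  show "d = d'" if "d < D" "d' < D" "u < n" "v < n" "?M [d, u] = Suc v" "?M [d', u] = Suc v" for d d' u v
    using D(7)[of d d' u v] that by (auto split: if_splits)
qed

text \<open>
  The state of a Kempe exchange: the arc (x, y) still has to be coloured, a is free at x and b is
  free at y. The set Z collects the heads of the arcs displaced so far; they are distinct because
  each of them meanwhile has an incoming arc of colour b.
\<close>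

definition kempe ::
    "nat \<Rightarrow> nat \<Rightarrow> (nat \<times> nat) set \<Rightarrow> nat \<Rightarrow> nat \<Rightarrow> (nat list \<Rightarrow> nat) \<Rightarrow> (nat list \<Rightarrow> nat) \<Rightarrow>
      nat \<Rightarrow> nat \<Rightarrow> nat set \<Rightarrow> bool" where
  "kempe n D A a b M N x y Z \<longleftrightarrow>
     arc_colouring n D (A - {(x, y)}) M N \<and> (x, y) \<in> A \<and> x < n \<and> y < n \<and>
     M [a, x] = 0 \<and> N [b, y] = 0 \<and> Z \<subseteq> {..<n} \<and>
     (\<forall>z\<in>Z. \<exists>w<n. N [b, z] = Suc w \<and> (w = x \<or> (\<exists>z'\<in>Z. M [a, w] = Suc z')))"

text \<open>Here colour \<open>a\<close> is free at both ends of the pending arc.\<close>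

lemma kempe_finish_first:
  assumes "kempe n D A a b M N x y Z" and "a < D" and "N [a, y] = 0"
  shows "arc_colouring n D A (M([a, x] := Suc y)) (N([a, y] := Suc x))"
proof -
  have "(x, y) \<in> A" using assms(1) by (simp add: kempe_def)
  then have "insert (x, y) (A - {(x, y)}) = A" by blast
  then show ?thesis
    using arc_colouring_insert[of n D "A - {(x, y)}" M N x y a] assms by (simp add: kempe_def)
qed

text \<open>Colour \<open>a\<close> is occupied at \<open>y\<close> by an arc from
  \<open>x'\<close>. The pending arc takes this colour, and \<open>(x', y)\<close> becomes the
  pending one. As \<open>a\<close> is used at \<open>y\<close> and \<open>b\<close> is not, the two
  colours differ, so nothing of colour \<open>b\<close> has changed yet.\<close>

lemma kempe_exchange:
  assumes k: "kempe n D A a b M N x y Z" and ab: "a < D" "b < D" and N: "N [a, y] = Suc x'"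
  defines "M1 \<equiv> M([a, x'] := 0, [a, x] := Suc y)" and "N1 \<equiv> N([a, y] := Suc x)"
  shows "arc_colouring n D (A - {(x', y)}) M1 N1" and "x' < n" and "x' \<noteq> x" and "a \<noteq> b"
    and "M [a, x'] = Suc y" and "(x', y) \<in> A" and "M1 [b, x'] = M [b, x']" and "N1 [b, y] = 0"
proof -
  from k have col: "arc_colouring n D (A - {(x, y)}) M N" and xy: "(x, y) \<in> A" "x < n" "y < n"
    "M [a, x] = 0" "N [b, y] = 0" unfolding kempe_def by auto
  note D = arc_colouringD[OF col]
  show x': "x' < n" using D(3)[of a y] N ab xy by simp
  show M: "M [a, x'] = Suc y" using D(4)[of a x' y] N ab xy x' by simp
  show ne: "x' \<noteq> x" using M xy by auto
  show ne2: "a \<noteq> b" using N xy by auto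
  show A: "(x', y) \<in> A" using D(6)[of a x' y] M ab xy x' by simp
  have "arc_colouring n D (A - {(x, y)} - {(x', y)}) (M([a, x'] := 0)) (N([a, y] := 0))"
    by (rule arc_colouring_remove[OF col x' xy(3) ab(1) M])
  from arc_colouring_insert[OF this xy(2,3) ab(1)] xy ne
  have "arc_colouring n D (insert (x, y) (A - {(x, y)} - {(x', y)})) M1 N1"
    by (simp add: M1_def N1_def)
  moreover have "insert (x, y) (A - {(x, y)} - {(x', y)}) = A - {(x', y)}" using xy ne by auto
  ultimately show "arc_colouring n D (A - {(x', y)}) M1 N1" by simp
  show "M1 [b, x'] = M [b, x']" using ne ne2 by (simp add: M1_def)
  show "N1 [b, y] = 0" using xy ne2 by (simp add: N1_def)
qed

lemma kempe_finish_second: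
  assumes k: "kempe n D A a b M N x y Z" and ab: "a < D" "b < D" and N: "N [a, y] = Suc x'"
    and free: "M [b, x'] = 0"
  shows "arc_colouring n D A (M([a, x'] := 0, [a, x] := Suc y, [b, x'] := Suc y))
    (N([a, y] := Suc x, [b, y] := Suc x'))"
proof -
  note E = kempe_exchange[OF k ab N]
  have "insert (x', y) (A - {(x', y)}) = A" using E(6) by blast
  moreover have "y < n" using k by (simp add: kempe_def)
  ultimately show ?thesis
    using arc_colouring_insert[OF E(1,2) _ ab(2), of y] E(7,8) free by simp
qed

text \<open>The arc \<open>(x', y)\<close> takes colour \<open>b\<close> away from
  \<open>(x', y')\<close>, which becomes pending; now \<open>a\<close> is free at \<open>x'\<close>
  and \<open>b\<close> at \<open>y'\<close>, as before at \<open>x\<close> and \<open>y\<close>. The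
  vertex \<open>y\<close> joins \<open>Z\<close>, since it has just received an incoming arc of
  colour \<open>b\<close>. That \<open>y\<close> is new to \<open>Z\<close> is the progress measure
  of the exchange.\<close>

lemma kempe_next:
  assumes k: "kempe n D A a b M N x y Z" and ab: "a < D" "b < D" and N: "N [a, y] = Suc x'"
    and M: "M [b, x'] = Suc y'"
  shows "kempe n D A a b (M([a, x'] := 0, [a, x] := Suc y, [b, x'] := Suc y))
    (N([a, y] := Suc x, [b, y'] := 0, [b, y] := Suc x')) x' y' (insert y Z)" and "y \<notin> Z"
proof -
  note E = kempe_exchange[OF k ab N]
  define M1 where "M1 = M([a, x'] := 0, [a, x] := Suc y)"
  define N1 where "N1 = N([a, y] := Suc x)"
  from k have xy: "(x, y) \<in> A" "x < n" "y < n" "M [a, x] = 0" "N [b, y] = 0" "Z \<subseteq> {..<n}"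
    and Z: "\<And>z. z \<in> Z \<Longrightarrow> \<exists>w<n. N [b, z] = Suc w \<and> (w = x \<or> (\<exists>z'\<in>Z. M [a, w] = Suc z'))"
    unfolding kempe_def by auto
  have col: "arc_colouring n D (A - {(x', y)}) M1 N1" using E(1) by (simp add: M1_def N1_def)
  note D = arc_colouringD[OF col]
  have M1: "M1 [b, x'] = Suc y'" using E(7) M by (simp add: M1_def)
  have y': "y' < n" using D(2)[of b x'] ab E(2) M1 by simp
  have N1: "N1 [b, y'] = Suc x'" using D(4)[of b x' y'] ab E(2) M1 y' by simp
  have yy: "y' \<noteq> y" using N1 E(8) by (auto simp: N1_def)
  have A': "(x', y') \<in> A" using D(6)[of b x' y'] ab E(2) M1 y' by simp
  have Ny': "N [b, y'] = Suc x'" using N1 yy by (simp add: N1_def)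
  show yZ: "y \<notin> Z" using Z[of y] xy by auto
  \<comment> \<open>An arc of colour \<open>b\<close> into \<open>Z\<close> starts at
    \<open>x\<close> or at a vertex whose \<open>a\<close>-arc ends in \<open>Z\<close>. The
    \<open>b\<close>-arc into \<open>y'\<close> starts at \<open>x'\<close>, which differs from
    \<open>x\<close> and has its \<open>a\<close>-arc ending at \<open>y\<close>, outside
    \<open>Z\<close>. So freeing \<open>b\<close> at \<open>y'\<close> does not damage the invariant
    on \<open>Z\<close>.\<close>
  have y'Z: "y' \<notin> Z" using Z[of y'] Ny' E(3,5) yZ by auto
  have "arc_colouring n D (A - {(x', y)} - {(x', y')}) (M1([b, x'] := 0)) (N1([b, y'] := 0))"
    by (rule arc_colouring_remove[OF col E(2) y' ab(2) M1])
  from arc_colouring_insert[OF this E(2) xy(3) ab(2)] E(8) yy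
  have "arc_colouring n D (insert (x', y) (A - {(x', y)} - {(x', y')})) (M1([b, x'] := Suc y))
      (N1([b, y'] := 0, [b, y] := Suc x'))"
    by (simp add: N1_def)
  moreover have "insert (x', y) (A - {(x', y)} - {(x', y')}) = A - {(x', y')}" using E(6) yy by auto
  ultimately have new: "arc_colouring n D (A - {(x', y')}) (M1([b, x'] := Suc y))
      (N1([b, y'] := 0, [b, y] := Suc x'))" by simp
  let ?M = "M1([b, x'] := Suc y)" and ?N = "N1([b, y'] := 0, [b, y] := Suc x')"
  have "\<exists>w<n. ?N [b, z] = Suc w \<and> (w = x' \<or> (\<exists>z'\<in>insert y Z. ?M [a, w] = Suc z'))"
    if "z \<in> insert y Z" for z
  proof (cases "z = y")
    case True
    then show ?thesis using E(2) by (intro exI[of _ x']) simp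
  next
    case False
    then have z: "z \<in> Z" using that by simp
    then obtain w where w: "w < n" "N [b, z] = Suc w" "w = x \<or> (\<exists>z'\<in>Z. M [a, w] = Suc z')"
      using Z by blast
    have zy: "z \<noteq> y'" using z y'Z by auto
    have "?N [b, z] = Suc w" using w(2) zy False E(4) by (simp add: N1_def)
    \<comment> \<open>By the same argument. Hence \<open>w\<close> keeps its \<open>a\<close>-arc
      unless \<open>w = x\<close>, and the new \<open>a\<close>-arc of \<open>x\<close> ends at
      \<open>y\<close>, which now belongs to the set.\<close>
    moreover have "w \<noteq> x'" using w(3) E(3,5) yZ by auto
    then have "?M [a, w] = (if w = x then Suc y else M [a, w])" using E(4) by (simp add: M1_def)
    ultimately show ?thesis using w by (intro exI[of _ w]) auto
  qed
  then have "kempe n D A a b ?M ?N x' y' (insert y Z)"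
    unfolding kempe_def using new A' E(2,3,4) y' xy yy by (auto simp: M1_def)
  then show "kempe n D A a b (M([a, x'] := 0, [a, x] := Suc y, [b, x'] := Suc y))
    (N([a, y] := Suc x, [b, y'] := 0, [b, y] := Suc x')) x' y' (insert y Z)"
    unfolding M1_def N1_def .
qed

text \<open>Pigeonhole: if all colours occurred at \<open>u\<close>, mapping a colour to the head of
  its arc would inject the \<open>D\<close> colours into the out-neighbours.\<close>

lemma free_out_colour:
  assumes col: "arc_colouring n D A M N" and u: "u < n" and few: "card {v. (u, v) \<in> A} < D"
  shows "\<exists>c<D. M [c, u] = 0"
proof (rule ccontr)
  assume no: "\<not> (\<exists>c<D. M [c, u] = 0)"
  have pos: "M [c, u] = Suc (M [c, u] - 1)" "M [c, u] - 1 < n" if "c < D" for c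
  proof -
    have "M [c, u] \<noteq> 0" using no that by simp
    then show "M [c, u] = Suc (M [c, u] - 1)" "M [c, u] - 1 < n"
      using arc_colouringD(2)[OF col that u] by linarith+
  qed
  have "inj_on (\<lambda>c. M [c, u] - 1) {..<D}"
  proof (rule inj_onI)
    fix c d assume *: "c \<in> {..<D}" "d \<in> {..<D}" "M [c, u] - 1 = M [d, u] - 1"
    then have cd: "c < D" "d < D" by auto
    have "M [d, u] = Suc (M [c, u] - 1)" unfolding *(3) by (rule pos(1)[OF cd(2)])
    then show "c = d"
      by (rule arc_colouringD(7)[OF col cd u pos(2)[OF cd(1)] pos(1)[OF cd(1)]])
  qed
  moreover have "(u, M [c, u] - 1) \<in> A" if "c < D" for c
    by (rule arc_colouringD(6)[OF col that u pos(2)[OF that] pos(1)[OF that]])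
  then have "(\<lambda>c. M [c, u] - 1) ` {..<D} \<subseteq> {v. (u, v) \<in> A}" by blast
  moreover have "finite {v. (u, v) \<in> A}"
    by (rule finite_subset[of _ "snd ` A"])
      (use arc_colouringD(1)[OF col] in \<open>force, blast intro: finite_subset finite_cartesian_product\<close>)
  ultimately have "card {..<D} \<le> card {v. (u, v) \<in> A}" by (rule card_inj_on_le)
  with few show False by simp
qed

text \<open>The two tables play symmetric roles; this turns \<open>free_out_colour\<close> into its
  counterpart for incoming arcs.\<close>

lemma arc_colouring_converse:
  assumes "arc_colouring n D A M N"
  shows "arc_colouring n D (A\<inverse>) N M"
proof (rule arc_colouringI)
  note D = arc_colouringD[OF assms]
  show "A\<inverse> \<subseteq> {..<n} \<times> {..<n}" using D(1) by blast
  show "N [c, u] \<le> n" "M [c, u] \<le> n" if "c < D" "u < n" for c u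
    using D(2,3)[OF that] by auto
  show *: "N [c, u] = Suc v \<longleftrightarrow> M [c, v] = Suc u" if "c < D" "u < n" "v < n" for c u v
    by (rule D(4)[OF that(1,3,2), symmetric])
  show "\<exists>c<D. N [c, u] = Suc v" if "u < n" "v < n" "(u, v) \<in> A\<inverse>" for u v
    using D(5)[of v u] *[of _ u v] that by auto
  show "(u, v) \<in> A\<inverse>" if "c < D" "u < n" "v < n" "N [c, u] = Suc v" for c u v
    using D(6)[OF that(1,3,2)] *[OF that(1-3)] that(4) by simp
  show "c = c'" if "c < D" "c' < D" "u < n" "v < n" "N [c, u] = Suc v" "N [c', u] = Suc v" for c c' u v
    using D(7)[OF that(1,2,4,3)] *[OF that(1,3,4)] *[OF that(2,3,4)] that(5,6) by simp
qed

section \<open>Kempe exchanges as a program\<close>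

abbreviation seq :: "com \<Rightarrow> com \<Rightarrow> com" (infixr ";;" 60) where "c ;; c' \<equiv> Seq c c'"
abbreviation var :: "string \<Rightarrow> aexp" where "var x \<equiv> Read x []"
abbreviation set_var :: "string \<Rightarrow> aexp \<Rightarrow> com" where "set_var x a \<equiv> Assign x [] a"
abbreviation pred :: "aexp \<Rightarrow> aexp" where "pred a \<equiv> Sub a (Num 1)"
abbreviation succ :: "aexp \<Rightarrow> aexp" where "succ a \<equiv> Add a (Num 1)"

definition find_free :: "string \<Rightarrow> string \<Rightarrow> string \<Rightarrow> com" where
  "find_free a M u = For ''i'' (var ''D'')
     (Cond (Read M [var ''i'', var u]) Skip (set_var a (var ''i'')))"

lemma written_find_free [simp]: "written (find_free a M u) = {a, ''i''}"
  by (auto simp: find_free_def)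

lemma wp_find_free:
  assumes "D \<le> n" "s ''D'' [] = D" "\<exists>c<D. s M [c, s u []] = 0"
    and ne: "distinct [a, M, u, ''i'', ''D'']"
  shows "wp (find_free a M u) (n * 5 + 2) (\<lambda>s'. s' a [] < D \<and> s M [s' a [], s u []] = 0) s"
proof -
  let ?I = "\<lambda>k s'. (\<exists>c<k. s M [c, s u []] = 0) \<longrightarrow> s' a [] < D \<and> s M [s' a [], s u []] = 0"
  have "wp (find_free a M u) (n * (3 + 2) + 2) (\<lambda>s'. s' a [] < D \<and> s M [s' a [], s u []] = 0) s"
    unfolding find_free_def
  proof (rule wp_For[where I = ?I])
    show "wp (Cond (Read M [var ''i'', var u]) Skip (set_var a (var ''i''))) 3 (?I (Suc k)) s'"
      if "k < aval s (var ''D'')" "?I k s'" "s' ''i'' [] = k"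
        "\<And>x. x \<notin> insert ''i'' (written (Cond (Read M [var ''i'', var u]) Skip (set_var a (var ''i'')))) \<Longrightarrow> s' x = s x"
      for k s'
      using that assms by (intro wp_run) (auto simp: store_def less_Suc_eq)
  qed (use assms in \<open>auto simp: store_def\<close>)
  then show ?thesis by simp
qed

text \<open>The variables \<open>z\<close> and \<open>w\<close> keep the shifted encoding of the
  tables: 0 doubles as the branch test "colour free", and \<open>z\<close> can be stored back
  unchanged. The flag \<open>f\<close> is up as long as an arc is pending.\<close>

definition kempe_step :: com where
  "kempe_step =
     set_var ''z'' (Read ''N'' [var ''a'', var ''y'']) ;;
     Cond (var ''z'')
       (Assign ''M'' [var ''a'', pred (var ''z'')] (Num 0) ;;
        Assign ''M'' [var ''a'', var ''x''] (succ (var ''y'')) ;;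
        Assign ''N'' [var ''a'', var ''y''] (succ (var ''x'')) ;;
        set_var ''w'' (Read ''M'' [var ''b'', pred (var ''z'')]) ;;
        Assign ''M'' [var ''b'', pred (var ''z'')] (succ (var ''y'')) ;;
        Cond (var ''w'')
          (Assign ''N'' [var ''b'', pred (var ''w'')] (Num 0) ;;
           Assign ''N'' [var ''b'', var ''y''] (var ''z'') ;;
           set_var ''x'' (pred (var ''z'')) ;;
           set_var ''y'' (pred (var ''w'')))
          (Assign ''N'' [var ''b'', var ''y''] (var ''z'') ;;
           set_var ''f'' (Num 0)))
       (Assign ''M'' [var ''a'', var ''x''] (succ (var ''y'')) ;;
        Assign ''N'' [var ''a'', var ''y''] (succ (var ''x'')) ;;
        set_var ''f'' (Num 0))"

text \<open>The size of \<open>Z\<close> is tied to the loop counter, which converts the progress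
  measure into a loop invariant and allows a loop of fixed length.\<close>

definition kempe_inv ::
    "nat \<Rightarrow> nat \<Rightarrow> (nat \<times> nat) set \<Rightarrow> nat \<Rightarrow> nat \<Rightarrow> nat \<Rightarrow> state \<Rightarrow> bool" where
  "kempe_inv n D A a b k s \<longleftrightarrow>
     (if s ''f'' [] = 0 then arc_colouring n D A (s ''M'') (s ''N'')
      else \<exists>Z. card Z = k \<and> kempe n D A a b (s ''M'') (s ''N'') (s ''x'' []) (s ''y'' []) Z)"

lemma kempe_step:
  assumes inv: "kempe_inv n D A a b k s" and f: "s ''f'' [] \<noteq> 0"
    and ab: "s ''a'' [] = a" "s ''b'' [] = b" "a < D" "b < D"
  shows "kempe_inv n D A a b (Suc k) (run kempe_step s)"
proof -
  define x y M N where "x = s ''x'' []" and "y = s ''y'' []" and "M = s ''M''" and "N = s ''N''"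
  note defs = x_def[symmetric] y_def[symmetric] M_def[symmetric] N_def[symmetric]
  obtain Z where Z: "card Z = k" and kz: "kempe n D A a b M N x y Z"
    using inv f by (auto simp: kempe_inv_def defs)
  show ?thesis
  proof (cases "N [a, y]")
    case 0
    have "run kempe_step s ''f'' [] = 0" "run kempe_step s ''M'' = M([a, x] := Suc y)"
      "run kempe_step s ''N'' = N([a, y] := Suc x)"
      using ab 0 by (simp_all add: kempe_step_def store_def defs)
    with kempe_finish_first[OF kz ab(3) 0] show ?thesis by (simp add: kempe_inv_def)
  next
    case N: (Suc x')
    note E = kempe_exchange[OF kz ab(3,4) N]
    show ?thesis
    proof (cases "M [b, x']")
      case 0
      have "run kempe_step s ''f'' [] = 0"
        "run kempe_step s ''M'' = M([a, x'] := 0, [a, x] := Suc y, [b, x'] := Suc y)"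
        "run kempe_step s ''N'' = N([a, y] := Suc x, [b, y] := Suc x')"
        using ab N 0 E(3,4) by (simp_all add: kempe_step_def store_def defs)
      with kempe_finish_second[OF kz ab(3,4) N 0] show ?thesis by (simp add: kempe_inv_def)
    next
      case M: (Suc y')
      have *: "run kempe_step s ''f'' [] \<noteq> 0"
        "run kempe_step s ''M'' = M([a, x'] := 0, [a, x] := Suc y, [b, x'] := Suc y)"
        "run kempe_step s ''N'' = N([a, y] := Suc x, [b, y'] := 0, [b, y] := Suc x')"
        "run kempe_step s ''x'' [] = x'" "run kempe_step s ''y'' [] = y'"
        using ab N M E(3,4) f by (simp_all add: kempe_step_def store_def defs)
      have "finite Z" using kz by (auto simp: kempe_def intro: finite_subset)
      then have "card (insert y Z) = Suc k" using kempe_next(2)[OF kz ab(3,4) N M] Z by simp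
      then show ?thesis
        unfolding kempe_inv_def if_not_P[OF *(1)] *(2-5)
        using kempe_next(1)[OF kz ab(3,4) N M] by blast
    qed
  qed
qed

definition insert_arc :: com where
  "insert_arc =
     find_free ''a'' ''M'' ''u'' ;; find_free ''b'' ''N'' ''v'' ;;
     (set_var ''x'' (var ''u'') ;; set_var ''y'' (var ''v'') ;; set_var ''f'' (Num 1)) ;;
     For ''k'' (var ''n'') (Cond (var ''f'') kempe_step Skip)"

lemma written_kempe_step [simp]:
  "written kempe_step = {''z'', ''M'', ''N'', ''w'', ''x'', ''y'', ''f''}"
  by (auto simp: kempe_step_def)

lemma written_insert_arc [simp]:
  "written insert_arc = {''a'', ''b'', ''i'', ''k'', ''z'', ''M'', ''N'', ''w'', ''x'', ''y'', ''f''}"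
  by (auto simp: insert_arc_def)

lemma wp_insert_arc:
  assumes n: "s ''n'' [] = n" "s ''D'' [] = D" "D \<le> n"
    and uv: "s ''u'' [] = u" "s ''v'' [] = v" "u < n" "v < n" "(u, v) \<notin> A"
    and col: "arc_colouring n D A (s ''M'') (s ''N'')"
    and free: "\<exists>c<D. s ''M'' [c, u] = 0" "\<exists>c<D. s ''N'' [c, v] = 0"
  shows "wp insert_arc (31 * n + 20) (\<lambda>s'. arc_colouring n D (insert (u, v) A) (s' ''M'') (s' ''N'')) s"
proof -
  let ?Q = "\<lambda>s'. arc_colouring n D (insert (u, v) A) (s' ''M'') (s' ''N'')"
  let ?I = "set_var ''x'' (var ''u'') ;; set_var ''y'' (var ''v'') ;; set_var ''f'' (Num 1)"
  let ?F = "For ''k'' (var ''n'') (Cond (var ''f'') kempe_step Skip)"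
  have loop: "wp ?F (n * (19 + 2) + 2) ?Q s'"
    if s': "s' ''n'' [] = n" and ab: "s' ''a'' [] < D" "s' ''b'' [] < D" "s' ''M'' [s' ''a'' [], u] = 0" "s' ''N'' [s' ''b'' [], v] = 0"
      and xy: "s' ''x'' [] = u" "s' ''y'' [] = v" "s' ''f'' [] = 1" and MN: "s' ''M'' = s ''M''" "s' ''N'' = s ''N''" for s'
  proof (rule wp_For[where I = "kempe_inv n D (insert (u, v) A) (s' ''a'' []) (s' ''b'' [])"])
    have "insert (u, v) A - {(u, v)} = A" using uv by auto
    then have "kempe n D (insert (u, v) A) (s' ''a'' []) (s' ''b'' []) (s' ''M'') (s' ''N'') u v {}"
      unfolding kempe_def using ab uv col MN by simp
    then show "kempe_inv n D (insert (u, v) A) (s' ''a'' []) (s' ''b'' []) 0 s'"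
      unfolding kempe_inv_def using xy by (simp, intro exI[of _ "{}"]) simp
    show "wp (Cond (var ''f'') kempe_step Skip) 19
        (kempe_inv n D (insert (u, v) A) (s' ''a'' []) (s' ''b'' []) (Suc k)) s2"
      if "kempe_inv n D (insert (u, v) A) (s' ''a'' []) (s' ''b'' []) k s2"
       "\<And>x. x \<notin> insert ''k'' (written (Cond (var ''f'') kempe_step Skip)) \<Longrightarrow> s2 x = s' x" for k s2
    proof (cases "s2 ''f'' [] = 0")
      case True
      then show ?thesis using that(1) by (intro wp_run) (simp_all add: kempe_step_def kempe_inv_def)
    next
      case False
      with kempe_step[OF that(1) False _ _ ab(1,2)] that(2) show ?thesis
        by (intro wp_run) (simp_all add: kempe_step_def)
    qed
    show "?Q s2" if "kempe_inv n D (insert (u, v) A) (s' ''a'' []) (s' ''b'' []) (aval s' (var ''n'')) s2" for s2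
    proof -
      \<comment> \<open>Colour \<open>b\<close> is free at the pending head but occupied at all of
        \<open>Z\<close>, so \<open>Z\<close> misses a vertex and cannot have reached size
        \<open>n\<close>. Thus the flag is down after \<open>n\<close> iterations.\<close>
      have False if "card Z = n" "kempe n D (insert (u, v) A) (s' ''a'' []) (s' ''b'' [])
          (s2 ''M'') (s2 ''N'') (s2 ''x'' []) (s2 ''y'' []) Z" for Z
      proof -
        from that(2) have Z: "Z \<subseteq> {..<n}" "s2 ''y'' [] < n" "s2 ''y'' [] \<notin> Z" by (auto simp: kempe_def)
        then have "card Z < card {..<n}" by (intro psubset_card_mono) auto
        with that(1) show False by simp
      qed
      with that s' show ?thesis by (auto simp: kempe_inv_def split: if_splits)
    qed
  qed (use s' in \<open>auto simp: kempe_inv_def store_def\<close>)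
  have "wp insert_arc ((n * 5 + 2) + ((n * 5 + 2) + (3 + (n * (19 + 2) + 2)))) ?Q s"
    unfolding insert_arc_def
  proof (rule wp_Seq_step[OF wp_find_free[where D = D and s = s and M = "''M''" and u = "''u''" and a = "''a''", OF n(3,2)]])
    fix s1 assume s1: "s1 ''a'' [] < D \<and> s ''M'' [s1 ''a'' [], s ''u'' []] = 0"
      "\<And>x. x \<notin> written (find_free ''a'' ''M'' ''u'') \<Longrightarrow> s1 x = s x"
    show "wp (find_free ''b'' ''N'' ''v'' ;; ?I ;; ?F) ((n * 5 + 2) + (3 + (n * (19 + 2) + 2))) ?Q s1"
    proof (rule wp_Seq_step[OF wp_find_free[where D = D and s = s1 and M = "''N''" and u = "''v''" and a = "''b''", OF n(3)]])
      fix s2 assume s2: "s2 ''b'' [] < D \<and> s1 ''N'' [s2 ''b'' [], s1 ''v'' []] = 0"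
        "\<And>x. x \<notin> written (find_free ''b'' ''N'' ''v'') \<Longrightarrow> s2 x = s1 x"
      show "wp (?I ;; ?F) (3 + (n * (19 + 2) + 2)) ?Q s2"
        using s1 s2 n uv by (intro wp_Seq wp_run loop) (simp_all add: store_def)
    qed (use s1 n uv free in simp_all)
  qed (use n uv free in simp_all)
  then show ?thesis by (rule wp_mono) auto
qed

section \<open>Maximum degree and the colouring of all arcs\<close>

definition arcs :: "nat \<Rightarrow> nat set set \<Rightarrow> (nat \<times> nat) set" where
  "arcs n E = {(u, v). u < n \<and> v < n \<and> {u, v} \<in> E}"

text \<open>The degree is not part of the input. The maximum is taken, rather than the degree of one
  vertex, because the time bound must hold on all graphs, including irregular ones, and with the
  maximum degree as number of colours the Kempe exchanges go through on every graph.\<close>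

definition max_degree :: com where
  "max_degree =
     set_var ''D'' (Num 0) ;;
     For ''u'' (var ''n'')
       (set_var ''t'' (Num 0) ;;
        For ''v'' (var ''n'') (set_var ''t'' (Add (var ''t'') (Read ''G'' [var ''u'', var ''v'']))) ;;
        Cond (Sub (var ''t'') (var ''D'')) (set_var ''D'' (var ''t'')) Skip)"

lemma written_max_degree [simp]: "written max_degree = {''D'', ''u'', ''v'', ''t''}"
  by (auto simp: max_degree_def)

lemma wp_max_degree:
  assumes n: "s ''n'' [] = n" and G: "\<And>i j. s ''G'' [i, j] = of_bool ({i, j} \<in> E)"
  shows "wp max_degree (10 * (n + 1) * (n + 1))
    (\<lambda>s'. (\<forall>u<n. card {v. (u, v) \<in> arcs n E} \<le> s' ''D'' []) \<and>
       (s' ''D'' [] = 0 \<or> (\<exists>u<n. s' ''D'' [] = card {v. (u, v) \<in> arcs n E}))) s"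
proof -
  let ?deg = "\<lambda>u. card {v. (u, v) \<in> arcs n E}"
  let ?I = "\<lambda>k s'. (\<forall>u<k. ?deg u \<le> s' ''D'' []) \<and> (s' ''D'' [] = 0 \<or> (\<exists>u<n. s' ''D'' [] = ?deg u))"
  let ?inner = "For ''v'' (var ''n'') (set_var ''t'' (Add (var ''t'') (Read ''G'' [var ''u'', var ''v''])))"
  let ?body = "set_var ''t'' (Num 0) ;; ?inner ;; Cond (Sub (var ''t'') (var ''D'')) (set_var ''D'' (var ''t'')) Skip"
  have inner: "wp ?inner (n * (1 + 2) + 2) (\<lambda>s2. s2 ''t'' [] = ?deg u) s'"
    if "s' ''u'' [] = u" "s' ''t'' [] = 0" "s' ''n'' [] = n" "s' ''G'' = s ''G''" "u < n" for s' u
  proof (rule wp_For[where I = "\<lambda>k s2. s2 ''t'' [] = card {v. v < k \<and> {u, v} \<in> E}"])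
    show "wp (set_var ''t'' (Add (var ''t'') (Read ''G'' [var ''u'', var ''v'']))) 1
        (\<lambda>s2. s2 ''t'' [] = card {v. v < Suc k \<and> {u, v} \<in> E}) s3"
      if "s3 ''t'' [] = card {v. v < k \<and> {u, v} \<in> E}" "s3 ''v'' [] = k"
        "\<And>x. x \<notin> insert ''v'' (written (set_var ''t'' (Add (var ''t'') (Read ''G'' [var ''u'', var ''v''])))) \<Longrightarrow> s3 x = s' x"
      for k s3
    proof -
      have "{v. v < Suc k \<and> {u, v} \<in> E} =
          (if {u, k} \<in> E then insert k {v. v < k \<and> {u, v} \<in> E} else {v. v < k \<and> {u, v} \<in> E})"
        by (auto simp: less_Suc_eq)
      then show ?thesis
        using that(1,2) that(3)[of "''u''"] that(3)[of "''G''"] \<open>s' ''u'' [] = u\<close> \<open>s' ''G'' = s ''G''\<close>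
        by (intro wp_run) (auto simp: store_def G)
    qed
    show "s2 ''t'' [] = ?deg u" if "s2 ''t'' [] = card {v. v < aval s' (var ''n'') \<and> {u, v} \<in> E}" for s2
      using that \<open>s' ''n'' [] = n\<close> \<open>u < n\<close> by (simp add: arcs_def)
  qed (use that in \<open>auto simp: store_def\<close>)
  have body: "wp ?body (1 + ((n * (1 + 2) + 2) + 3)) (?I (Suc k)) s'"
    if k: "k < n" "?I k s'" "s' ''u'' [] = k" "s' ''n'' [] = n" "s' ''G'' = s ''G''" for k s'
  proof (rule wp_Seq, rule wp_run)
    show "wp (?inner ;; Cond (Sub (var ''t'') (var ''D'')) (set_var ''D'' (var ''t'')) Skip)
       ((n * (1 + 2) + 2) + 3) (?I (Suc k)) (run (set_var ''t'' (Num 0)) s')"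
    proof (rule wp_Seq_step[OF inner])
      show "wp (Cond (Sub (var ''t'') (var ''D'')) (set_var ''D'' (var ''t'')) Skip) 3 (?I (Suc k)) s2"
        if s2: "s2 ''t'' [] = ?deg k" "\<And>x. x \<notin> written ?inner \<Longrightarrow> s2 x = run (set_var ''t'' (Num 0)) s' x" for s2
      proof (rule wp_run)
        have D: "s2 ''D'' [] = s' ''D'' []" using s2(2) by (simp add: store_def)
        show "?I (Suc k) (run (Cond (Sub (var ''t'') (var ''D'')) (set_var ''D'' (var ''t'')) Skip) s2)"
        proof (cases "?deg k \<le> s' ''D'' []")
          case True
          then show ?thesis using k(2) D s2(1) by (auto simp: less_Suc_eq)
        next
          case False
          then have "\<forall>u<Suc k. ?deg u \<le> ?deg k" using k(2) by (auto simp: less_Suc_eq)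
          then show ?thesis using False k(1) D s2(1) by (auto simp: store_def)
        qed
      qed simp_all
    qed (use k in \<open>simp_all add: store_def\<close>)
  qed simp_all
  have loop: "wp (For ''u'' (var ''n'') ?body) (n * ((1 + ((n * (1 + 2) + 2) + 3)) + 2) + 2) (?I n) s'"
    if s': "s' ''D'' [] = 0" "\<And>x. x \<noteq> ''D'' \<Longrightarrow> s' x = s x" for s'
  proof (rule wp_For[where I = ?I])
    show "wp ?body (1 + ((n * (1 + 2) + 2) + 3)) (?I (Suc k)) s2"
      if "k < aval s' (var ''n'')" "?I k s2" "s2 ''u'' [] = k"
        "\<And>x. x \<notin> insert ''u'' (written ?body) \<Longrightarrow> s2 x = s' x" for k s2
      by (rule body) (use that n s' in simp_all)
  qed (use s' n in \<open>auto simp: store_def\<close>)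
  have "wp max_degree (1 + (n * ((1 + ((n * (1 + 2) + 2) + 3)) + 2) + 2)) (?I n) s"
    unfolding max_degree_def by (rule wp_Seq, rule wp_run, simp, simp, rule loop) (auto simp: store_def)
  then show ?thesis by (rule wp_mono) (auto simp: algebra_simps)
qed

definition colour_arcs :: com where
  "colour_arcs =
     For ''u'' (var ''n'') (For ''v'' (var ''n'')
       (Cond (Read ''G'' [var ''u'', var ''v'']) insert_arc Skip))"

lemma written_colour_arcs [simp]:
  "written colour_arcs = {''u'', ''v'', ''a'', ''b'', ''i'', ''k'', ''z'', ''M'', ''N'', ''w'', ''x'', ''y'', ''f''}"
  by (auto simp: colour_arcs_def)

lemma wp_colour_arcs:
  assumes n: "s ''n'' [] = n" "s ''D'' [] = D" "D \<le> n"
    and G: "\<And>i j. s ''G'' [i, j] = of_bool ({i, j} \<in> E)"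
    and deg: "\<And>u. u < n \<Longrightarrow> card {v. (u, v) \<in> arcs n E} \<le> D"
    and empty: "s ''M'' = (\<lambda>_. 0)" "s ''N'' = (\<lambda>_. 0)"
  shows "wp colour_arcs (n * ((n * ((31 * n + 21) + 2) + 2) + 2) + 2)
    (\<lambda>s'. arc_colouring n D (arcs n E) (s' ''M'') (s' ''N'')) s"
proof -
  let ?A = "\<lambda>u v. {(i, j) \<in> arcs n E. i < u \<or> i = u \<and> j < v}"
  let ?I = "\<lambda>u v s'. arc_colouring n D (?A u v) (s' ''M'') (s' ''N'')"
  have fin: "finite {v. (u, v) \<in> arcs n E}" for u
    by (rule finite_subset[of _ "{..<n}"]) (auto simp: arcs_def)
  have free: "\<exists>c<D. M [c, u] = 0" "\<exists>c<D. N [c, v] = 0"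
    if col: "arc_colouring n D (?A u v) M N" and uv: "(u, v) \<in> arcs n E" for M N u v
  proof -
    have lt: "u < n" "v < n" "(v, u) \<in> arcs n E" using uv by (auto simp: arcs_def insert_commute)
    have "card {w. (u, w) \<in> ?A u v} < card {w. (u, w) \<in> arcs n E}"
      using uv by (intro psubset_card_mono fin) auto
    with free_out_colour[OF col lt(1)] deg[OF lt(1)] show "\<exists>c<D. M [c, u] = 0" by simp
    \<comment> \<open>Incoming arcs are counted through the symmetry of adjacency: those already
      coloured come from neighbours of \<open>v\<close>, and \<open>u\<close> is not yet among
      them.\<close>
    have "card {w. (v, w) \<in> (?A u v)\<inverse>} < card {w. (v, w) \<in> arcs n E}"
    proof (intro psubset_card_mono fin psubsetI)
      show "{w. (v, w) \<in> (?A u v)\<inverse>} \<subseteq> {w. (v, w) \<in> arcs n E}"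
        by (auto simp: arcs_def insert_commute)
      have "u \<notin> {w. (v, w) \<in> (?A u v)\<inverse>}" by simp
      then show "{w. (v, w) \<in> (?A u v)\<inverse>} \<noteq> {w. (v, w) \<in> arcs n E}" using lt(3) by blast
    qed
    with free_out_colour[OF arc_colouring_converse[OF col] lt(2)] deg[OF lt(2)]
    show "\<exists>c<D. N [c, v] = 0" by simp
  qed
  let ?step = "Cond (Read ''G'' [var ''u'', var ''v'']) insert_arc Skip"
  have step: "wp ?step (31 * n + 21) (?I u (Suc v)) s'"
    if uv: "u < n" "v < n" and I: "?I u v s'" and s': "s' ''u'' [] = u" "s' ''v'' [] = v" "s' ''n'' [] = n" "s' ''D'' [] = D"
      "s' ''G'' = s ''G''" for u v s'
  proof (cases "(u, v) \<in> arcs n E")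
    case True
    then have "?A u (Suc v) = insert (u, v) (?A u v)" by auto
    moreover have "wp insert_arc (31 * n + 20)
      (\<lambda>s2. arc_colouring n D (insert (u, v) (?A u v)) (s2 ''M'') (s2 ''N'')) s'"
      by (rule wp_insert_arc) (use s' uv n I free[OF I True] in auto)
    ultimately have "wp ?step (Suc (31 * n + 20)) (?I u (Suc v)) s'"
      using True s' G by (intro wp_Cond) (simp_all add: arcs_def)
    then show ?thesis by (rule wp_mono) simp_all
  next
    case False
    then have "?A u (Suc v) = ?A u v" by (auto simp: less_Suc_eq)
    moreover have "wp Skip 1 (?I u v) s'" using I by (intro wp_run) simp_all
    then have "wp Skip (31 * n + 20) (?I u v) s'" by (rule wp_mono) auto
    ultimately have "wp ?step (Suc (31 * n + 20)) (?I u (Suc v)) s'"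
      using False s' uv G by (intro wp_Cond) (simp_all add: arcs_def)
    then show ?thesis by (rule wp_mono) simp_all
  qed
  have inner: "wp (For ''v'' (var ''n'') ?step) (n * ((31 * n + 21) + 2) + 2) (?I (Suc u) 0) s'"
    if I: "?I u 0 s'" and s': "u < n" "s' ''u'' [] = u" "s' ''n'' [] = n" "s' ''D'' [] = D" "s' ''G'' = s ''G''" for u s'
  proof (rule wp_For[where I = "?I u"])
    show "wp ?step (31 * n + 21) (?I u (Suc v)) s2"
      if "v < aval s' (var ''n'')" "?I u v s2" "s2 ''v'' [] = v"
       "\<And>x. x \<notin> insert ''v'' (written ?step) \<Longrightarrow> s2 x = s' x" for v s2
      by (rule step) (use that s' in simp_all)
    have "?A u n = ?A (Suc u) 0" by (auto simp: arcs_def)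
    then show "?I (Suc u) 0 s2" if "?I u (aval s' (var ''n'')) s2" for s2
      using that s' by simp
  qed (use that in \<open>simp_all add: store_def\<close>)
  show ?thesis unfolding colour_arcs_def
  proof (rule wp_For[where I = "\<lambda>u. ?I u 0"])
    show "wp (For ''v'' (var ''n'') ?step) (n * ((31 * n + 21) + 2) + 2) (?I (Suc u) 0) s'"
      if "u < aval s (var ''n'')" "?I u 0 s'" "s' ''u'' [] = u"
       "\<And>x. x \<notin> insert ''u'' (written (For ''v'' (var ''n'') ?step)) \<Longrightarrow> s' x = s x" for u s'
      by (rule inner) (use that n in simp_all)
    have "?A 0 0 = {}" by auto
    then show "?I 0 0 s" unfolding arc_colouring_def using empty by simp
    have "?A n 0 = arcs n E" by (auto simp: arcs_def)
    then show "arc_colouring n D (arcs n E) (s' ''M'') (s' ''N'')" if "?I (aval s (var ''n'')) 0 s'" for s'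
      using that n by simp
  qed (use n in \<open>simp_all add: store_def\<close>)
qed

section \<open>Number of rounds and bound on the walk entries\<close>

definition rounds :: "nat \<Rightarrow> com" where
  "rounds K =
     (set_var ''p'' (Num 1) ;; set_var ''L'' (Num 0)) ;;
     For ''i'' (var ''n'') (Cond (Sub (var ''n'') (var ''p''))
       (set_var ''p'' (Add (var ''p'') (var ''p'')) ;; set_var ''L'' (succ (var ''L''))) Skip) ;;
     (set_var ''T'' (Num 0) ;; set_var ''B'' (Num 1)) ;;
     For ''i'' (Num K) (For ''j'' (var ''L'')
       (set_var ''T'' (succ (var ''T'')) ;; set_var ''B'' (Add (var ''B'') (var ''B''))))"

lemma written_rounds [simp]: "written (rounds K) = {''p'', ''L'', ''T'', ''B'', ''i'', ''j''}"
  by (auto simp: rounds_def)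

text \<open>The upper bound on \<open>2 ^ L\<close> is what makes \<open>2 ^ (K * L)\<close>, at
  most \<open>(2 * n + 1) ^ K\<close>, polynomial in \<open>n\<close> for fixed \<open>K\<close>.
  The summand 1 covers \<open>n = 0\<close>.\<close>

lemma wp_rounds:
  assumes n: "s ''n'' [] = n"
  shows "wp (rounds K) (20 * (K + 1) * (n + 1))
    (\<lambda>s'. \<exists>L. L \<le> n \<and> n \<le> 2 ^ L \<and> 2 ^ L \<le> 2 * n + 1 \<and> s' ''T'' [] = K * L \<and> s' ''B'' [] = 2 ^ (K * L)) s"
proof -
  let ?I = "\<lambda>k s'. s' ''p'' [] = 2 ^ s' ''L'' [] \<and> s' ''p'' [] \<le> 2 * n + 1 \<and> s' ''L'' [] \<le> k \<and>
    (s' ''p'' [] < n \<longrightarrow> s' ''L'' [] = k)"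
  let ?b = "Cond (Sub (var ''n'') (var ''p''))
       (set_var ''p'' (Add (var ''p'') (var ''p'')) ;; set_var ''L'' (succ (var ''L''))) Skip"
  let ?F = "For ''i'' (var ''n'') ?b"
  let ?G = "For ''i'' (Num K) (For ''j'' (var ''L'')
       (set_var ''T'' (succ (var ''T'')) ;; set_var ''B'' (Add (var ''B'') (var ''B''))))"
  let ?Q = "\<lambda>s'. \<exists>L. L \<le> n \<and> n \<le> 2 ^ L \<and> 2 ^ L \<le> 2 * n + 1 \<and> s' ''T'' [] = K * L \<and> s' ''B'' [] = 2 ^ (K * L)"
  have F: "wp ?F (n * (4 + 2) + 2) (?I n) s'"
    if s': "s' ''n'' [] = n" "s' ''p'' [] = 1" "s' ''L'' [] = 0" for s'
  proof (rule wp_For[where I = ?I])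
    show "wp ?b 4 (?I (Suc k)) s2"
      if "k < aval s' (var ''n'')" "?I k s2" "\<And>x. x \<notin> insert ''i'' (written ?b) \<Longrightarrow> s2 x = s' x" for k s2
    proof -
      have n2: "s2 ''n'' [] = n" using that(3) s' by simp
      have "?I (Suc k) (run ?b s2)"
      proof (cases "s2 ''p'' [] < n")
        case True
        then have "s2 ''L'' [] = k" "s2 ''p'' [] = 2 ^ k" "2 ^ k < n" using that(2) by auto
        with n2 show ?thesis by (simp add: store_def)
      next
        case False
        then show ?thesis using that(2) n2 by simp
      qed
      then show ?thesis by (rule wp_run[rotated 2]) simp_all
    qed
  qed (use s' in \<open>simp_all add: store_def\<close>)
  have G: "wp ?G (K * ((n * (2 + 2) + 2) + 2) + 2) ?Q s'"
    if s': "s' ''T'' [] = 0" "s' ''B'' [] = 1" "s' ''L'' [] = L" and L: "L \<le> n" "n \<le> 2 ^ L" "2 ^ L \<le> 2 * n + 1" for s' L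
  proof (rule wp_For[where I = "\<lambda>k s2. s2 ''T'' [] = k * L \<and> s2 ''B'' [] = 2 ^ (k * L)"])
    show "wp (For ''j'' (var ''L'')
       (set_var ''T'' (succ (var ''T'')) ;; set_var ''B'' (Add (var ''B'') (var ''B''))))
       (n * (2 + 2) + 2) (\<lambda>s2. s2 ''T'' [] = Suc k * L \<and> s2 ''B'' [] = 2 ^ (Suc k * L)) s2"
      if s2: "s2 ''T'' [] = k * L \<and> s2 ''B'' [] = 2 ^ (k * L)"
        "\<And>x. x \<notin> insert ''i'' (written (For ''j'' (var ''L'')
       (set_var ''T'' (succ (var ''T'')) ;; set_var ''B'' (Add (var ''B'') (var ''B''))))) \<Longrightarrow> s2 x = s' x"
      for k s2
    proof (rule wp_For[where I = "\<lambda>m s3. s3 ''T'' [] = k * L + m \<and> s3 ''B'' [] = 2 ^ (k * L + m)"])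
      show "wp (set_var ''T'' (succ (var ''T'')) ;; set_var ''B'' (Add (var ''B'') (var ''B''))) 2
        (\<lambda>s3. s3 ''T'' [] = k * L + Suc m \<and> s3 ''B'' [] = 2 ^ (k * L + Suc m)) s3"
        if "s3 ''T'' [] = k * L + m \<and> s3 ''B'' [] = 2 ^ (k * L + m)" for m s3
        using that by (intro wp_run) (simp_all add: store_def)
      show "s3 ''T'' [] = Suc k * L \<and> s3 ''B'' [] = 2 ^ (Suc k * L)"
        if "s3 ''T'' [] = k * L + aval s2 (var ''L'') \<and> s3 ''B'' [] = 2 ^ (k * L + aval s2 (var ''L''))" for s3
        using that s2(2)[of "''L''"] s' by (simp add: add.commute)
    qed (use s2 s' L in \<open>simp_all add: store_def\<close>)
  qed (use s' L in \<open>auto simp: store_def\<close>)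
  have tail: "wp ((set_var ''T'' (Num 0) ;; set_var ''B'' (Num 1)) ;; ?G) (2 + (K * ((n * (2 + 2) + 2) + 2) + 2)) ?Q s'"
    if I: "?I n s'" for s'
  proof (rule wp_Seq, rule wp_run)
    \<comment> \<open>If \<open>p\<close> were still below \<open>n\<close>, every one of the
      \<open>n\<close> iterations would have doubled it, and it would equal
      \<open>2 ^ n\<close>.\<close>
    have "n < 2 ^ n" by (rule less_exp)
    then have "n \<le> s' ''p'' []" using I by (cases "s' ''p'' [] < n") auto
    then show "wp ?G (K * ((n * (2 + 2) + 2) + 2) + 2) ?Q (run (set_var ''T'' (Num 0) ;; set_var ''B'' (Num 1)) s')"
      using I by (intro G[of _ "s' ''L'' []"]) (simp_all add: store_def)
  qed simp_all
  have "wp (rounds K) (2 + ((n * (4 + 2) + 2) + (2 + (K * ((n * (2 + 2) + 2) + 2) + 2)))) ?Q s"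
    unfolding rounds_def
  proof (rule wp_Seq, rule wp_run)
    show "wp (?F ;; (set_var ''T'' (Num 0) ;; set_var ''B'' (Num 1)) ;; ?G)
      ((n * (4 + 2) + 2) + (2 + (K * ((n * (2 + 2) + 2) + 2) + 2))) ?Q
      (run (set_var ''p'' (Num 1) ;; set_var ''L'' (Num 0)) s)"
      by (rule wp_Seq_step[OF F tail]) (use n in \<open>simp_all add: store_def\<close>)
  qed simp_all
  then show ?thesis by (rule wp_mono) (auto simp: algebra_simps)
qed

section \<open>Greedy selection of colours\<close>

text \<open>The lazy walk from \<open>x\<close>, multiplied by \<open>2 ^ j\<close> to stay among
  the integers. Mass moves against the arcs: \<open>v\<close> collects from the head of its own arc,
  which makes one step the average of a function and its composition with the permutation.\<close>

fun walk :: "(nat list \<Rightarrow> nat) \<Rightarrow> (nat \<Rightarrow> nat) \<Rightarrow> nat \<Rightarrow> nat \<Rightarrow> nat \<Rightarrow> nat" where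
  "walk M sel 0 x v = of_bool (x = v)"
| "walk M sel (Suc j) x v = walk M sel j x v + walk M sel j x (M [sel j, v] - 1)"

lemma walk_cong: "(\<And>i. i < j \<Longrightarrow> sel i = sel' i) \<Longrightarrow> walk M sel j = walk M sel' j"
proof (induction j)
  case (Suc j)
  then have "walk M sel j = walk M sel' j" "sel j = sel' j" by auto
  then show ?case by (auto simp: fun_eq_iff)
qed (simp add: fun_eq_iff)

lemma walk_le: "walk M sel j x v \<le> 2 ^ j"
proof (induction j arbitrary: v)
  case (Suc j)
  show ?case using Suc.IH[of v] Suc.IH[of "M [sel j, v] - 1"] by simp
qed simp

text \<open>Squares of the plain integer entries, without subtracting the mean: when the classes are
  permutations the row sums are fixed, so by \<open>step_cost_eq\<close> these numbers rank the
  colours exactly as the squared distances to uniform do.\<close>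

definition step_cost :: "nat \<Rightarrow> (nat list \<Rightarrow> nat) \<Rightarrow> (nat \<Rightarrow> nat \<Rightarrow> nat) \<Rightarrow> nat \<Rightarrow> nat" where
  "step_cost n M f c = (\<Sum>x<n. \<Sum>v<n. (f x v + f x (M [c, v] - 1))\<^sup>2)"

text \<open>
  The machine has no multiplication, so r is squared by adding it r times; the loop runs up to the
  bound B of all entries in order to have a length that does not depend on r.
\<close>

definition compute_cost :: com where
  "compute_cost = set_var ''q'' (Num 0) ;;
     For ''x'' (var ''n'') (For ''v'' (var ''n'')
       (set_var ''r'' (Add (Read ''P'' [var ''j'', var ''x'', var ''v''])
          (Read ''P'' [var ''j'', var ''x'', pred (Read ''M'' [var ''c'', var ''v''])])) ;;
        For ''i'' (var ''B'')
          (Cond (Sub (var ''r'') (var ''i'')) (set_var ''q'' (Add (var ''q'') (var ''r''))) Skip)))"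

lemma written_compute_cost [simp]: "written compute_cost = {''q'', ''x'', ''v'', ''r'', ''i''}"
  by (auto simp: compute_cost_def)

lemma wp_compute_cost:
  assumes n: "s ''n'' [] = n" "s ''j'' [] = j" "s ''c'' [] = c" "s ''B'' [] = B"
    and M: "\<And>v. v < n \<Longrightarrow> s ''M'' [c, v] \<le> n"
    and P: "\<And>x v. x < n \<Longrightarrow> v < n \<Longrightarrow> s ''P'' [j, x, v] = f x v"
    and small: "\<And>x v w. f x v + f x w \<le> B"
  shows "wp compute_cost (1 + (n * ((n * ((1 + (B * (3 + 2) + 2)) + 2) + 2) + 2) + 2))
    (\<lambda>s'. s' ''q'' [] = step_cost n (s ''M'') f c) s"
proof -
  let ?M = "s ''M''"
  let ?g = "\<lambda>x v. f x v + f x (?M [c, v] - 1)"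
  let ?mul = "For ''i'' (var ''B'')
     (Cond (Sub (var ''r'') (var ''i'')) (set_var ''q'' (Add (var ''q'') (var ''r''))) Skip)"
  let ?set = "set_var ''r'' (Add (Read ''P'' [var ''j'', var ''x'', var ''v''])
          (Read ''P'' [var ''j'', var ''x'', pred (Read ''M'' [var ''c'', var ''v''])]))"
  have mul: "wp ?mul (B * (3 + 2) + 2) (\<lambda>s2. s2 ''q'' [] = q + r\<^sup>2) s'"
    if s': "s' ''q'' [] = q" "s' ''r'' [] = r" "s' ''B'' [] = B" and r: "r \<le> B" for s' q r
  proof (rule wp_For[where I = "\<lambda>k s2. s2 ''q'' [] = q + r * min r k"])
    show "wp (Cond (Sub (var ''r'') (var ''i'')) (set_var ''q'' (Add (var ''q'') (var ''r''))) Skip) 3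
        (\<lambda>s2. s2 ''q'' [] = q + r * min r (Suc k)) s2"
      if "s2 ''q'' [] = q + r * min r k" "s2 ''i'' [] = k"
        "\<And>x. x \<notin> insert ''i'' (written (Cond (Sub (var ''r'') (var ''i''))
            (set_var ''q'' (Add (var ''q'') (var ''r''))) Skip)) \<Longrightarrow> s2 x = s' x" for k s2
      using that s' by (intro wp_run) (auto simp: store_def min_def not_less_eq_eq le_Suc_eq)
    show "s2 ''q'' [] = q + r\<^sup>2" if "s2 ''q'' [] = q + r * min r (aval s' (var ''B''))" for s2
      using that s' r by (simp add: power2_eq_square)
  qed (use s' in \<open>auto simp: store_def\<close>)
  have inner: "wp (For ''v'' (var ''n'') (?set ;; ?mul)) (n * ((1 + (B * (3 + 2) + 2)) + 2) + 2)
      (\<lambda>s2. s2 ''q'' [] = q + (\<Sum>v<n. (?g x v)\<^sup>2)) s'"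
    if s': "s' ''q'' [] = q" "s' ''x'' [] = x" "x < n" "\<And>y. y \<notin> {''q'', ''x'', ''v'', ''r'', ''i''} \<Longrightarrow> s' y = s y"
    for s' q x
  proof (rule wp_For[where I = "\<lambda>k s2. s2 ''q'' [] = q + (\<Sum>v<k. (?g x v)\<^sup>2)"])
    fix k s2 assume k: "k < aval s' (var ''n'')" "s2 ''q'' [] = q + (\<Sum>v<k. (?g x v)\<^sup>2)" "s2 ''v'' [] = k"
      "\<And>y. y \<notin> insert ''v'' (written (?set ;; ?mul)) \<Longrightarrow> s2 y = s' y"
    have "k < n" using k(1) s' n by simp
    have same: "s2 ''M'' = s ''M''" "s2 ''P'' = s ''P''" "s2 ''j'' [] = j" "s2 ''c'' [] = c" "s2 ''x'' [] = x" "s2 ''B'' [] = B"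
      using k(4) s' n by simp_all
    \<comment> \<open>Truncated subtraction reads a missing arc, entry 0, as an arc to vertex 0. The
      index stays in range, so the computation is also well specified on irregular graphs.\<close>
    have lt: "s ''M'' [c, k] - 1 < n" using M[OF \<open>k < n\<close>] \<open>k < n\<close> by linarith
    have r: "run ?set s2 ''r'' [] = ?g x k"
      using same k(3) P[OF s'(3) \<open>k < n\<close>] P[OF s'(3) lt] by (simp add: store_def)
    show "wp (?set ;; ?mul) (1 + (B * (3 + 2) + 2)) (\<lambda>s2. s2 ''q'' [] = q + (\<Sum>v<Suc k. (?g x v)\<^sup>2)) s2"
    proof (rule wp_Seq, rule wp_run)
      have "wp ?mul (B * (3 + 2) + 2) (\<lambda>s3. s3 ''q'' [] = (q + (\<Sum>v<k. (?g x v)\<^sup>2)) + (?g x k)\<^sup>2) (run ?set s2)"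
        by (rule mul) (use k(2) same r small in \<open>simp_all add: store_def\<close>)
      then show "wp ?mul (B * (3 + 2) + 2) (\<lambda>s2. s2 ''q'' [] = q + (\<Sum>v<Suc k. (?g x v)\<^sup>2)) (run ?set s2)"
        by (rule wp_mono) simp_all
    qed simp_all
  qed (use s' n in \<open>simp_all add: store_def\<close>)
  have loop: "wp (For ''x'' (var ''n'') (For ''v'' (var ''n'') (?set ;; ?mul)))
     (n * ((n * ((1 + (B * (3 + 2) + 2)) + 2) + 2) + 2) + 2)
    (\<lambda>s'. s' ''q'' [] = step_cost n (s ''M'') f c) s'"
    if s': "s' ''q'' [] = 0" "\<And>y. y \<noteq> ''q'' \<Longrightarrow> s' y = s y" for s'
  proof (rule wp_For[where I = "\<lambda>k s2. s2 ''q'' [] = (\<Sum>x<k. \<Sum>v<n. (?g x v)\<^sup>2)"])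
    fix k s2 assume k: "k < aval s' (var ''n'')" "s2 ''q'' [] = (\<Sum>x<k. \<Sum>v<n. (?g x v)\<^sup>2)" "s2 ''x'' [] = k"
      "\<And>y. y \<notin> insert ''x'' (written (For ''v'' (var ''n'') (?set ;; ?mul))) \<Longrightarrow> s2 y = s' y"
    have "wp (For ''v'' (var ''n'') (?set ;; ?mul)) (n * ((1 + (B * (3 + 2) + 2)) + 2) + 2)
      (\<lambda>s2. s2 ''q'' [] = (\<Sum>x<k. \<Sum>v<n. (?g x v)\<^sup>2) + (\<Sum>v<n. (?g k v)\<^sup>2)) s2"
      by (rule inner) (use k s' n in simp_all)
    then show "wp (For ''v'' (var ''n'') (?set ;; ?mul)) (n * ((1 + (B * (3 + 2) + 2)) + 2) + 2)
      (\<lambda>s2. s2 ''q'' [] = (\<Sum>x<Suc k. \<Sum>v<n. (?g x v)\<^sup>2)) s2"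
      by (rule wp_mono) simp_all
  qed (use s' n in \<open>simp_all add: store_def step_cost_def\<close>)
  show ?thesis unfolding compute_cost_def
    by (rule wp_Seq, rule wp_run, simp, simp, rule loop) (simp_all add: store_def)
qed

definition find_best :: com where
  "find_best = set_var ''g'' (Num 0) ;;
     For ''c'' (var ''D'')
       (Cond (Read ''U'' [var ''c'']) Skip
         (compute_cost ;;
          Cond (var ''g'')
            (Cond (Sub (var ''h'') (var ''q'')) (set_var ''h'' (var ''q'') ;; set_var ''e'' (var ''c'')) Skip)
            (set_var ''g'' (Num 1) ;; set_var ''h'' (var ''q'') ;; set_var ''e'' (var ''c''))))"

lemma written_find_best [simp]:
  "written find_best = {''g'', ''c'', ''q'', ''x'', ''v'', ''r'', ''i'', ''h'', ''e''}"
  by (auto simp: find_best_def)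

lemma wp_find_best:
  assumes n: "s ''n'' [] = n" "s ''j'' [] = j" "s ''D'' [] = D" "s ''B'' [] = B" "D \<le> n"
    and M: "\<And>c v. c < D \<Longrightarrow> v < n \<Longrightarrow> s ''M'' [c, v] \<le> n"
    and P: "\<And>x v. x < n \<Longrightarrow> v < n \<Longrightarrow> s ''P'' [j, x, v] = f x v"
    and small: "\<And>x v w. f x v + f x w \<le> B"
    and ex: "\<exists>c<D. s ''U'' [c] = 0"
    and t: "t = 1 + (n * ((n * ((1 + (B * (3 + 2) + 2)) + 2) + 2) + 2) + 2)"
  shows "wp find_best (1 + (n * ((t + 9) + 2) + 2))
    (\<lambda>s'. s' ''e'' [] < D \<and> s ''U'' [s' ''e'' []] = 0 \<and>
      (\<forall>c<D. s ''U'' [c] = 0 \<longrightarrow> step_cost n (s ''M'') f (s' ''e'' []) \<le> step_cost n (s ''M'') f c)) s"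
proof -
  let ?\<phi> = "step_cost n (s ''M'') f" and ?U = "s ''U''"
  let ?I = "\<lambda>k s'. if s' ''g'' [] = 0 then \<forall>c<k. ?U [c] \<noteq> 0 else
     s' ''e'' [] < k \<and> ?U [s' ''e'' []] = 0 \<and> s' ''h'' [] = ?\<phi> (s' ''e'' []) \<and>
      (\<forall>c<k. ?U [c] = 0 \<longrightarrow> ?\<phi> (s' ''e'' []) \<le> ?\<phi> c)"
  let ?upd = "Cond (var ''g'')
            (Cond (Sub (var ''h'') (var ''q'')) (set_var ''h'' (var ''q'') ;; set_var ''e'' (var ''c'')) Skip)
            (set_var ''g'' (Num 1) ;; set_var ''h'' (var ''q'') ;; set_var ''e'' (var ''c''))"
  let ?body = "Cond (Read ''U'' [var ''c'']) Skip (compute_cost ;; ?upd)"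
  have body: "wp ?body (t + 9) (?I (Suc k)) s'"
    if k: "k < D" "?I k s'" "s' ''c'' [] = k"
      and s': "\<And>y. y \<notin> {''g'', ''c'', ''q'', ''x'', ''v'', ''r'', ''i'', ''h'', ''e''} \<Longrightarrow> s' y = s y" for k s'
  proof (cases "?U [k] = 0")
    case False
    then have *: "?I (Suc k) s'" using k(2) by (auto simp: less_Suc_eq split: if_splits)
    have "wp Skip (t + 8) (?I (Suc k)) s'"
      by (rule wp_Skip, rule *) simp
    then have "wp ?body (Suc (t + 8)) (?I (Suc k)) s'"
      by (intro wp_Cond) (use False k s' in simp_all)
    then show ?thesis by (rule wp_mono) simp_all
  next
    case True
    have "wp (compute_cost ;; ?upd) (t + 8) (?I (Suc k)) s'"
    proof (rule wp_Seq_step)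
      show "wp compute_cost t (\<lambda>s2. s2 ''q'' [] = step_cost n (s' ''M'') f k) s'"
        unfolding t by (rule wp_compute_cost) (use k s' n M P small in simp_all)
      show "wp ?upd 8 (?I (Suc k)) s2"
        if s2: "s2 ''q'' [] = step_cost n (s' ''M'') f k" "\<And>y. y \<notin> written compute_cost \<Longrightarrow> s2 y = s' y" for s2
      proof (rule wp_run)
        have q: "s2 ''q'' [] = ?\<phi> k" using s2(1) s' by simp
        have same: "s2 ''g'' = s' ''g''" "s2 ''h'' = s' ''h''" "s2 ''e'' = s' ''e''" "s2 ''c'' = s' ''c''"
          using s2(2) by simp_all
        show "?I (Suc k) (run ?upd s2)"
        proof (cases "s' ''g'' [] = 0")
          case True
          then show ?thesis using k q same \<open>?U [k] = 0\<close> by (auto simp: store_def less_Suc_eq)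
        next
          case False
          then have I: "s' ''e'' [] < k" "?U [s' ''e'' []] = 0" "s' ''h'' [] = ?\<phi> (s' ''e'' [])"
             "\<And>c. c < k \<Longrightarrow> ?U [c] = 0 \<Longrightarrow> ?\<phi> (s' ''e'' []) \<le> ?\<phi> c" using k(2) by auto
          show ?thesis
          proof (cases "?\<phi> (s' ''e'' []) \<le> ?\<phi> k")
            case True
            then show ?thesis using False I k(3) q same by (simp add: less_Suc_eq)
          next
            case c: False
            then have "?\<phi> k \<le> ?\<phi> c" if "c < Suc k" "?U [c] = 0" for c
              using I(4)[of c] that by (auto simp: less_Suc_eq)
            then show ?thesis using c False I k(3) q same \<open>?U [k] = 0\<close> by (simp add: store_def)
          qed
        qed
      qed simp_all
    qed
    then have "wp ?body (Suc (t + 8)) (?I (Suc k)) s'"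
      by (intro wp_Cond) (use True k s' in simp_all)
    then show ?thesis by (rule wp_mono) simp_all
  qed
  have loop: "wp (For ''c'' (var ''D'') ?body) (n * ((t + 9) + 2) + 2)
    (\<lambda>s'. s' ''e'' [] < D \<and> s ''U'' [s' ''e'' []] = 0 \<and> (\<forall>c<D. s ''U'' [c] = 0 \<longrightarrow> ?\<phi> (s' ''e'' []) \<le> ?\<phi> c)) s'"
    if s': "s' ''g'' [] = 0" "\<And>y. y \<noteq> ''g'' \<Longrightarrow> s' y = s y" for s'
  proof (rule wp_For[where I = ?I])
    show "wp ?body (t + 9) (?I (Suc k)) s2"
      if "k < aval s' (var ''D'')" "?I k s2" "s2 ''c'' [] = k"
       "\<And>x. x \<notin> insert ''c'' (written ?body) \<Longrightarrow> s2 x = s' x" for k s2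
      using body[of k s2] that s' n by simp
    show "s2 ''e'' [] < D \<and> s ''U'' [s2 ''e'' []] = 0 \<and> (\<forall>c<D. s ''U'' [c] = 0 \<longrightarrow> ?\<phi> (s2 ''e'' []) \<le> ?\<phi> c)"
      if "?I (aval s' (var ''D'')) s2" for s2
      using that s' n ex by (auto split: if_splits)
  qed (use s' n in \<open>simp_all add: store_def\<close>)
  show ?thesis unfolding find_best_def
    by (rule wp_Seq, rule wp_run, simp, simp, rule loop) (simp_all add: store_def)
qed

section \<open>One round of the selection and its iteration\<close>

definition update_walk :: com where
  "update_walk = For ''x'' (var ''n'') (For ''v'' (var ''n'')
     (Assign ''P'' [succ (var ''j''), var ''x'', var ''v'']
        (Add (Read ''P'' [var ''j'', var ''x'', var ''v''])
          (Read ''P'' [var ''j'', var ''x'', pred (Read ''M'' [var ''e'', var ''v''])]))))"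

lemma written_update_walk [simp]: "written update_walk = {''x'', ''v'', ''P''}"
  by (auto simp: update_walk_def)

text \<open>The step number is an index of the table, so the old walks stay readable, at arbitrary
  vertices, while the new ones are written.\<close>

lemma wp_update_walk:
  assumes n: "s ''n'' [] = n" "s ''j'' [] = j" "s ''e'' [] = e"
    and M: "\<And>v. v < n \<Longrightarrow> s ''M'' [e, v] \<le> n"
    and P: "\<And>x v. x < n \<Longrightarrow> v < n \<Longrightarrow> s ''P'' [j, x, v] = f x v"
  shows "wp update_walk (n * ((n * (1 + 2) + 2) + 2) + 2)
    (\<lambda>s'. \<forall>x<n. \<forall>v<n. s' ''P'' [Suc j, x, v] = f x v + f x (s ''M'' [e, v] - 1)) s"
proof -
  let ?g = "\<lambda>x v. f x v + f x (s ''M'' [e, v] - 1)"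
  let ?I = "\<lambda>x k s'. (\<forall>x<n. \<forall>v<n. s' ''P'' [j, x, v] = f x v) \<and>
    (\<forall>y<x. \<forall>v<n. s' ''P'' [Suc j, y, v] = ?g y v) \<and> (\<forall>v<k. s' ''P'' [Suc j, x, v] = ?g x v)"
  let ?b = "Assign ''P'' [succ (var ''j''), var ''x'', var ''v'']
        (Add (Read ''P'' [var ''j'', var ''x'', var ''v''])
          (Read ''P'' [var ''j'', var ''x'', pred (Read ''M'' [var ''e'', var ''v''])]))"
  have inner: "wp (For ''v'' (var ''n'') ?b) (n * (1 + 2) + 2) (?I (Suc x) 0) s'"
    if s': "?I x 0 s'" "s' ''x'' [] = x" "x < n" "\<And>y. y \<notin> {''x'', ''v'', ''P''} \<Longrightarrow> s' y = s y" for s' x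
  proof (rule wp_For[where I = "?I x"])
    fix k s2 assume k: "k < aval s' (var ''n'')" "?I x k s2" "s2 ''v'' [] = k"
      "\<And>y. y \<notin> insert ''v'' (written ?b) \<Longrightarrow> s2 y = s' y"
    have "k < n" using k(1) s' n by simp
    have same: "s2 ''M'' = s ''M''" "s2 ''j'' [] = j" "s2 ''e'' [] = e" "s2 ''x'' [] = x"
      using k(4) s' n by simp_all
    have lt: "s ''M'' [e, k] - 1 < n" using M[OF \<open>k < n\<close>] \<open>k < n\<close> by linarith
    have P2: "s2 ''P'' [j, x, v] = f x v" if "v < n" for v using k(2) that s'(3) by blast
    have r: "run ?b s2 ''P'' = (s2 ''P'')([Suc j, x, k] := ?g x k)"
      using same k(3) P2[OF \<open>k < n\<close>] P2[OF lt] by (simp add: store_def)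
    have "?I x (Suc k) (run ?b s2)"
      unfolding r using k(2) by (auto simp: less_Suc_eq)
    then show "wp ?b 1 (?I x (Suc k)) s2" by (rule wp_run[rotated 2]) simp_all
  next
    fix s2 assume "?I x (aval s' (var ''n'')) s2"
    then show "?I (Suc x) 0 s2" using s' n by (simp add: less_Suc_eq)
  qed (use s' n in \<open>simp_all add: store_def\<close>)
  show ?thesis unfolding update_walk_def
  proof (rule wp_For[where I = "\<lambda>x. ?I x 0"])
    show "wp (For ''v'' (var ''n'') ?b) (n * (1 + 2) + 2) (?I (Suc x) 0) s'"
      if "x < aval s (var ''n'')" "?I x 0 s'" "s' ''x'' [] = x"
        "\<And>y. y \<notin> insert ''x'' (written (For ''v'' (var ''n'') ?b)) \<Longrightarrow> s' y = s y" for x s'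
      by (rule inner) (use that n in simp_all)
  qed (use n P in \<open>simp_all add: store_def\<close>)
qed

text \<open>Both entries are raised, so \<open>H\<close> stays symmetric and an edge picked up in
  both orientations ends with weight 2. The second assignment reads the result of the first, so even
  an arc from a vertex to itself would be counted consistently.\<close>

definition add_edges :: com where
  "add_edges = For ''v'' (var ''n'')
     (set_var ''w'' (pred (Read ''M'' [var ''e'', var ''v''])) ;;
      Assign ''H'' [var ''v'', var ''w''] (succ (Read ''H'' [var ''v'', var ''w''])) ;;
      Assign ''H'' [var ''w'', var ''v''] (succ (Read ''H'' [var ''w'', var ''v''])))"

lemma written_add_edges [simp]: "written add_edges = {''v'', ''w'', ''H''}"
  by (auto simp: add_edges_def)

lemma wp_add_edges:
  assumes n: "s ''n'' [] = n" "s ''e'' [] = e"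
  shows "wp add_edges (n * (3 + 2) + 2)
    (\<lambda>s'. \<forall>u<n. \<forall>w<n. s' ''H'' [u, w] = s ''H'' [u, w] +
       of_bool (s ''M'' [e, u] - 1 = w) + of_bool (s ''M'' [e, w] - 1 = u)) s"
proof -
  let ?M = "\<lambda>u. s ''M'' [e, u] - 1"
  let ?I = "\<lambda>k s'. \<forall>u w. s' ''H'' [u, w] = s ''H'' [u, w] +
       of_bool (u < k \<and> ?M u = w) + of_bool (w < k \<and> ?M w = u)"
  let ?b = "set_var ''w'' (pred (Read ''M'' [var ''e'', var ''v''])) ;;
      Assign ''H'' [var ''v'', var ''w''] (succ (Read ''H'' [var ''v'', var ''w''])) ;;
      Assign ''H'' [var ''w'', var ''v''] (succ (Read ''H'' [var ''w'', var ''v'']))"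
  show ?thesis unfolding add_edges_def
  proof (rule wp_For[where I = ?I])
    fix k s2 assume k: "k < aval s (var ''n'')" "?I k s2" "s2 ''v'' [] = k"
      "\<And>y. y \<notin> insert ''v'' (written ?b) \<Longrightarrow> s2 y = s y"
    have same: "s2 ''M'' = s ''M''" "s2 ''e'' [] = e" using k(4) n by simp_all
    have r: "run ?b s2 ''H'' [u, w] = s2 ''H'' [u, w] + of_bool (u = k \<and> ?M k = w) + of_bool (w = k \<and> ?M k = u)" for u w
      using same k(3) by (auto simp: store_def)
    have "?I (Suc k) (run ?b s2)"
      unfolding r using k(2) by (auto simp: less_Suc_eq)
    then show "wp ?b 3 (?I (Suc k)) s2" by (rule wp_run[rotated 2]) simp_all
  qed (use n in \<open>simp_all add: store_def\<close>)
qed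

text \<open>Earlier colours are excluded so that no arc is used twice, which later keeps the weights
  at most 2.\<close>

definition greedy :: "nat \<Rightarrow> nat \<Rightarrow> (nat list \<Rightarrow> nat) \<Rightarrow> (nat \<Rightarrow> nat) \<Rightarrow> nat \<Rightarrow> bool" where
  "greedy n D M sel T \<longleftrightarrow> (\<forall>j<T. sel j < D \<and> sel j \<notin> sel ` {..<j} \<and>
     (\<forall>c<D. c \<notin> sel ` {..<j} \<longrightarrow>
        step_cost n M (walk M sel j) (sel j) \<le> step_cost n M (walk M sel j) c))"

text \<open>Changing \<open>sel\<close> at \<open>j\<close> leaves the earlier choices optimal,
  because a walk depends only on the colours selected before it.\<close>

lemma greedy_Suc:
  assumes "greedy n D M sel j" and "e < D" "e \<notin> sel ` {..<j}"
    and "\<And>c. c < D \<Longrightarrow> c \<notin> sel ` {..<j} \<Longrightarrow> step_cost n M (walk M sel j) e \<le> step_cost n M (walk M sel j) c"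
  shows "greedy n D M (sel(j := e)) (Suc j)"
  unfolding greedy_def
proof (intro allI impI)
  fix i assume i: "i < Suc j"
  then have *: "sel(j := e) ` {..<i} = sel ` {..<i}" "walk M (sel(j := e)) i = walk M sel i"
    by (auto intro: walk_cong)
  show "(sel(j := e)) i < D \<and> (sel(j := e)) i \<notin> sel(j := e) ` {..<i} \<and>
     (\<forall>c<D. c \<notin> sel(j := e) ` {..<i} \<longrightarrow>
        step_cost n M (walk M (sel(j := e)) i) ((sel(j := e)) i) \<le> step_cost n M (walk M (sel(j := e)) i) c)"
    unfolding * using assms i by (auto simp: greedy_def less_Suc_eq)
qed

definition select_round :: com where
  "select_round = find_best ;; Assign ''U'' [var ''e''] (Num 1) ;; update_walk ;; add_edges"

lemma written_select_round [simp]: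
  "written select_round = {''g'', ''c'', ''q'', ''x'', ''v'', ''r'', ''i'', ''h'', ''e'', ''U'', ''P'', ''w'', ''H''}"
  by (auto simp: select_round_def)

definition select_inv :: "nat \<Rightarrow> nat \<Rightarrow> (nat list \<Rightarrow> nat) \<Rightarrow> nat \<Rightarrow> state \<Rightarrow> bool" where
  "select_inv n D M j s \<longleftrightarrow> (\<exists>sel. greedy n D M sel j \<and>
     (\<forall>c. s ''U'' [c] = 0 \<longleftrightarrow> c \<notin> sel ` {..<j}) \<and>
     (\<forall>x<n. \<forall>v<n. s ''P'' [j, x, v] = walk M sel j x v) \<and>
     (\<forall>u<n. \<forall>w<n. s ''H'' [u, w] = (\<Sum>i<j. of_bool (M [sel i, u] - 1 = w) + of_bool (M [sel i, w] - 1 = u))))"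

lemma wp_select_round:
  assumes n: "s ''n'' [] = n" "s ''j'' [] = j" "s ''D'' [] = D" "s ''B'' [] = 2 ^ T" "D \<le> n"
    and j: "j < T" "T \<le> D"
    and M: "s ''M'' = M" "\<And>c v. c < D \<Longrightarrow> v < n \<Longrightarrow> M [c, v] \<le> n"
    and inv: "select_inv n D M j s"
    and t: "t = 1 + (n * ((n * ((1 + (2 ^ T * (3 + 2) + 2)) + 2) + 2) + 2) + 2)"
  shows "wp select_round ((1 + (n * ((t + 9) + 2) + 2)) +
      (1 + ((n * ((n * (1 + 2) + 2) + 2) + 2) + (n * (3 + 2) + 2)))) (select_inv n D M (Suc j)) s"
proof -
  obtain sel where sel: "greedy n D M sel j" "\<And>c. s ''U'' [c] = 0 \<longleftrightarrow> c \<notin> sel ` {..<j}"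
     "\<And>x v. x < n \<Longrightarrow> v < n \<Longrightarrow> s ''P'' [j, x, v] = walk M sel j x v"
     "\<And>u w. u < n \<Longrightarrow> w < n \<Longrightarrow>
       s ''H'' [u, w] = (\<Sum>i<j. of_bool (M [sel i, u] - 1 = w) + of_bool (M [sel i, w] - 1 = u))"
    using inv unfolding select_inv_def by blast
  have "card (sel ` {..<j}) < card {..<D}" using card_image_le[of "{..<j}" sel] j by simp
  then have "\<not> {..<D} \<subseteq> sel ` {..<j}" using card_mono[of "sel ` {..<j}" "{..<D}"] by auto
  then have ex: "\<exists>c<D. s ''U'' [c] = 0" using sel(2) by blast
  \<comment> \<open>Two entries of the \<open>j\<close>-th walk add up to at most
    \<open>2 ^ Suc j\<close>; \<open>j < T\<close> keeps this within the length of the loop that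
    squares.\<close>
  have small: "walk M sel j x v + walk M sel j x w \<le> 2 ^ T" for x v w
  proof -
    have "(2::nat) ^ Suc j \<le> 2 ^ T" using j by (intro power_increasing) auto
    then show ?thesis using walk_le[of M sel j x v] walk_le[of M sel j x w] by simp
  qed
  show ?thesis unfolding select_round_def
  proof (rule wp_Seq_step[OF wp_find_best[where D = D and B = "2 ^ T" and f = "walk M sel j", OF n(1,2,3,4,5) _ _ small ex t]])
    fix s1 assume s1: "s1 ''e'' [] < D \<and> s ''U'' [s1 ''e'' []] = 0 \<and>
        (\<forall>c<D. s ''U'' [c] = 0 \<longrightarrow> step_cost n (s ''M'') (walk M sel j) (s1 ''e'' [])
           \<le> step_cost n (s ''M'') (walk M sel j) c)"
      and fr1: "\<And>x. x \<notin> written find_best \<Longrightarrow> s1 x = s x"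
    define e where "e = s1 ''e'' []"
    let ?sel = "sel(j := e)"
    have greedy: "greedy n D M ?sel (Suc j)"
      using s1 sel(2) M(1) by (intro greedy_Suc sel(1)) (auto simp: e_def)
    have e: "e < D" using s1 by (simp add: e_def)
    let ?s2 = "run (Assign ''U'' [var ''e''] (Num 1)) s1"
    have s2: "?s2 ''n'' [] = n" "?s2 ''j'' [] = j" "?s2 ''e'' [] = e" "?s2 ''M'' = M" "?s2 ''P'' = s ''P''" "?s2 ''H'' = s ''H''"
      "?s2 ''U'' = (s ''U'')([e] := 1)"
      using fr1 n M(1) by (simp_all add: store_def e_def)
    have walkS: "walk M ?sel (Suc j) x v = walk M sel j x v + walk M sel j x (M [e, v] - 1)" for x v
      using walk_cong[of j ?sel sel M] by simp
    show "wp (Assign ''U'' [var ''e''] (Num 1) ;; update_walk ;; add_edges)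
       (1 + ((n * ((n * (1 + 2) + 2) + 2) + 2) + (n * (3 + 2) + 2))) (select_inv n D M (Suc j)) s1"
    proof (rule wp_Seq, rule wp_run)
      show "wp (update_walk ;; add_edges) ((n * ((n * (1 + 2) + 2) + 2) + 2) + (n * (3 + 2) + 2))
         (select_inv n D M (Suc j)) ?s2"
      proof (rule wp_Seq_step[OF wp_update_walk[where f = "walk M sel j" and e = e and j = j and s = "?s2", OF s2(1,2,3)]])
        fix s3 assume s3: "\<forall>x<n. \<forall>v<n. s3 ''P'' [Suc j, x, v] = walk M sel j x v + walk M sel j x (?s2 ''M'' [e, v] - 1)"
          and fr3: "\<And>x. x \<notin> written update_walk \<Longrightarrow> s3 x = ?s2 x"
        have eq: "s3 ''n'' [] = n" "s3 ''e'' [] = e" "s3 ''M'' = M" "s3 ''H'' = s ''H''" "s3 ''U'' = (s ''U'')([e] := 1)"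
          using fr3 s2 by simp_all
        show "wp add_edges (n * (3 + 2) + 2) (select_inv n D M (Suc j)) s3"
        proof (rule wp_mono[OF wp_add_edges[where s = s3, OF eq(1,2)]])
          fix s4 assume s4: "\<forall>u<n. \<forall>w<n. s4 ''H'' [u, w] = s3 ''H'' [u, w] +
              of_bool (s3 ''M'' [e, u] - 1 = w) + of_bool (s3 ''M'' [e, w] - 1 = u)"
            and fr4: "\<And>x. x \<notin> written add_edges \<Longrightarrow> s4 x = s3 x"
          have eq4: "s4 ''U'' = (s ''U'')([e] := 1)" "s4 ''P'' = s3 ''P''" using fr4 eq by simp_all
          have "\<forall>c. s4 ''U'' [c] = 0 \<longleftrightarrow> c \<notin> ?sel ` {..<Suc j}"
            using sel(2) by (auto simp: eq4 lessThan_Suc)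
          moreover have "\<forall>x<n. \<forall>v<n. s4 ''P'' [Suc j, x, v] = walk M ?sel (Suc j) x v"
            using s3 s2(4) unfolding walkS eq4 by simp
          moreover have "\<forall>u<n. \<forall>w<n. s4 ''H'' [u, w] =
              (\<Sum>i<Suc j. of_bool (M [?sel i, u] - 1 = w) + of_bool (M [?sel i, w] - 1 = u))"
            using s4 sel(4) eq by simp
          ultimately show "select_inv n D M (Suc j) s4"
            unfolding select_inv_def using greedy by blast
        qed simp
      qed (use s2 M e sel(3) in simp_all)
    qed simp_all
  qed (use M sel(3) in simp_all)
qed

definition select_colours :: com where
  "select_colours =
     For ''x'' (var ''n'') (Assign ''P'' [Num 0, var ''x'', var ''x''] (Num 1)) ;;
     For ''j'' (var ''T'') select_round"

lemma wp_select_colours: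
  assumes n: "s ''n'' [] = n" "s ''D'' [] = D" "s ''B'' [] = 2 ^ T" "s ''T'' [] = T" "D \<le> n"
    and j: "T \<le> D"
    and M: "s ''M'' = M" "\<And>c v. c < D \<Longrightarrow> v < n \<Longrightarrow> M [c, v] \<le> n"
    and empty: "s ''P'' = (\<lambda>_. 0)" "s ''U'' = (\<lambda>_. 0)" "s ''H'' = (\<lambda>_. 0)"
  shows "wp select_colours (100 * (2 ^ T + 1) * (n + 1) * (n + 1) * (n + 1) * (T + 1)) (select_inv n D M T) s"
proof -
  let ?t = "1 + (n * ((n * ((1 + (2 ^ T * (3 + 2) + 2)) + 2) + 2) + 2) + 2)"
  let ?r = "(1 + (n * ((?t + 9) + 2) + 2)) + (1 + ((n * ((n * (1 + 2) + 2) + 2) + 2) + (n * (3 + 2) + 2)))"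
  let ?init = "For ''x'' (var ''n'') (Assign ''P'' [Num 0, var ''x'', var ''x''] (Num 1))"
  have init: "wp ?init (n * (1 + 2) + 2) (\<lambda>s'. \<forall>x v. x < n \<longrightarrow> s' ''P'' [0, x, v] = of_bool (x = v)) s"
  proof (rule wp_For[where I = "\<lambda>k s'. \<forall>x v. s' ''P'' [0, x, v] = of_bool (x < k \<and> x = v)"])
    show "wp (Assign ''P'' [Num 0, var ''x'', var ''x''] (Num 1)) 1
        (\<lambda>s'. \<forall>x v. s' ''P'' [0, x, v] = of_bool (x < Suc k \<and> x = v)) s'"
      if "\<forall>x v. s' ''P'' [0, x, v] = of_bool (x < k \<and> x = v)" "s' ''x'' [] = k" for k s'
      using that by (intro wp_run) (auto simp: store_def less_Suc_eq)
  qed (use n empty in \<open>simp_all add: store_def\<close>)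
  have loop: "wp (For ''j'' (var ''T'') select_round) (T * (?r + 2) + 2) (select_inv n D M T) s'"
    if P: "\<forall>x v. x < n \<longrightarrow> s' ''P'' [0, x, v] = of_bool (x = v)"
      and fr: "\<And>x. x \<notin> {''x'', ''P''} \<Longrightarrow> s' x = s x" for s'
  proof (rule wp_For[where I = "select_inv n D M"])
    show "wp select_round ?r (select_inv n D M (Suc k)) s2"
      if "k < aval s' (var ''T'')" "select_inv n D M k s2" "s2 ''j'' [] = k"
        "\<And>x. x \<notin> insert ''j'' (written select_round) \<Longrightarrow> s2 x = s' x" for k s2
      by (rule wp_select_round[where T = T]) (use that fr n M j in simp_all)
    show "select_inv n D M 0 s'"
      unfolding select_inv_def greedy_def using P fr empty by simp
    show "select_inv n D M k (store s2 ''j'' [] m)" if "select_inv n D M k s2" for k s2 m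
      using that by (simp add: select_inv_def store_def)
  qed (use n fr in simp_all)
  have "wp select_colours ((n * (1 + 2) + 2) + (T * (?r + 2) + 2)) (select_inv n D M T) s"
    unfolding select_colours_def by (rule wp_Seq_step[OF init loop]) simp_all
  then show ?thesis
  proof (rule wp_mono)
    define a where "a = (2::nat) ^ T"
    have "(n * (1 + 2) + 2) + (T * (((1 + (n * (((1 + (n * ((n * ((1 + (a * (3 + 2) + 2)) + 2) + 2) + 2) + 2)) + 9) + 2) + 2)) +
       (1 + ((n * ((n * (1 + 2) + 2) + 2) + 2) + (n * (3 + 2) + 2)))) + 2) + 2) \<le> 100 * (a + 1) * (n + 1) * (n + 1) * (n + 1) * (T + 1)"
      by (simp add: algebra_simps)
    then show "(n * (1 + 2) + 2) + (T * (?r + 2) + 2) \<le> 100 * (2 ^ T + 1) * (n + 1) * (n + 1) * (n + 1) * (T + 1)"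
      by (simp add: a_def)
  qed simp
qed

section \<open>A discrete Cheeger inequality\<close>

text \<open>A layer-cake argument. Let \<open>m\<close> be the least nonzero value and
  \<open>b\<close> be \<open>a\<close> with the bottom layer of height \<open>m\<close> removed from
  its support. Removing the layer lowers the left side by \<kappa> times \<open>m\<close> times the
  size of the support and the right side by \<open>m\<close> times the number of arcs leaving the
  support; \<open>cut\<close> compares the two, and \<open>b\<close> has smaller support.\<close>

lemma coarea:
  fixes a :: "'a \<Rightarrow> real" and R :: "('a \<times> 'a) set" and \<kappa> :: real
  assumes fin: "finite V" "finite R" "R \<subseteq> V \<times> V"
    and cut: "\<And>S. S \<subseteq> V \<Longrightarrow> S \<noteq> {} \<Longrightarrow> 2 * card S \<le> card V \<Longrightarrow>
      \<kappa> * card S \<le> card {(u, v) \<in> R. u \<in> S \<and> v \<notin> S}"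
    and nonneg: "\<And>v. v \<in> V \<Longrightarrow> 0 \<le> a v" and supp: "2 * card {v \<in> V. a v \<noteq> 0} \<le> card V"
  shows "\<kappa> * (\<Sum>v\<in>V. a v) \<le> (\<Sum>(u, v)\<in>R. max 0 (a u - a v))"
  using nonneg supp
proof (induction "card {v \<in> V. a v \<noteq> 0}" arbitrary: a rule: less_induct)
  case less
  let ?S = "{v \<in> V. a v \<noteq> 0}"
  show ?case
  proof (cases "?S = {}")
    case True
    then have "(\<Sum>v\<in>V. a v) = 0" by (intro sum.neutral) auto
    then show ?thesis by (auto intro!: sum_nonneg)
  next
    case False
    have finS: "finite ?S" using fin by simp
    define m where "m = Min (a ` ?S)"
    define b where "b v = (if a v = 0 then 0 else a v - m)" for v
    have "m \<in> a ` ?S" unfolding m_def using False finS by (intro Min_in) auto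
    then obtain v0 where v0: "v0 \<in> ?S" "a v0 = m" by auto
    have m: "m \<le> a v" if "v \<in> ?S" for v unfolding m_def using finS that by (intro Min_le) auto
    have "v0 \<notin> {v \<in> V. b v \<noteq> 0}" using v0(2) by (simp add: b_def)
    moreover have "b v = 0" if "a v = 0" for v using that by (simp add: b_def)
    then have "{v \<in> V. b v \<noteq> 0} \<subseteq> ?S" by blast
    ultimately have sub: "{v \<in> V. b v \<noteq> 0} \<subset> ?S" using v0(1) by blast
    have card: "card {v \<in> V. b v \<noteq> 0} < card ?S" by (rule psubset_card_mono[OF finS sub])
    have "\<kappa> * (\<Sum>v\<in>V. b v) \<le> (\<Sum>(u, v)\<in>R. max 0 (b u - b v))"
    proof (rule less.hyps[OF card])
      show "0 \<le> b v" if "v \<in> V" for v using m[of v] that by (auto simp: b_def)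
      show "2 * card {v \<in> V. b v \<noteq> 0} \<le> card V" using card less.prems(2) by linarith
    qed
    moreover have "m * (\<kappa> * card ?S) \<le> m * card {(u, v) \<in> R. u \<in> ?S \<and> v \<notin> ?S}"
      using less.prems(1)[of v0] v0 False by (intro mult_left_mono cut less.prems(2)) auto
    moreover have "(\<Sum>v\<in>V. a v) = m * card ?S + (\<Sum>v\<in>V. b v)"
    proof -
      have "(\<Sum>v\<in>V. a v) = (\<Sum>v\<in>V. (if v \<in> ?S then m else 0) + b v)"
        by (intro sum.cong) (auto simp: b_def)
      also have "\<dots> = (\<Sum>v\<in>V. if v \<in> ?S then m else 0) + (\<Sum>v\<in>V. b v)" by (rule sum.distrib)
      also have "(\<Sum>v\<in>V. if v \<in> ?S then m else 0) = m * card ?S"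
        using fin by (subst sum.inter_filter[symmetric]) auto
      finally show ?thesis .
    qed
    \<comment> \<open>Only arcs leaving the support change: inside it the layer cancels, and arcs
      that start outside contribute 0 both before and after.\<close>
    moreover have "(\<Sum>(u, v)\<in>R. max 0 (a u - a v)) =
        m * card {(u, v) \<in> R. u \<in> ?S \<and> v \<notin> ?S} + (\<Sum>(u, v)\<in>R. max 0 (b u - b v))"
    proof -
      let ?X = "{p \<in> R. fst p \<in> ?S \<and> snd p \<notin> ?S}"
      have "(\<Sum>(u, v)\<in>R. max 0 (a u - a v)) =
          (\<Sum>p\<in>R. (if fst p \<in> ?S \<and> snd p \<notin> ?S then m else 0) + max 0 (b (fst p) - b (snd p)))"
      proof (intro sum.cong refl)
        fix p assume p: "p \<in> R"
        obtain u v where uv: "p = (u, v)" by force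
        have "u \<in> V" "v \<in> V" using p uv fin by auto
        then show "(case p of (u, v) \<Rightarrow> max 0 (a u - a v)) =
            (if fst p \<in> ?S \<and> snd p \<notin> ?S then m else 0) + max 0 (b (fst p) - b (snd p))"
          using m[of u] m[of v] less.prems(1)[of u] less.prems(1)[of v] uv by (auto simp: b_def max_def)
      qed
      also have "\<dots> = (\<Sum>p\<in>R. if fst p \<in> ?S \<and> snd p \<notin> ?S then m else 0) + (\<Sum>p\<in>R. max 0 (b (fst p) - b (snd p)))"
        by (rule sum.distrib)
      also have "(\<Sum>p\<in>R. if fst p \<in> ?S \<and> snd p \<notin> ?S then m else 0) = m * card ?X"
        using fin by (subst sum.inter_filter[symmetric]) auto
      also have "?X = {(u, v) \<in> R. u \<in> ?S \<and> v \<notin> ?S}" by auto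
      finally show ?thesis by (simp add: case_prod_beta)
    qed
    ultimately show ?thesis by (simp add: algebra_simps)
  qed
qed

lemma sum_fibres_le:
  fixes h :: "'a \<Rightarrow> real"
  assumes "finite V" "finite R" "\<And>p. p \<in> R \<Longrightarrow> f p \<in> V" "\<And>v. v \<in> V \<Longrightarrow> 0 \<le> h v"
    and "\<And>v. v \<in> V \<Longrightarrow> card {p \<in> R. f p = v} \<le> D"
  shows "(\<Sum>p\<in>R. h (f p)) \<le> D * (\<Sum>v\<in>V. h v)"
proof -
  have "(\<Sum>p\<in>R. h (f p)) = (\<Sum>v\<in>V. \<Sum>p\<in>{p \<in> R. f p = v}. h (f p))"
    using assms by (intro sum.group[symmetric]) auto
  also have "\<dots> = (\<Sum>v\<in>V. card {p \<in> R. f p = v} * h v)"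
    by (intro sum.cong refl) simp
  also have "\<dots> \<le> (\<Sum>v\<in>V. D * h v)"
    using assms by (intro sum_mono mult_right_mono) auto
  finally show ?thesis by (simp add: sum_distrib_left)
qed

text \<open>A directed form of expansion. For a graph, the relation contains both orientations of
  every edge, so the arcs leaving a set correspond to the cut edges one to one.\<close>

locale expanding_relation =
  fixes V :: "'a set" and R :: "('a \<times> 'a) set" and D :: nat and \<kappa> :: real
  assumes fin: "finite V" "finite R" "R \<subseteq> V \<times> V"
    and out_degree: "\<And>v. v \<in> V \<Longrightarrow> card {p \<in> R. fst p = v} \<le> D"
    and in_degree: "\<And>v. v \<in> V \<Longrightarrow> card {p \<in> R. snd p = v} \<le> D"
    and cut: "\<And>S. S \<subseteq> V \<Longrightarrow> S \<noteq> {} \<Longrightarrow> 2 * card S \<le> card V \<Longrightarrow>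
      \<kappa> * card S \<le> card {(u, v) \<in> R. u \<in> S \<and> v \<notin> S}"
    and \<kappa>: "0 \<le> \<kappa>"
begin

text \<open>The coarea bound is applied to the square of \<open>h\<close>. Factoring the difference
  of squares and using Cauchy-Schwarz separates the wanted energy from the sum of
  \<open>(h u + h v)^2\<close>; this is at most \<open>4 * D\<close> times the squared norm, since
  \<open>(x + y)^2 <= 2 x^2 + 2 y^2\<close> and each vertex is a head and a tail at most
  \<open>D\<close> times. One factor of the squared norm then cancels.\<close>

lemma cheeger_nonneg:
  fixes h :: "'a \<Rightarrow> real"
  assumes nonneg: "\<And>v. v \<in> V \<Longrightarrow> 0 \<le> h v" and supp: "2 * card {v \<in> V. h v \<noteq> 0} \<le> card V"
  shows "\<kappa>\<^sup>2 * (\<Sum>v\<in>V. (h v)\<^sup>2) \<le> 4 * D * (\<Sum>(u, v)\<in>R. (h u - h v)\<^sup>2)"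
proof -
  let ?s = "\<Sum>v\<in>V. (h v)\<^sup>2" and ?E = "\<Sum>p\<in>R. (h (fst p) - h (snd p))\<^sup>2"
  have mem: "fst p \<in> V" "snd p \<in> V" if "p \<in> R" for p using that fin by auto
  have "\<kappa> * ?s \<le> (\<Sum>(u, v)\<in>R. max 0 ((h u)\<^sup>2 - (h v)\<^sup>2))"
    using supp by (intro coarea fin cut) auto
  also have "\<dots> \<le> (\<Sum>p\<in>R. \<bar>h (fst p) - h (snd p)\<bar> * (h (fst p) + h (snd p)))"
  proof (rule sum_mono)
    fix p assume p: "p \<in> R"
    have "(h (fst p))\<^sup>2 - (h (snd p))\<^sup>2 = (h (fst p) - h (snd p)) * (h (fst p) + h (snd p))"
      by (simp add: power2_eq_square algebra_simps)
    also have "\<dots> \<le> \<bar>h (fst p) - h (snd p)\<bar> * (h (fst p) + h (snd p))"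
      using nonneg mem[OF p] by (intro mult_right_mono) (auto intro: add_nonneg_nonneg)
    finally show "(case p of (u, v) \<Rightarrow> max 0 ((h u)\<^sup>2 - (h v)\<^sup>2)) \<le>
        \<bar>h (fst p) - h (snd p)\<bar> * (h (fst p) + h (snd p))"
      using nonneg mem[OF p] by (auto simp: case_prod_beta)
  qed
  finally have "(\<kappa> * ?s)\<^sup>2 \<le> (\<Sum>p\<in>R. \<bar>h (fst p) - h (snd p)\<bar> * (h (fst p) + h (snd p)))\<^sup>2"
    using \<kappa> by (intro power_mono mult_nonneg_nonneg sum_nonneg) auto
  also have "\<dots> \<le> ?E * (\<Sum>p\<in>R. (h (fst p) + h (snd p))\<^sup>2)"
    using Cauchy_Schwarz_ineq_sum[of "\<lambda>p. \<bar>h (fst p) - h (snd p)\<bar>" "\<lambda>p. h (fst p) + h (snd p)" R] by simp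
  also have "\<dots> \<le> ?E * (4 * D * ?s)"
  proof (intro mult_left_mono sum_nonneg)
    have "(\<Sum>p\<in>R. (h (fst p) + h (snd p))\<^sup>2) \<le> (\<Sum>p\<in>R. 2 * (h (fst p))\<^sup>2 + 2 * (h (snd p))\<^sup>2)"
    proof (rule sum_mono)
      show "(h (fst p) + h (snd p))\<^sup>2 \<le> 2 * (h (fst p))\<^sup>2 + 2 * (h (snd p))\<^sup>2" for p
        using zero_le_power2[of "h (fst p) - h (snd p)"] by (simp add: power2_eq_square algebra_simps)
    qed
    also have "\<dots> = 2 * (\<Sum>p\<in>R. (h (fst p))\<^sup>2) + 2 * (\<Sum>p\<in>R. (h (snd p))\<^sup>2)"
      by (simp add: sum.distrib sum_distrib_left)
    also have "\<dots> \<le> 2 * (D * ?s) + 2 * (D * ?s)"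
      using fin mem out_degree in_degree by (intro add_mono mult_left_mono sum_fibres_le) auto
    finally show "(\<Sum>p\<in>R. (h (fst p) + h (snd p))\<^sup>2) \<le> 4 * D * ?s" by simp
  qed auto
  finally have *: "(\<kappa>\<^sup>2 * ?s) * ?s \<le> (4 * D * ?E) * ?s" by (simp add: power2_eq_square algebra_simps)
  have "\<kappa>\<^sup>2 * ?s \<le> 4 * D * ?E"
  proof (cases "?s = 0")
    case True
    then show ?thesis by (auto intro!: mult_nonneg_nonneg sum_nonneg)
  next
    case False
    then have "0 < ?s" by (simp add: order_less_le sum_nonneg)
    with * show ?thesis by (simp only: mult_le_cancel_right_pos)
  qed
  then show ?thesis by (simp add: case_prod_beta)
qed

end

text \<open>The witness is the least value of \<open>f\<close> that is exceeded at no more than half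
  of the points.\<close>

lemma median:
  fixes f :: "'a \<Rightarrow> real"
  assumes V: "finite V" "V \<noteq> {}"
  obtains m where "2 * card {v \<in> V. m < f v} \<le> card V" "2 * card {v \<in> V. f v < m} \<le> card V"
proof -
  let ?A = "{v \<in> V. 2 * card {w \<in> V. f v < f w} \<le> card V}"
  define m where "m = Min (f ` ?A)"
  have "Max (f ` V) \<in> f ` V" using V by simp
  then obtain v1 where v1: "v1 \<in> V" "f v1 = Max (f ` V)" by auto
  then have "f w \<le> f v1" if "w \<in> V" for w using V that by simp
  then have "{w \<in> V. f v1 < f w} = {}" by force
  then have "2 * card {w \<in> V. f v1 < f w} \<le> card V" by (simp only: card.empty)
  then have "v1 \<in> ?A" using v1(1) by blast
  then have "m \<in> f ` ?A" unfolding m_def using V by (intro Min_in) auto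
  then obtain v where v: "v \<in> ?A" "m = f v" by auto
  have "2 * card {w \<in> V. f w < m} \<le> card V"
  proof (cases "{w \<in> V. f w < m} = {}")
    case False
    let ?B = "{w \<in> V. f w < m}"
    have "Max (f ` ?B) \<in> f ` ?B" using V False by (intro Max_in) auto
    then obtain w where w: "w \<in> ?B" "f w = Max (f ` ?B)" by auto
    have wmax: "f u \<le> f w" if "u \<in> ?B" for u using V that w(2) by simp
    have "w \<notin> ?A"
    proof
      assume "w \<in> ?A"
      then have "m \<le> f w" unfolding m_def using V by (intro Min_le) auto
      with w show False by simp
    qed
    \<comment> \<open>The largest value \<open>f w\<close> below \<open>m\<close> fails the defining
      condition of \<open>?A\<close>, so more than half of the points exceed it. These are precisely
      the points not below \<open>m\<close>.\<close>
    then have "card V < 2 * card {u \<in> V. f w < f u}" using w by simp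
    moreover have "{u \<in> V. f w < f u} = V - ?B" using wmax w by force
    moreover have "card (V - ?B) = card V - card ?B" "card ?B \<le> card V"
      using V by (auto intro: card_Diff_subset card_mono)
    ultimately show ?thesis by simp
  qed (simp only: card.empty)
  then show ?thesis using that v by auto
qed

text \<open>After subtracting a median, the positive and the negative part each live on at most half
  of the vertices, so the nonnegative case applies to both.\<close>

lemma (in expanding_relation) cheeger:
  fixes f :: "'a \<Rightarrow> real"
  assumes sum0: "(\<Sum>v\<in>V. f v) = 0"
  shows "\<kappa>\<^sup>2 * (\<Sum>v\<in>V. (f v)\<^sup>2) \<le> 4 * D * (\<Sum>(u, v)\<in>R. (f u - f v)\<^sup>2)"
proof (cases "V = {}")
  case True
  then show ?thesis by (auto intro!: mult_nonneg_nonneg sum_nonneg)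
next
  case False
  then obtain m where m: "2 * card {v \<in> V. m < f v} \<le> card V" "2 * card {v \<in> V. f v < m} \<le> card V"
    using median fin(1) by metis
  define p q where "p v = max 0 (f v - m)" and "q v = max 0 (m - f v)" for v
  \<comment> \<open>As \<open>f\<close> sums to 0, shifting by a constant cannot decrease the
    squared norm.\<close>
  have "(\<Sum>v\<in>V. (f v)\<^sup>2) \<le> (\<Sum>v\<in>V. (f v)\<^sup>2) - 2 * m * (\<Sum>v\<in>V. f v) + card V * m\<^sup>2"
    using sum0 by simp
  also have "\<dots> = (\<Sum>v\<in>V. (f v - m)\<^sup>2)"
    by (simp add: power2_diff sum.distrib sum_subtractf flip: sum_distrib_left sum_distrib_right)
  also have "\<dots> = (\<Sum>v\<in>V. (p v)\<^sup>2 + (q v)\<^sup>2)"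
    by (intro sum.cong) (auto simp: p_def q_def max_def power2_commute)
  also have "\<dots> = (\<Sum>v\<in>V. (p v)\<^sup>2) + (\<Sum>v\<in>V. (q v)\<^sup>2)" by (rule sum.distrib)
  finally have "\<kappa>\<^sup>2 * (\<Sum>v\<in>V. (f v)\<^sup>2) \<le> \<kappa>\<^sup>2 * (\<Sum>v\<in>V. (p v)\<^sup>2) + \<kappa>\<^sup>2 * (\<Sum>v\<in>V. (q v)\<^sup>2)"
    by (metis distrib_left mult_left_mono zero_le_power2)
  also have "\<dots> \<le> 4 * D * (\<Sum>(u, v)\<in>R. (p u - p v)\<^sup>2) + 4 * D * (\<Sum>(u, v)\<in>R. (q u - q v)\<^sup>2)"
  proof (intro add_mono cheeger_nonneg)
    have "{v \<in> V. p v \<noteq> 0} = {v \<in> V. m < f v}" "{v \<in> V. q v \<noteq> 0} = {v \<in> V. f v < m}"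
      by (auto simp: p_def q_def max_def)
    with m show "2 * card {v \<in> V. p v \<noteq> 0} \<le> card V" "2 * card {v \<in> V. q v \<noteq> 0} \<le> card V" by simp_all
  qed (auto simp: p_def q_def)
  also have "\<dots> = 4 * D * (\<Sum>(u, v)\<in>R. (p u - p v)\<^sup>2 + (q u - q v)\<^sup>2)"
    by (simp add: sum.distrib case_prod_beta distrib_left)
  also have "\<dots> \<le> 4 * D * (\<Sum>(u, v)\<in>R. (f u - f v)\<^sup>2)"
  proof (intro mult_left_mono sum_mono)
    fix e assume "e \<in> R"
    obtain u v where e: "e = (u, v)" by force
    have *: "f u - f v = (p u - p v) - (q u - q v)" by (auto simp: p_def q_def max_def)
    \<comment> \<open>\<open>p\<close> increases and \<open>q\<close> decreases with
      \<open>f\<close>, so the mixed term has the sign that lets the two energies add up to at most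
      the energy of \<open>f\<close>.\<close>
    have "(p u - p v) * (q u - q v) \<le> 0"
      by (auto simp: p_def q_def max_def mult_nonneg_nonpos mult_nonpos_nonneg)
    moreover have "(f u - f v)\<^sup>2 = (p u - p v)\<^sup>2 + (q u - q v)\<^sup>2 - 2 * ((p u - p v) * (q u - q v))"
      unfolding * by (simp add: power2_eq_square algebra_simps)
    ultimately show "(case e of (u, v) \<Rightarrow> (p u - p v)\<^sup>2 + (q u - q v)\<^sup>2) \<le> (case e of (u, v) \<Rightarrow> (f u - f v)\<^sup>2)"
      unfolding e by simp
  qed simp
  finally show ?thesis .
qed

section \<open>Mixing of the selected matchings\<close>

locale matching_decomposition = expanding_relation "{..<n}" R D \<kappa>
  for n :: nat and R :: "(nat \<times> nat) set" and D :: nat and \<kappa> :: real +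
  fixes M :: "nat list \<Rightarrow> nat"
  assumes matching: "\<And>c. c < D \<Longrightarrow> bij_betw (\<lambda>v. M [c, v] - 1) {..<n} {..<n}"
    and decomposition: "bij_betw (\<lambda>(c, v). (v, M [c, v] - 1)) ({..<D} \<times> {..<n}) R"
    and nonempty: "0 < n" "0 < D"
begin

abbreviation \<sigma> :: "nat \<Rightarrow> nat \<Rightarrow> nat" where "\<sigma> c v \<equiv> M [c, v] - 1"

lemma \<sigma>_less: "c < D \<Longrightarrow> v < n \<Longrightarrow> \<sigma> c v < n"
  using bij_betwE[OF matching] by blast

lemma sum_\<sigma>: "c < D \<Longrightarrow> (\<Sum>v<n. g (\<sigma> c v)) = (\<Sum>v<n. g v)"
  by (rule sum.reindex_bij_betw[OF matching])

text \<open>The square of an average is the average of the squares minus a quarter of the squared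
  difference. Permutations preserve the squared norm, so summing over all colours loses exactly a
  quarter of the energy over all arcs; Cheeger's factor \<open>4 * D\<close> then gives the
  16.\<close>

lemma contraction:
  fixes f :: "nat \<Rightarrow> real"
  assumes "(\<Sum>v<n. f v) = 0"
  shows "(\<Sum>c<D. \<Sum>v<n. ((f v + f (\<sigma> c v)) / 2)\<^sup>2) \<le> (D - \<kappa>\<^sup>2 / (16 * D)) * (\<Sum>v<n. (f v)\<^sup>2)"
proof -
  let ?s = "\<Sum>v<n. (f v)\<^sup>2" and ?E = "\<Sum>(u, v)\<in>R. (f u - f v)\<^sup>2"
  have one: "(\<Sum>v<n. ((f v + f (\<sigma> c v)) / 2)\<^sup>2) = ?s - (\<Sum>v<n. (f v - f (\<sigma> c v))\<^sup>2) / 4" if "c < D" for c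
  proof -
    have "(\<Sum>v<n. ((f v + f (\<sigma> c v)) / 2)\<^sup>2) =
        (\<Sum>v<n. (f v)\<^sup>2 / 2 + (f (\<sigma> c v))\<^sup>2 / 2 - (f v - f (\<sigma> c v))\<^sup>2 / 4)"
      by (intro sum.cong refl) (simp add: power2_eq_square field_simps)
    also have "\<dots> = ?s / 2 + (\<Sum>v<n. (f (\<sigma> c v))\<^sup>2) / 2 - (\<Sum>v<n. (f v - f (\<sigma> c v))\<^sup>2) / 4"
      by (simp add: sum.distrib sum_subtractf sum_divide_distrib)
    finally show ?thesis using sum_\<sigma>[OF that, of "\<lambda>v. (f v)\<^sup>2"] by simp
  qed
  have "?E = (\<Sum>(c, v)\<in>{..<D} \<times> {..<n}. (f v - f (\<sigma> c v))\<^sup>2)"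
    using sum.reindex_bij_betw[OF decomposition, of "\<lambda>(u, v). (f u - f v)\<^sup>2"] by (simp add: case_prod_beta)
  also have "\<dots> = (\<Sum>c<D. \<Sum>v<n. (f v - f (\<sigma> c v))\<^sup>2)" by (rule sum.cartesian_product[symmetric])
  finally have E: "(\<Sum>c<D. \<Sum>v<n. (f v - f (\<sigma> c v))\<^sup>2) = ?E" by simp
  have "(\<Sum>c<D. \<Sum>v<n. ((f v + f (\<sigma> c v)) / 2)\<^sup>2) = D * ?s - ?E / 4"
    unfolding E[symmetric] using one by (simp add: sum_subtractf sum_divide_distrib del: One_nat_def)
  moreover have "\<kappa>\<^sup>2 / (16 * D) * ?s \<le> ?E / 4"
    using cheeger[OF assms] nonempty by (simp add: field_simps)
  ultimately show ?thesis by (simp add: algebra_simps)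
qed

lemma walk_row_sum:
  assumes "\<And>i. i < j \<Longrightarrow> sel i < D" "x < n"
  shows "(\<Sum>v<n. walk M sel j x v) = 2 ^ j"
  using assms(1)
proof (induction j)
  case (Suc j)
  then show ?case using sum_\<sigma>[of "sel j" "walk M sel j x"] by (simp add: sum.distrib)
qed (use assms(2) in simp)

text \<open>Together with the row sums this makes the walk matrix doubly stochastic up to scale: a
  new column is just the sum of two old ones. It is needed to cap by 1 the mass that all walks
  together can place on one vertex.\<close>

lemma walk_column_sum:
  assumes "\<And>i. i < j \<Longrightarrow> sel i < D" "v < n"
  shows "(\<Sum>x<n. walk M sel j x v) = 2 ^ j"
  using assms
proof (induction j arbitrary: v)
  case (Suc j)
  then show ?case using \<sigma>_less[of "sel j" v] by (simp add: sum.distrib)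
qed simp

definition centred :: "(nat \<Rightarrow> nat) \<Rightarrow> nat \<Rightarrow> nat \<Rightarrow> nat \<Rightarrow> real" where
  "centred sel j x v = walk M sel j x v / 2 ^ j - 1 / n"

definition spread :: "(nat \<Rightarrow> nat \<Rightarrow> real) \<Rightarrow> real" where
  "spread f = (\<Sum>x<n. \<Sum>v<n. (f x v)\<^sup>2)"

lemma centred_Suc: "centred sel (Suc j) x v = (centred sel j x v + centred sel j x (\<sigma> (sel j) v)) / 2"
  by (simp add: centred_def field_simps)

lemma sum_centred:
  assumes "\<And>i. i < j \<Longrightarrow> sel i < D" "x < n"
  shows "(\<Sum>v<n. centred sel j x v) = 0"
proof -
  have "(\<Sum>v<n. real (walk M sel j x v)) = 2 ^ j"
    unfolding of_nat_sum[symmetric] using walk_row_sum[of j sel x] assms by simp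
  then show ?thesis
    using nonempty by (simp add: centred_def sum_subtractf flip: sum_divide_distrib)
qed

text \<open>Expanding around the mean \<open>1 / n\<close>, the linear terms vanish because centred
  rows sum to 0, and the constants \<open>1 / n^2\<close> add up to 1. Hence integer cost and spread
  are related by one increasing affine map for all colours, and the exact comparisons of the program
  minimise the spread.\<close>

lemma step_cost_eq:
  assumes sel: "\<And>i. i < j \<Longrightarrow> sel i < D" and c: "c < D"
  shows "real (step_cost n M (walk M sel j) c) =
    4 ^ Suc j * (spread (\<lambda>x v. (centred sel j x v + centred sel j x (\<sigma> c v)) / 2) + 1)"
proof -
  let ?a = "\<lambda>x v. (centred sel j x v + centred sel j x (\<sigma> c v)) / 2"
  have "real (step_cost n M (walk M sel j) c) =
      (\<Sum>x<n. \<Sum>v<n. (real (walk M sel j x v) + real (walk M sel j x (\<sigma> c v)))\<^sup>2)"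
    by (simp add: step_cost_def)
  also have "\<dots> = (\<Sum>x<n. \<Sum>v<n. 4 ^ Suc j * ((?a x v)\<^sup>2 + (2 / n) * ?a x v + 1 / n\<^sup>2))"
  proof (intro sum.cong refl)
    fix x v
    have "real (walk M sel j x v) + real (walk M sel j x (\<sigma> c v)) = 2 ^ Suc j * (?a x v + 1 / n)"
      by (simp add: centred_def field_simps)
    moreover have "((2::real) ^ Suc j)\<^sup>2 = 4 ^ Suc j"
      by (simp add: power2_eq_square flip: power_mult_distrib)
    ultimately show "(real (walk M sel j x v) + real (walk M sel j x (\<sigma> c v)))\<^sup>2 =
        4 ^ Suc j * ((?a x v)\<^sup>2 + (2 / n) * ?a x v + 1 / n\<^sup>2)"
      by (simp only: power_mult_distrib) (simp add: power2_sum power_divide mult.commute)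
  qed
  also have "\<dots> = 4 ^ Suc j * (\<Sum>x<n. \<Sum>v<n. (?a x v)\<^sup>2 + (2 / n) * ?a x v + 1 / n\<^sup>2)"
    by (simp only: sum_distrib_left)
  also have "(\<Sum>x<n. \<Sum>v<n. (?a x v)\<^sup>2 + (2 / n) * ?a x v + 1 / n\<^sup>2) =
     (\<Sum>x<n. (\<Sum>v<n. (?a x v)\<^sup>2) + 1 / n)"
  proof (intro sum.cong refl)
    fix x assume "x \<in> {..<n}"
    then have "(\<Sum>v<n. ?a x v) = 0"
      using sum_centred[of j sel x] sel sum_\<sigma>[OF c, of "centred sel j x"]
      by (simp add: sum.distrib flip: sum_divide_distrib)
    then have "(\<Sum>v<n. (2 / n) * ?a x v) = 0" by (simp only: sum_distrib_left[symmetric])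
    then show "(\<Sum>v<n. (?a x v)\<^sup>2 + (2 / n) * ?a x v + 1 / n\<^sup>2) = (\<Sum>v<n. (?a x v)\<^sup>2) + 1 / n"
      using nonempty by (simp only: sum.distrib) (simp add: power2_eq_square)
  qed
  also have "\<dots> = spread ?a + 1"
    using nonempty by (simp add: spread_def sum.distrib)
  finally show ?thesis .
qed

lemma spread_Suc_le:
  fixes g :: real
  assumes greedy: "greedy n D M sel T" and j: "j < T"
    and g: "0 < g" "g < 1" "real T \<le> g * D" "32 * g * D\<^sup>2 \<le> \<kappa>\<^sup>2"
  shows "spread (centred sel (Suc j)) \<le> (1 - g) * spread (centred sel j)"
proof -
  let ?s = "spread (centred sel j)"
  let ?a = "\<lambda>c. spread (\<lambda>x v. (centred sel j x v + centred sel j x (\<sigma> c v)) / 2)"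
  have sel: "sel i < D" if "i < T" for i using greedy that by (simp add: greedy_def)
  have sel': "sel i < D" if "i < j" for i using sel that j by simp
  let ?U = "{..<D} - sel ` {..<j}"
  have nonneg: "0 \<le> spread f" for f unfolding spread_def by (intro sum_nonneg) simp
  have next_eq: "spread (centred sel (Suc j)) = ?a (sel j)"
    unfolding spread_def centred_Suc ..
  have min: "?a (sel j) \<le> ?a c" if "c \<in> ?U" for c
  proof -
    have "step_cost n M (walk M sel j) (sel j) \<le> step_cost n M (walk M sel j) c"
      using greedy j that by (simp add: greedy_def)
    then have "real (step_cost n M (walk M sel j) (sel j)) \<le> real (step_cost n M (walk M sel j) c)"
      by simp
    then show ?thesis
      using step_cost_eq[of j sel "sel j"] step_cost_eq[of j sel c] sel' sel[OF j] that
      by (simp del: One_nat_def)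
  qed
  have "card ?U \<ge> D - j"
    using diff_card_le_card_Diff[of "sel ` {..<j}" "{..<D}"] card_image_le[of "{..<j}" sel] by simp
  then have U: "(1 - g) * D \<le> card ?U" using g(3) j by (simp add: algebra_simps)
  have "((1 - g) * D) * ?a (sel j) \<le> card ?U * ?a (sel j)"
    using U nonneg by (rule mult_right_mono)
  also have "\<dots> = (\<Sum>c\<in>?U. ?a (sel j))" by simp
  also have "\<dots> \<le> (\<Sum>c\<in>?U. ?a c)" using min by (rule sum_mono)
  also have "\<dots> \<le> (\<Sum>c<D. ?a c)" using nonneg by (intro sum_mono2) auto
  also have "\<dots> = (\<Sum>x<n. \<Sum>c<D. \<Sum>v<n. ((centred sel j x v + centred sel j x (\<sigma> c v)) / 2)\<^sup>2)"
    unfolding spread_def by (rule sum.swap)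
  also have "\<dots> \<le> (\<Sum>x<n. (D - \<kappa>\<^sup>2 / (16 * D)) * (\<Sum>v<n. (centred sel j x v)\<^sup>2))"
    using sel' by (intro sum_mono contraction sum_centred) auto
  also have "\<dots> = (D - \<kappa>\<^sup>2 / (16 * D)) * ?s"
    by (simp add: spread_def sum_distrib_left)
  also have "\<dots> \<le> ((1 - g) * (1 - g) * D) * ?s"
  proof (intro mult_right_mono nonneg)
    have "2 * g * D \<le> \<kappa>\<^sup>2 / (16 * D)"
      using g(4) nonempty by (simp add: field_simps power2_eq_square)
    moreover have "(1 - 2 * g) * D \<le> (1 - g) * (1 - g) * D"
      by (intro mult_right_mono) (simp_all add: algebra_simps)
    ultimately show "D - \<kappa>\<^sup>2 / (16 * D) \<le> (1 - g) * (1 - g) * D" by (simp add: algebra_simps)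
  qed
  finally have "((1 - g) * D) * ?a (sel j) \<le> ((1 - g) * D) * ((1 - g) * ?s)" by (simp add: mult_ac)
  then show ?thesis
    unfolding next_eq using g nonempty by (subst (asm) mult_le_cancel_left_pos) auto
qed

lemma spread_le:
  fixes g :: real
  assumes greedy: "greedy n D M sel T"
    and g: "0 < g" "g < 1" "real T \<le> g * D" "32 * g * D\<^sup>2 \<le> \<kappa>\<^sup>2"
    and j: "j \<le> T"
  shows "spread (centred sel j) \<le> (1 - g) ^ j * n"
  using j
proof (induction j)
  case 0
  have "(\<Sum>v<n. (centred sel 0 x v)\<^sup>2) \<le> 1" if "x < n" for x
  proof -
    \<comment> \<open>The entry at \<open>x\<close> is \<open>1 - 1 / n\<close>, with square
      \<open>1 - 2 / n + 1 / n^2\<close>; all others are \<open>- 1 / n\<close>.\<close>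
    have "(\<Sum>v<n. (centred sel 0 x v)\<^sup>2) = (\<Sum>v<n. (if v = x then 1 - 2 / n else 0) + 1 / n\<^sup>2)"
      by (intro sum.cong refl) (simp add: centred_def power2_eq_square algebra_simps)
    also have "\<dots> = 1 - 1 / n"
      using that by (simp add: sum.distrib power2_eq_square)
    finally show ?thesis by simp
  qed
  then have "spread (centred sel 0) \<le> (\<Sum>x<n. 1)" unfolding spread_def by (intro sum_mono) simp
  then show ?case by simp
next
  case (Suc j)
  have "spread (centred sel (Suc j)) \<le> (1 - g) * spread (centred sel j)"
    using Suc.prems by (intro spread_Suc_le[OF greedy _ g]) simp
  also have "\<dots> \<le> (1 - g) * ((1 - g) ^ j * n)"
    using Suc g by (intro mult_left_mono) auto
  finally show ?case by simp
qed

text \<open>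
  The mass that the walks started in S carry out of S: at each step it grows by at most half the
  number of arcs of the current matching that enter S.
\<close>

lemma crossing_arcs:
  assumes greedy: "greedy n D M sel T"
    and mixed: "spread (centred sel T) \<le> 1 / (16 * n\<^sup>2)"
    and S: "S \<subseteq> {..<n}" "2 * card S \<le> n"
  shows "3 / 4 * card S \<le> real (\<Sum>j<T. card {v \<in> {..<n} - S. \<sigma> (sel j) v \<in> S})"
proof -
  have sel: "sel i < D" if "i < T" for i using greedy that by (simp add: greedy_def)
  have finS: "finite S" using S(1) finite_subset by blast
  let ?C = "{..<n} - S"
  define F where "F j v = (\<Sum>x\<in>S. walk M sel j x v / (2::real) ^ j)" for j v
  let ?cross = "\<lambda>j. card {v \<in> ?C. \<sigma> (sel j) v \<in> S}"
  have F0: "0 \<le> F j v" for j v unfolding F_def by (intro sum_nonneg) simp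
  \<comment> \<open>Enlarging \<open>S\<close> to all start vertices turns the mass at
    \<open>v\<close> into a normalised column sum.\<close>
  have F1: "F j v \<le> 1" if "j \<le> T" "v < n" for j v
  proof -
    have "F j v \<le> (\<Sum>x<n. walk M sel j x v / (2::real) ^ j)"
      unfolding F_def using S by (intro sum_mono2) auto
    also have "\<dots> = real (\<Sum>x<n. walk M sel j x v) / 2 ^ j" by (simp add: sum_divide_distrib)
    also have "\<dots> = 1" using that sel by (subst walk_column_sum) auto
    finally show ?thesis .
  qed
  have mass: "(\<Sum>v\<in>?C. F j v) \<le> (\<Sum>i<j. ?cross i) / 2" if "j \<le> T" for j
    using that
  proof (induction j)
    case 0
    have "F 0 v = 0" if "v \<in> ?C" for v unfolding F_def using that by (intro sum.neutral) auto
    then show ?case by simp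
  next
    case (Suc j)
    then have j: "j < T" by simp
    let ?\<sigma> = "\<sigma> (sel j)"
    have "(\<Sum>v\<in>?C. F (Suc j) v) = (\<Sum>v\<in>?C. (F j v + F j (?\<sigma> v)) / 2)"
      by (intro sum.cong refl) (simp add: F_def sum_divide_distrib add_divide_distrib mult.commute[of 2] flip: sum.distrib)
    also have "\<dots> = ((\<Sum>v\<in>?C. F j v) + (\<Sum>v\<in>?C. F j (?\<sigma> v))) / 2"
      by (simp add: sum.distrib flip: sum_divide_distrib)
    also have "(\<Sum>v\<in>?C. F j (?\<sigma> v)) = (\<Sum>v\<in>?\<sigma> ` ?C. F j v)"
      using matching[OF sel[OF j]] by (subst sum.reindex) (auto simp: bij_betw_def inj_on_diff)
    \<comment> \<open>The permutation maps the complement of \<open>S\<close> partly to itself and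
      partly into \<open>S\<close>, the latter along arcs that enter \<open>S\<close>; each vertex
      so reached carries mass at most 1.\<close>
    also have "\<dots> \<le> (\<Sum>v\<in>?C. F j v) + ?cross j"
    proof -
      have im: "?\<sigma> ` ?C \<subseteq> {..<n}" using \<sigma>_less[OF sel[OF j]] by auto
      have "(\<Sum>v\<in>?\<sigma> ` ?C. F j v) \<le> (\<Sum>v\<in>?C \<union> ?\<sigma> ` {v \<in> ?C. ?\<sigma> v \<in> S}. F j v)"
        using im F0 by (intro sum_mono2) auto
      also have "\<dots> \<le> (\<Sum>v\<in>?C. F j v) + (\<Sum>v\<in>?\<sigma> ` {v \<in> ?C. ?\<sigma> v \<in> S}. F j v)"
        using F0 by (subst sum.union_inter_neutral) auto
      also have "(\<Sum>v\<in>?\<sigma> ` {v \<in> ?C. ?\<sigma> v \<in> S}. F j v) \<le> (\<Sum>v\<in>?\<sigma> ` {v \<in> ?C. ?\<sigma> v \<in> S}. 1)"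
        using F1[of j] im j by (intro sum_mono) auto
      also have "\<dots> \<le> ?cross j" by (simp add: card_image_le)
      finally show ?thesis by simp
    qed
    finally show ?case using Suc by simp
  qed
  \<comment> \<open>The bound \<open>1 / (16 * n^2)\<close> is the square of
    \<open>1 / (4 * n)\<close>, so each individual entry lies within \<open>1 / (4 * n)\<close> of
    \<open>1 / n\<close>.\<close>
  have entry: "3 / (4 * n) \<le> walk M sel T x v / (2::real) ^ T" if "x < n" "v < n" for x v
  proof -
    have "(centred sel T x v)\<^sup>2 \<le> (\<Sum>v<n. (centred sel T x v)\<^sup>2)"
      using that by (intro member_le_sum) auto
    also have "\<dots> \<le> spread (centred sel T)"
      unfolding spread_def using that by (intro member_le_sum[of x]) (auto intro: sum_nonneg)
    also have "\<dots> \<le> (1 / (4 * n))\<^sup>2" using mixed by (simp add: power2_eq_square)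
    finally have "\<bar>centred sel T x v\<bar>\<^sup>2 \<le> (1 / (4 * n))\<^sup>2" by simp
    then have "\<bar>centred sel T x v\<bar> \<le> 1 / (4 * n)" by (rule power2_le_imp_le) simp
    then have "- (1 / (4 * n)) \<le> walk M sel T x v / (2::real) ^ T - 1 / n" by (simp add: centred_def)
    moreover have "1 / real n - 1 / (4 * n) = 3 / (4 * n)" using nonempty by (simp add: field_simps)
    ultimately show ?thesis by linarith
  qed
  have cardC: "card ?C = n - card S" using S finS by (simp add: card_Diff_subset)
  \<comment> \<open>At least \<open>n / 2\<close> vertices lie outside \<open>S\<close>, so the mass
    there is at least 3/8 of \<open>card S\<close>; the half unit per crossing arc doubles this to
    3/4.\<close>
  have "(\<Sum>v\<in>?C. \<Sum>x\<in>S. 3 / (4 * real n)) \<le> (\<Sum>v\<in>?C. F T v)"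
    unfolding F_def using S entry by (intro sum_mono) auto
  also have "\<dots> \<le> (\<Sum>i<T. ?cross i) / 2" by (rule mass) simp
  finally have "(n - card S) * (card S * (3 / (4 * real n))) \<le> (\<Sum>i<T. ?cross i) / 2"
    by (simp add: cardC)
  moreover have "real n / 2 * (card S * (3 / (4 * real n))) \<le> (n - card S) * (card S * (3 / (4 * real n)))"
    using S by (intro mult_right_mono) auto
  moreover have "real n / 2 * (card S * (3 / (4 * real n))) = 3 / 8 * card S"
    using nonempty by simp
  ultimately show ?thesis unfolding of_nat_sum by linarith
qed

end

section \<open>Cuts, degrees and relabelling of weighted graphs\<close>

lemma simple_graph_edgeE:
  assumes "simple_graph V E" "e \<in> E"
  obtains u v where "e = {u, v}" "u \<noteq> v" "u \<in> V" "v \<in> V"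
proof -
  have e: "e \<subseteq> V" "card e = 2" using assms by (simp_all add: simple_graph_def)
  from e(2) obtain u v where "e = {u, v}" "u \<noteq> v" by (metis card_2_iff)
  with e(1) show thesis using that by simp
qed

text \<open>An edge that meets \<open>S\<close> in exactly one point has exactly one orientation out
  of \<open>S\<close>.\<close>

lemma cut_weight_pairs:
  assumes G: "simple_graph V E" and S: "S \<subseteq> V"
  shows "cut_weight E w S = (\<Sum>(u, v)\<in>{(u, v). u \<in> S \<and> v \<in> V - S \<and> {u, v} \<in> E}. w {u, v})"
proof -
  let ?P = "{(u, v). u \<in> S \<and> v \<in> V - S \<and> {u, v} \<in> E}"
  have "bij_betw (\<lambda>(u, v). {u, v}) ?P {e \<in> E. card (e \<inter> S) = 1}"
    unfolding bij_betw_def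
  proof (intro conjI equalityI subsetI)
    show "inj_on (\<lambda>(u, v). {u, v}) ?P" by (auto simp: inj_on_def doubleton_eq_iff)
    show "e \<in> {e \<in> E. card (e \<inter> S) = 1}" if "e \<in> (\<lambda>(u, v). {u, v}) ` ?P" for e
    proof -
      from that obtain u v where "u \<in> S" "v \<notin> S" "{u, v} \<in> E" "e = {u, v}" by auto
      moreover from this have "e \<inter> S = {u}" by auto
      ultimately show ?thesis by simp
    qed
    show "e \<in> (\<lambda>(u, v). {u, v}) ` ?P" if e: "e \<in> {e \<in> E. card (e \<inter> S) = 1}" for e
    proof -
      obtain u v where uv: "e = {u, v}" "u \<noteq> v" "u \<in> V" "v \<in> V"
        using simple_graph_edgeE[OF G, of e] e by blast
      consider "u \<in> S" "v \<in> S" | "u \<in> S" "v \<notin> S" | "u \<notin> S" "v \<in> S" | "u \<notin> S" "v \<notin> S" by blast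
      then show ?thesis
      proof cases
        case 1
        then have "e \<inter> S = {u, v}" using uv by auto
        then show ?thesis using e uv by simp
      next
        case 2
        then have "(u, v) \<in> ?P" using e uv by simp
        then show ?thesis using uv by (intro image_eqI[of _ _ "(u, v)"]) simp_all
      next
        case 3
        then have "(v, u) \<in> ?P" using e uv by (simp add: insert_commute)
        then show ?thesis using uv by (intro image_eqI[of _ _ "(v, u)"]) auto
      next
        case 4
        then have "e \<inter> S = {}" using uv by auto
        then show ?thesis using e by simp
      qed
    qed
  qed
  from sum.reindex_bij_betw[OF this, of w] show ?thesis
    unfolding cut_weight_def by (simp add: case_prod_beta)
qed

lemma weighted_degree_pairs:
  assumes G: "simple_graph V E" and v: "v \<in> V"
  shows "weighted_degree E w v = (\<Sum>u\<in>{u \<in> V. {v, u} \<in> E}. w {v, u})"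
proof -
  have "bij_betw (\<lambda>u. {v, u}) {u \<in> V. {v, u} \<in> E} {e \<in> E. v \<in> e}"
    unfolding bij_betw_def
  proof (intro conjI equalityI subsetI)
    show "inj_on (\<lambda>u. {v, u}) {u \<in> V. {v, u} \<in> E}" by (auto simp: inj_on_def doubleton_eq_iff)
    show "e \<in> (\<lambda>u. {v, u}) ` {u \<in> V. {v, u} \<in> E}" if e: "e \<in> {e \<in> E. v \<in> e}" for e
    proof -
      obtain a b where ab: "e = {a, b}" "a \<in> V" "b \<in> V" using simple_graph_edgeE[OF G, of e] e by blast
      then show ?thesis using e by (auto simp: insert_commute)
    qed
  qed auto
  from sum.reindex_bij_betw[OF this, of w] show ?thesis
    unfolding weighted_degree_def by simp
qed

lemma finite_cut_ratios:
  assumes "finite V"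
  shows "finite {cut_weight E w S / real (card S) | S. S \<subset> V \<and> 0 < card S \<and> real (card S) \<le> real (card V) / 2}"
    (is "finite ?A")
proof (rule finite_subset)
  show "?A \<subseteq> (\<lambda>S. cut_weight E w S / real (card S)) ` Pow V" by blast
qed (use assms in simp)

lemma edge_expansion_cut:
  fixes b :: real
  assumes "finite V" "b \<le> edge_expansion V E w" "S \<subseteq> V" "S \<noteq> {}" "2 * card S \<le> card V"
  shows "b * card S \<le> cut_weight E w S"
proof -
  have "finite S" "0 < card S" using assms by (auto intro: finite_subset simp: card_gt_0_iff)
  moreover have "S \<noteq> V" using assms(5) calculation by auto
  ultimately have "edge_expansion V E w \<le> cut_weight E w S / card S"
    unfolding edge_expansion_def using assms by (intro Min_le finite_cut_ratios) auto
  then have "b \<le> cut_weight E w S / card S" using assms(2) by simp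
  then show ?thesis using \<open>0 < card S\<close> by (simp add: field_simps)
qed

text \<open>With two vertices or more a singleton is an admissible set, so the minimum is taken over
  a nonempty set.\<close>

lemma edge_expansion_ge:
  fixes b :: real
  assumes "finite V" "2 \<le> card V"
    and "\<And>S. S \<subseteq> V \<Longrightarrow> S \<noteq> {} \<Longrightarrow> 2 * card S \<le> card V \<Longrightarrow> b * card S \<le> cut_weight E w S"
  shows "b \<le> edge_expansion V E w"
  unfolding edge_expansion_def
proof (rule Min.boundedI)
  obtain v where "v \<in> V" using assms(2) by fastforce
  then have "{v} \<subset> V" using assms(2) by (auto simp: psubset_eq)
  then show "{cut_weight E w S / real (card S) | S. S \<subset> V \<and> 0 < card S \<and> real (card S) \<le> real (card V) / 2} \<noteq> {}"
    using assms(2) by (auto intro!: exI[of _ "{v}"])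
  fix a assume "a \<in> {cut_weight E w S / real (card S) | S. S \<subset> V \<and> 0 < card S \<and> real (card S) \<le> real (card V) / 2}"
  then obtain S where S: "a = cut_weight E w S / real (card S)" "S \<subset> V" "0 < card S" "real (card S) \<le> real (card V) / 2"
    by blast
  then have "b * card S \<le> cut_weight E w S" using assms(3)[of S] by force
  then show "b \<le> a" unfolding S(1) using S(3) by (simp add: pos_le_divide_eq)
qed (rule finite_cut_ratios[OF assms(1)])

section \<open>Invariance under relabelling of the vertices\<close>

context
  fixes k :: "'a \<Rightarrow> 'b" and V :: "'a set" and E :: "'a set set"
  assumes inj: "inj_on k V" and G: "simple_graph V E"
begin

lemma inj_on_edges: "inj_on ((`) k) (Pow V)"
  using inj by (rule inj_on_image_Pow)

lemma simple_graph_image: "simple_graph (k ` V) ((`) k ` E)"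
proof -
  have "card (k ` e) = 2" "k ` e \<subseteq> k ` V" if "e \<in> E" for e
    using that G inj by (auto simp: simple_graph_def card_image inj_on_subset)
  then show ?thesis using G by (auto simp: simple_graph_def)
qed

lemma weighted_degree_image:
  assumes "v \<in> V"
  shows "weighted_degree ((`) k ` E) w (k v) = weighted_degree E (\<lambda>e. w (k ` e)) v"
proof -
  have sub: "e \<subseteq> V" if "e \<in> E" for e using that G by (auto simp: simple_graph_def)
  then have "k v \<in> k ` e \<longleftrightarrow> v \<in> e" if "e \<in> E" for e
    using inj_on_image_mem_iff[OF inj assms] that by blast
  then have "{e \<in> (`) k ` E. k v \<in> e} = (`) k ` {e \<in> E. v \<in> e}" by blast
  moreover have "inj_on ((`) k) {e \<in> E. v \<in> e}"
    using sub by (intro inj_on_subset[OF inj_on_edges]) auto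
  ultimately show ?thesis unfolding weighted_degree_def by (simp add: sum.reindex)
qed

lemma cut_weight_image:
  assumes "S \<subseteq> V"
  shows "cut_weight ((`) k ` E) w (k ` S) = cut_weight E (\<lambda>e. w (k ` e)) S"
proof -
  have sub: "e \<subseteq> V" if "e \<in> E" for e using that G by (auto simp: simple_graph_def)
  have "card (k ` e \<inter> k ` S) = card (e \<inter> S)" if "e \<in> E" for e
    using inj_on_image_Int[OF inj sub[OF that] assms] card_image[of k "e \<inter> S"] inj assms
    by (metis inf.coboundedI2 inj_on_subset)
  then have "{e \<in> (`) k ` E. card (e \<inter> k ` S) = 1} = (`) k ` {e \<in> E. card (e \<inter> S) = 1}"
    by auto
  moreover have "inj_on ((`) k) {e \<in> E. card (e \<inter> S) = 1}"
    using sub by (intro inj_on_subset[OF inj_on_edges]) auto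
  ultimately show ?thesis unfolding cut_weight_def by (simp add: sum.reindex)
qed

lemma edge_expansion_image:
  "edge_expansion (k ` V) ((`) k ` E) w = edge_expansion V E (\<lambda>e. w (k ` e))"
proof -
  have card: "card (k ` S) = card S" if "S \<subseteq> V" for S
    using inj that by (intro card_image) (rule inj_on_subset)
  have psub: "k ` S \<subset> k ` V \<longleftrightarrow> S \<subset> V" if "S \<subseteq> V" for S
    using inj_on_image_eq_iff[OF inj that order_refl] that by blast
  have "{cut_weight ((`) k ` E) w T / real (card T) | T. T \<subset> k ` V \<and> 0 < card T \<and> real (card T) \<le> real (card (k ` V)) / 2}
      = {cut_weight E (\<lambda>e. w (k ` e)) S / real (card S) | S. S \<subset> V \<and> 0 < card S \<and> real (card S) \<le> real (card V) / 2}"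
    (is "?L = ?R")
  proof (intro equalityI subsetI)
    fix a assume "a \<in> ?L"
    then obtain T where T: "a = cut_weight ((`) k ` E) w T / real (card T)" "T \<subset> k ` V" "0 < card T"
      "real (card T) \<le> real (card (k ` V)) / 2" by blast
    obtain S where S: "S \<subseteq> V" "T = k ` S" using T(2) by (meson psubsetE subset_imageE)
    then show "a \<in> ?R" using T by (auto simp: card psub cut_weight_image)
  next
    fix a assume "a \<in> ?R"
    then obtain S where S: "a = cut_weight E (\<lambda>e. w (k ` e)) S / real (card S)" "S \<subset> V" "0 < card S"
      "real (card S) \<le> real (card V) / 2" by blast
    then have "S \<subseteq> V" by blast
    then show "a \<in> ?L"
      using S by (intro CollectI exI[of _ "k ` S"]) (simp add: card psub cut_weight_image)
  qed
  then show ?thesis unfolding edge_expansion_def by simp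
qed

end

lemma weighted_regular_image:
  assumes "inj_on k V" "simple_graph V E"
  shows "weighted_regular (k ` V) ((`) k ` E) w d \<longleftrightarrow> weighted_regular V E (\<lambda>e. w (k ` e)) d"
  using weighted_degree_image[OF assms] by (simp add: weighted_regular_def)

lemma dense_expander_image:
  assumes "inj_on k V" "dense_expander \<beta> \<gamma> V E"
  shows "dense_expander \<beta> \<gamma> (k ` V) ((`) k ` E)"
proof -
  have G: "simple_graph V E" using assms(2) by (simp add: dense_expander_def)
  show ?thesis
    using assms simple_graph_image[OF assms(1) G]
    unfolding dense_expander_def
    by (simp add: weighted_regular_image[OF assms(1) G] edge_expansion_image[OF assms(1) G] card_image)
qed

lemma regular_expander_subgraph_preimage:
  assumes k: "inj_on k V" and G: "simple_graph V E"
    and H: "regular_expander_subgraph b (k ` V) ((`) k ` E) F w"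
  shows "regular_expander_subgraph b V E {e \<in> E. k ` e \<in> F} (\<lambda>e. w (k ` e))"
proof -
  let ?F = "{e \<in> E. k ` e \<in> F}"
  have F: "(`) k ` ?F = F" using H by (auto simp: regular_expander_subgraph_def)
  have G': "simple_graph V ?F" using G by (auto simp: simple_graph_def)
  show ?thesis
    using H weighted_regular_image[OF k G', of w] edge_expansion_image[OF k G', of w]
    unfolding F regular_expander_subgraph_def by auto
qed

section \<open>From colourings to expanders\<close>

lemma card_out_arcs:
  assumes "simple_graph {..<n} E" "weighted_regular {..<n} E (\<lambda>_. 1) (real D)" "u < n"
  shows "card {v. (u, v) \<in> arcs n E} = D"
proof -
  have "{v. (u, v) \<in> arcs n E} = {v \<in> {..<n}. {u, v} \<in> E}" using assms(3) by (auto simp: arcs_def)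
  moreover have "real (card {v \<in> {..<n}. {u, v} \<in> E}) = D"
    using weighted_degree_pairs[OF assms(1), of u "\<lambda>_. 1"] assms(2,3)
    by (simp add: weighted_regular_def)
  ultimately show ?thesis by simp
qed

lemma finite_arcs: "finite (arcs n E)"
  by (rule finite_subset[of _ "{..<n} \<times> {..<n}"]) (auto simp: arcs_def)

lemma expanding_relation_arcs:
  assumes G: "simple_graph {..<n} E" and reg: "weighted_regular {..<n} E (\<lambda>_. 1) (real D)"
    and exp: "\<kappa> \<le> edge_expansion {..<n} E (\<lambda>_. 1)" and \<kappa>: "0 \<le> \<kappa>"
  shows "expanding_relation {..<n} (arcs n E) D \<kappa>"
proof
  show "card {p \<in> arcs n E. fst p = v} \<le> D" if "v \<in> {..<n}" for v
  proof -
    have "{p \<in> arcs n E. fst p = v} = Pair v ` {w. (v, w) \<in> arcs n E}" by auto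
    moreover have "card (Pair v ` {w. (v, w) \<in> arcs n E}) = card {w. (v, w) \<in> arcs n E}"
      by (intro card_image) (auto simp: inj_on_def)
    ultimately show ?thesis using card_out_arcs[OF G reg, of v] that by simp
  qed
  show "card {p \<in> arcs n E. snd p = v} \<le> D" if "v \<in> {..<n}" for v
  proof -
    have "{p \<in> arcs n E. snd p = v} = (\<lambda>w. (w, v)) ` {w. (v, w) \<in> arcs n E}"
      by (auto simp: arcs_def insert_commute)
    moreover have "card ((\<lambda>w. (w, v)) ` {w. (v, w) \<in> arcs n E}) = card {w. (v, w) \<in> arcs n E}"
      by (intro card_image) (auto simp: inj_on_def)
    ultimately show ?thesis using card_out_arcs[OF G reg, of v] that by simp
  qed
  show "\<kappa> * card S \<le> card {(u, v) \<in> arcs n E. u \<in> S \<and> v \<notin> S}"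
    if S: "S \<subseteq> {..<n}" "S \<noteq> {}" "2 * card S \<le> card {..<n}" for S
  proof -
    have "{(u, v) \<in> arcs n E. u \<in> S \<and> v \<notin> S} = {(u, v). u \<in> S \<and> v \<in> {..<n} - S \<and> {u, v} \<in> E}"
      using S by (auto simp: arcs_def)
    then show ?thesis
      using edge_expansion_cut[OF _ exp S] cut_weight_pairs[OF G S(1), of "\<lambda>_. 1"]
      by (simp add: case_prod_beta)
  qed
qed (use \<kappa> finite_arcs in \<open>auto simp: arcs_def\<close>)

text \<open>This is where regularity is used: with exactly as many colours as the degree, every
  colour occurs at every vertex. Each class is then a total map, injective because the second table
  inverts it, and so a permutation.\<close>

lemma matching_decomposition_arcs:
  assumes G: "simple_graph {..<n} E" and reg: "weighted_regular {..<n} E (\<lambda>_. 1) (real D)"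
    and exp: "\<kappa> \<le> edge_expansion {..<n} E (\<lambda>_. 1)" and \<kappa>: "0 \<le> \<kappa>"
    and col: "arc_colouring n D (arcs n E) M N" and pos: "0 < n" "0 < D"
  shows "matching_decomposition n (arcs n E) D \<kappa> M"
proof -
  note C = arc_colouringD[OF col]
  \<comment> \<open>Were \<open>c\<close> missing at \<open>u\<close>, the \<open>D\<close> arcs out
    of \<open>u\<close> would have pairwise distinct colours among the other
    \<open>D - 1\<close>.\<close>
  have used: "M [c, u] \<noteq> 0" if cu: "c < D" "u < n" for c u
  proof
    assume zero: "M [c, u] = 0"
    have "\<forall>v\<in>{v. (u, v) \<in> arcs n E}. \<exists>d. d < D \<and> M [d, u] = Suc v"
      using C(5)[OF cu(2)] by (auto simp: arcs_def)
    then obtain d where d: "\<forall>v\<in>{v. (u, v) \<in> arcs n E}. d v < D \<and> M [d v, u] = Suc v"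
      using bchoice[of "{v. (u, v) \<in> arcs n E}" "\<lambda>v d. d < D \<and> M [d, u] = Suc v"] by blast
    have dD: "d v < D" "M [d v, u] = Suc v" if "v \<in> {v. (u, v) \<in> arcs n E}" for v
      using bspec[OF d that] by simp_all
    have "card {v. (u, v) \<in> arcs n E} \<le> card ({..<D} - {c})"
    proof (rule card_inj_on_le)
      show "inj_on d {v. (u, v) \<in> arcs n E}"
      proof (rule inj_onI)
        fix v w assume vw: "v \<in> {v. (u, v) \<in> arcs n E}" "w \<in> {v. (u, v) \<in> arcs n E}" "d v = d w"
        have "Suc v = Suc w"
          unfolding dD(2)[OF vw(1), symmetric] dD(2)[OF vw(2), symmetric] vw(3) ..
        then show "v = w" by simp
      qed
      show "d ` {v. (u, v) \<in> arcs n E} \<subseteq> {..<D} - {c}"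
      proof (rule image_subsetI)
        fix v assume v: "v \<in> {v. (u, v) \<in> arcs n E}"
        have "d v \<noteq> c" using dD(2)[OF v] zero by (intro notI) simp
        then show "d v \<in> {..<D} - {c}" using dD(1)[OF v] by simp
      qed
    qed simp
    then show False using card_out_arcs[OF G reg cu(2)] cu(1) by simp
  qed
  have M: "M [c, u] = Suc (M [c, u] - 1)" "M [c, u] - 1 < n" if "c < D" "u < n" for c u
    using used[OF that] C(2)[OF that] by simp_all
  have bij: "bij_betw (\<lambda>v. M [c, v] - 1) {..<n} {..<n}" if c: "c < D" for c
  proof -
    have inj: "inj_on (\<lambda>v. M [c, v] - 1) {..<n}"
    proof (rule inj_onI)
      fix u v assume uv: "u \<in> {..<n}" "v \<in> {..<n}" "M [c, u] - 1 = M [c, v] - 1"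
      then have lt: "u < n" "v < n" by auto
      have u: "N [c, M [c, u] - 1] = Suc u" by (rule C(4)[OF c lt(1) M(2)[OF c lt(1)], THEN iffD1, OF M(1)[OF c lt(1)]])
      have v: "N [c, M [c, v] - 1] = Suc v" by (rule C(4)[OF c lt(2) M(2)[OF c lt(2)], THEN iffD1, OF M(1)[OF c lt(2)]])
      have "Suc u = Suc v" using u[unfolded uv(3)] v by (rule trans[OF sym])
      then show "u = v" by simp
    qed
    have im: "(\<lambda>v. M [c, v] - 1) ` {..<n} \<subseteq> {..<n}"
      by (rule image_subsetI) (use M(2)[OF c] in simp)
    show ?thesis
      unfolding bij_betw_def using inj endo_inj_surj[OF finite_lessThan im inj] by (rule conjI)
  qed
  have dec: "bij_betw (\<lambda>(c, v). (v, M [c, v] - 1)) ({..<D} \<times> {..<n}) (arcs n E)"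
    unfolding bij_betw_def
  proof (intro conjI equalityI subsetI)
    show "inj_on (\<lambda>(c, v). (v, M [c, v] - 1)) ({..<D} \<times> {..<n})"
    proof (rule inj_onI)
      fix p q :: "nat \<times> nat"
      assume pq: "p \<in> {..<D} \<times> {..<n}" "q \<in> {..<D} \<times> {..<n}"
        "(case p of (c, v) \<Rightarrow> (v, M [c, v] - 1)) = (case q of (c, v) \<Rightarrow> (v, M [c, v] - 1))"
      obtain c v d w where p: "p = (c, v)" and q: "q = (d, w)" by (metis surj_pair)
      have lt: "c < D" "d < D" "v < n" using pq(1,2) unfolding p q by simp_all
      have "v = w \<and> M [c, v] - 1 = M [d, w] - 1"
        using pq(3) unfolding p q prod.case prod.inject .
      then have vw: "v = w" and eq: "M [c, v] - 1 = M [d, w] - 1" by blast+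
      have "M [d, v] = Suc (M [c, v] - 1)" unfolding eq unfolding vw[symmetric] by (rule M(1)[OF lt(2,3)])
      then have "c = d" by (rule C(7)[OF lt M(2)[OF lt(1,3)] M(1)[OF lt(1,3)]])
      then show "p = q" unfolding p q vw by simp
    qed
    show "p \<in> arcs n E" if p: "p \<in> (\<lambda>(c, v). (v, M [c, v] - 1)) ` ({..<D} \<times> {..<n})" for p
    proof -
      obtain q where q: "q \<in> {..<D} \<times> {..<n}" "p = (case q of (c, v) \<Rightarrow> (v, M [c, v] - 1))"
        using p by (rule imageE)
      obtain c v where cv: "q = (c, v)" by (metis surj_pair)
      have lt: "c < D" "v < n" using q(1) unfolding cv by simp_all
      show ?thesis unfolding q(2) cv prod.case by (rule C(6)[OF lt M(2)[OF lt] M(1)[OF lt]])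
    qed
    show "p \<in> (\<lambda>(c, v). (v, M [c, v] - 1)) ` ({..<D} \<times> {..<n})" if p: "p \<in> arcs n E" for p
    proof -
      obtain u v where uv: "p = (u, v)" "u < n" "v < n" using p unfolding arcs_def by blast
      have "\<exists>c<D. M [c, u] = Suc v" by (rule C(5)[OF uv(2,3)]) (rule p[unfolded uv(1)])
      then obtain c where c: "c < D" "M [c, u] = Suc v" by blast
      show ?thesis unfolding uv(1)
      proof (rule image_eqI)
        show "(u, v) = (case (c, u) of (c, v) \<Rightarrow> (v, M [c, v] - 1))" using c(2) by simp
        show "(c, u) \<in> {..<D} \<times> {..<n}" using c(1) uv(2) by simp
      qed
    qed
  qed
  interpret expanding_relation "{..<n}" "arcs n E" D \<kappa>
    by (rule expanding_relation_arcs[OF G reg exp \<kappa>])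
  show ?thesis by unfold_locales (fact bij, fact dec, fact pos(1), fact pos(2))
qed

lemma output_pairs:
  assumes sym: "s ''H'' [u, v] = s ''H'' [v, u]" and uv: "u < n" "v < n" "u \<noteq> v"
  shows "{u, v} \<in> output_edges n s \<longleftrightarrow> s ''H'' [u, v] \<noteq> 0"
    and "output_weight s {u, v} = real (s ''H'' [u, v])"
proof -
  have *: "{u, v} \<in> output_edges n s \<longleftrightarrow> s ''H'' [u, v] \<noteq> 0" if "u < v" "v < n" for u v
    using that by (auto simp: output_edges_def doubleton_eq_iff)
  show "{u, v} \<in> output_edges n s \<longleftrightarrow> s ''H'' [u, v] \<noteq> 0"
    using *[of u v] *[of v u] uv sym by (cases "u < v") (auto simp: insert_commute)
  show "output_weight s {u, v} = real (s ''H'' [u, v])"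
    using uv sym by (cases "u < v") (auto simp: output_weight_def min_def max_def)
qed

lemma output_edgeE:
  assumes "e \<in> output_edges n s"
  obtains u v where "e = {u, v}" "u < v" "v < n" "s ''H'' [u, v] \<noteq> 0"
  using assms unfolding output_edges_def by blast

lemma simple_graph_output: "simple_graph {..<n} (output_edges n s)"
  unfolding simple_graph_def
proof (intro conjI ballI)
  fix e assume "e \<in> output_edges n s"
  then obtain u v where "e = {u, v}" "u < v" "v < n" by (rule output_edgeE)
  then show "e \<subseteq> {..<n}" "card e = 2" by auto
qed simp

text \<open>Every selected permutation adds 2 to the degree of each vertex, once as a tail and once
  as a head. As each arc lies in only one class, \<open>h\<close> counts each of the two
  orientations of an edge at most once.\<close>

lemma (in matching_decomposition) selection_expander:
  assumes greedy: "greedy n D M sel T"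
    and mixed: "spread (centred sel T) \<le> 1 / (16 * n\<^sup>2)"
    and H: "\<And>u w. u < n \<Longrightarrow> w < n \<Longrightarrow>
      s ''H'' [u, w] = (\<Sum>i<T. of_bool (\<sigma> (sel i) u = w) + of_bool (\<sigma> (sel i) w = u))"
    and R: "R = arcs n E" and G: "simple_graph {..<n} E" and n: "2 \<le> n" and T: "2 * real T \<le> b"
  shows "regular_expander_subgraph b {..<n} E (output_edges n s) (output_weight s)"
proof -
  let ?F = "output_edges n s" and ?w = "output_weight s"
  define h where "h u w = s ''H'' [u, w]" for u w
  have sel: "sel i < D" if "i < T" for i using greedy that by (simp add: greedy_def)
  have sel_neq: "sel i \<noteq> sel j" if "i < j" "j < T" for i j
  proof
    assume "sel i = sel j"
    then have "sel j \<in> sel ` {..<j}" using that by (intro image_eqI[of _ _ i]) simp_all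
    then show False using greedy that by (simp add: greedy_def)
  qed
  have arc: "(u, w) \<in> R" if "i < T" "u < n" "\<sigma> (sel i) u = w" for i u w
  proof -
    have "(\<lambda>(c, v). (v, M [c, v] - 1)) (sel i, u) \<in> R"
      using sel[OF that(1)] that(2) by (intro bij_betwE[OF decomposition, rule_format]) simp
    then show ?thesis using that(3) by simp
  qed
  have once: "i = j" if "i < T" "j < T" "u < n" "\<sigma> (sel i) u = w" "\<sigma> (sel j) u = w" for i j u w
  proof -
    have "(sel i, u) = (sel j, u)"
    proof (rule inj_onD[OF bij_betw_imp_inj_on[OF decomposition]])
      show "(case (sel i, u) of (c, v) \<Rightarrow> (v, M [c, v] - 1)) = (case (sel j, u) of (c, v) \<Rightarrow> (v, M [c, v] - 1))"
        unfolding prod.case that(4,5) ..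
    qed (use sel that(1-3) in simp_all)
    then have "sel i = sel j" by simp
    then show ?thesis using sel_neq that(1,2) by (metis linorder_neqE_nat)
  qed
  have count: "(\<Sum>i<T. of_bool (\<sigma> (sel i) u = w)) \<le> (1::nat)" if "u < n" for u w
  proof -
    have "(\<Sum>i<T. of_bool (\<sigma> (sel i) u = w)) = card {i \<in> {..<T}. \<sigma> (sel i) u = w}"
      by (subst sum_of_bool_eq) (simp_all add: Int_def)
    also have "\<dots> \<le> 1"
    proof (subst One_nat_def, subst card_le_Suc0_iff_eq)
      show "\<forall>i\<in>{i \<in> {..<T}. \<sigma> (sel i) u = w}. \<forall>j\<in>{i \<in> {..<T}. \<sigma> (sel i) u = w}. i = j"
      proof (intro ballI)
        fix i j assume ij: "i \<in> {i \<in> {..<T}. \<sigma> (sel i) u = w}" "j \<in> {i \<in> {..<T}. \<sigma> (sel i) u = w}"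
        then have "i < T" "j < T" "\<sigma> (sel i) u = w" "\<sigma> (sel j) u = w" by blast+
        then show "i = j" using once[OF _ _ \<open>u < n\<close>] by blast
      qed
    qed simp
    finally show ?thesis .
  qed
  have h_split: "h u w = (\<Sum>i<T. of_bool (\<sigma> (sel i) u = w)) + (\<Sum>i<T. of_bool (\<sigma> (sel i) w = u))"
    if "u < n" "w < n" for u w
    unfolding h_def H[OF that] by (rule sum.distrib)
  have h_sym: "s ''H'' [u, w] = s ''H'' [w, u]" if "u < n" "w < n" for u w
    using h_split[OF that] h_split[OF that(2,1)] by (simp add: h_def)
  have h_le: "h u w \<le> 2" if "u < n" "w < n" for u w
    using h_split[OF that] count[OF that(1), of w] count[OF that(2), of u] by linarith
  have h_edge: "{u, w} \<in> E" if uw: "u < n" "w < n" "h u w \<noteq> 0" for u w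
  proof (rule ccontr)
    assume no: "{u, w} \<notin> E"
    have "\<sigma> (sel i) u \<noteq> w" "\<sigma> (sel i) w \<noteq> u" if "i < T" for i
      using arc[OF that uw(1), of w] arc[OF that uw(2), of u] no
      unfolding R arcs_def by (auto simp: insert_commute)
    then have "h u w = 0" unfolding h_split[OF uw(1,2)] by simp
    with uw(3) show False by simp
  qed
  \<comment> \<open>A fixed point of a selected permutation would be a loop of the graph, but edges
    have two elements. So the unread diagonal of \<open>H\<close> holds no degree.\<close>
  have h_diag: "h u u = 0" if "u < n" for u
    using h_edge[OF that that] G by (force simp: simple_graph_def)
  have FE: "?F \<subseteq> E"
  proof
    fix e assume "e \<in> ?F"
    then obtain u v where "e = {u, v}" "u < v" "v < n" "s ''H'' [u, v] \<noteq> 0" by (rule output_edgeE)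
    then show "e \<in> E" using h_edge[of u v] by (simp add: h_def)
  qed
  have weights: "\<forall>e\<in>?F. ?w e \<in> {1, 2}"
  proof
    fix e assume "e \<in> ?F"
    then obtain u v where uv: "e = {u, v}" "u < v" "v < n" "s ''H'' [u, v] \<noteq> 0" by (rule output_edgeE)
    then have "s ''H'' [u, v] = 1 \<or> s ''H'' [u, v] = 2" using h_le[of u v] by (auto simp: h_def)
    moreover have "?w e = real (s ''H'' [u, v])"
      unfolding uv(1) using uv h_sym[of u v] by (intro output_pairs(2)) simp_all
    ultimately show "?w e \<in> {1, 2}" by auto
  qed
  have w_eq: "(if {u, v} \<in> ?F then ?w {u, v} else 0) = h u v" if "u < n" "v < n" "u \<noteq> v" for u v
    using output_pairs[where s = s and u = u and v = v and n = n] h_sym[OF that(1,2)] that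
    by (simp add: h_def)
  have reg: "weighted_regular {..<n} ?F ?w (2 * real T)"
    unfolding weighted_regular_def
  proof
    fix v assume v: "v \<in> {..<n}"
    have no_loop: "{v, v} \<notin> ?F"
    proof
      assume "{v, v} \<in> ?F"
      then obtain a b where "{v, v} = {a, b}" "a < b" by (rule output_edgeE)
      then show False by (auto simp: doubleton_eq_iff)
    qed
    have "weighted_degree ?F ?w v = (\<Sum>u\<in>{u \<in> {..<n}. {v, u} \<in> ?F}. ?w {v, u})"
      by (rule weighted_degree_pairs[OF simple_graph_output v])
    also have "\<dots> = (\<Sum>u<n. if {v, u} \<in> ?F then ?w {v, u} else 0)"
      by (rule sum.inter_filter) simp
    also have "\<dots> = (\<Sum>u<n. real (h v u))"
    proof (rule sum.cong[OF refl])
      show "(if {v, u} \<in> ?F then ?w {v, u} else 0) = real (h v u)" if "u \<in> {..<n}" for u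
        using w_eq[of v u] that v no_loop h_diag[of v] by (cases "u = v") simp_all
    qed
    also have "\<dots> = real (\<Sum>u<n. h v u)" by simp
    also have "(\<Sum>u<n. h v u) = (\<Sum>u<n. \<Sum>i<T. of_bool (\<sigma> (sel i) v = u) + of_bool (\<sigma> (sel i) u = v))"
      using v H by (intro sum.cong refl) (simp add: h_def)
    also have "\<dots> = (\<Sum>i<T. \<Sum>u<n. of_bool (\<sigma> (sel i) v = u) + of_bool (\<sigma> (sel i) u = v))"
      by (rule sum.swap)
    also have "\<dots> = (\<Sum>i<T. 2)"
    proof (rule sum.cong[OF refl])
      fix i assume "i \<in> {..<T}"
      then have c: "sel i < D" using sel by simp
      have "(\<Sum>u<n. of_bool (\<sigma> (sel i) v = u)) = (1::nat)"
        using \<sigma>_less[OF c, of v] v by (simp add: of_bool_def)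
      moreover have "(\<Sum>u<n. of_bool (\<sigma> (sel i) u = v)) = (1::nat)"
        using sum_\<sigma>[OF c, of "\<lambda>u. of_bool (u = v) :: nat"] v by (simp add: of_bool_def)
      ultimately show "(\<Sum>u<n. of_bool (\<sigma> (sel i) v = u) + of_bool (\<sigma> (sel i) u = v)) = (2::nat)"
        by (simp add: sum.distrib)
    qed
    finally show "weighted_degree ?F ?w v = 2 * real T" by simp
  qed
  have exp: "1 / 3 \<le> edge_expansion {..<n} ?F ?w"
  proof (rule edge_expansion_ge)
    fix S assume S: "S \<subseteq> {..<n}" "S \<noteq> {}" "2 * card S \<le> card {..<n}"
    let ?C = "{..<n} - S"
    have finS: "finite S" using S(1) finite_subset by blast
    have "3 / 4 * card S \<le> real (\<Sum>i<T. card {v \<in> ?C. \<sigma> (sel i) v \<in> S})"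
      using crossing_arcs[OF greedy mixed S(1)] S(3) by simp
    also have "(\<Sum>i<T. card {v \<in> ?C. \<sigma> (sel i) v \<in> S}) = (\<Sum>i<T. \<Sum>v\<in>?C. \<Sum>u\<in>S. of_bool (\<sigma> (sel i) v = u))"
    proof (intro sum.cong refl)
      fix i
      have "card {v \<in> ?C. \<sigma> (sel i) v \<in> S} = (\<Sum>v\<in>?C. of_bool (\<sigma> (sel i) v \<in> S))"
        by (subst sum_of_bool_eq) (simp_all add: Int_def)
      also have "\<dots> = (\<Sum>v\<in>?C. \<Sum>u\<in>S. of_bool (\<sigma> (sel i) v = u))"
        using finS by (intro sum.cong refl) (simp add: of_bool_def)
      finally show "card {v \<in> ?C. \<sigma> (sel i) v \<in> S} = (\<Sum>v\<in>?C. \<Sum>u\<in>S. of_bool (\<sigma> (sel i) v = u))" .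
    qed
    also have "\<dots> = (\<Sum>v\<in>?C. \<Sum>u\<in>S. \<Sum>i<T. of_bool (\<sigma> (sel i) v = u))"
      by (subst sum.swap) (intro sum.cong refl sum.swap)
    \<comment> \<open>Only arcs entering \<open>S\<close> are counted so far; \<open>h\<close> also
      counts those leaving it. The bound 3/4 exceeds 1/3 without them.\<close>
    also have "\<dots> \<le> (\<Sum>v\<in>?C. \<Sum>u\<in>S. h u v)"
    proof (intro sum_mono)
      fix u v assume "u \<in> S" "v \<in> ?C"
      then show "(\<Sum>i<T. of_bool (\<sigma> (sel i) v = u)) \<le> h u v"
        using S(1) h_split[of u v] by auto
    qed
    also have "(\<Sum>v\<in>?C. \<Sum>u\<in>S. h u v) = (\<Sum>(u, v)\<in>S \<times> ?C. h u v)"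
      by (subst sum.swap) (rule sum.cartesian_product)
    also have "real \<dots> = (\<Sum>p\<in>S \<times> ?C. if {fst p, snd p} \<in> ?F then ?w {fst p, snd p} else 0)"
      unfolding of_nat_sum
    proof (rule sum.cong[OF refl])
      fix p assume "p \<in> S \<times> ?C"
      then have "fst p < n" "snd p < n" "fst p \<noteq> snd p" using S(1) by auto
      from w_eq[OF this] show "real (case p of (u, v) \<Rightarrow> h u v) =
          (if {fst p, snd p} \<in> ?F then ?w {fst p, snd p} else 0)"
        by (simp add: case_prod_beta)
    qed
    also have "\<dots> = (\<Sum>p\<in>{p \<in> S \<times> ?C. {fst p, snd p} \<in> ?F}. ?w {fst p, snd p})"
      using finS by (intro sum.inter_filter[symmetric]) simp
    also have "{p \<in> S \<times> ?C. {fst p, snd p} \<in> ?F} = {(u, v). u \<in> S \<and> v \<in> ?C \<and> {u, v} \<in> ?F}"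
      by auto
    also have "(\<Sum>p\<in>\<dots>. ?w {fst p, snd p}) = cut_weight ?F ?w S"
      using cut_weight_pairs[OF simple_graph_output[of n s] S(1), of ?w] by (simp add: case_prod_beta)
    finally show "1 / 3 * card S \<le> cut_weight ?F ?w S" by simp
  qed (use n in simp_all)
  show ?thesis
    unfolding regular_expander_subgraph_def using FE weights reg T exp by blast
qed

section \<open>The program\<close>

text \<open>With fewer than \<open>K * L\<close> colours there is no selection of distinct classes,
  and the program stops early. On the instances this cannot happen once \<open>n\<close> is large,
  but the time bound has to hold on all graphs.\<close>

definition expander_program :: "nat \<Rightarrow> com" where
  "expander_program K = max_degree ;; colour_arcs ;; rounds K ;;
     Cond (Sub (var ''T'') (var ''D'')) Skip select_colours"

definition running_time :: "nat \<Rightarrow> nat \<Rightarrow> nat" where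
  "running_time K n = 10 * (n + 1) * (n + 1) + ((n * ((n * ((31 * n + 21) + 2) + 2) + 2) + 2) +
     (20 * (K + 1) * (n + 1) + Suc (100 * ((2 * n + 1) ^ K + 1) * (n + 1) * (n + 1) * (n + 1) * (K * n + 1))))"

text \<open>What a run guarantees on an arbitrary graph. For a regular one the first two conditions
  force \<open>D\<close> to be the degree.\<close>

definition program_result :: "nat \<Rightarrow> nat \<Rightarrow> nat set set \<Rightarrow> state \<Rightarrow> bool" where
  "program_result K n E s \<longleftrightarrow> (\<exists>D L M N.
     (\<forall>u<n. card {v. (u, v) \<in> arcs n E} \<le> D) \<and>
     (D = 0 \<or> (\<exists>u<n. D = card {v. (u, v) \<in> arcs n E})) \<and>
     arc_colouring n D (arcs n E) M N \<and> n \<le> 2 ^ L \<and> 2 ^ L \<le> 2 * n + 1 \<and>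
     (K * L \<le> D \<longrightarrow> select_inv n D M (K * L) s))"

lemma wp_expander_program:
  "wp (expander_program K) (running_time K n) (program_result K n E) (input_state n E)"
  unfolding expander_program_def running_time_def
proof (rule wp_Seq_step[OF wp_max_degree[where s = "input_state n E" and n = n and E = E]])
  let ?s = "input_state n E"
  show "?s ''n'' [] = n" "?s ''G'' [i, j] = of_bool ({i, j} \<in> E)" for i j
    by (simp_all add: input_state_def)
  have zero: "?s x = (\<lambda>_. 0)" if "x \<noteq> ''n''" "x \<noteq> ''G''" for x
    using that by (auto simp: input_state_def)
  fix s1 assume deg: "(\<forall>u<n. card {v. (u, v) \<in> arcs n E} \<le> s1 ''D'' []) \<and>
      (s1 ''D'' [] = 0 \<or> (\<exists>u<n. s1 ''D'' [] = card {v. (u, v) \<in> arcs n E}))"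
    and fr1: "\<And>x. x \<notin> written max_degree \<Longrightarrow> s1 x = ?s x"
  define D where "D = s1 ''D'' []"
  have "card {v. (u, v) \<in> arcs n E} \<le> n" for u
    using card_mono[of "{..<n}" "{v. (u, v) \<in> arcs n E}"] by (auto simp: arcs_def)
  then have Dn: "D \<le> n" using deg by (auto simp: D_def)
  have s1: "s1 ''n'' [] = n" "s1 ''D'' [] = D" "s1 ''M'' = (\<lambda>_. 0)" "s1 ''N'' = (\<lambda>_. 0)"
    "s1 ''P'' = (\<lambda>_. 0)" "s1 ''U'' = (\<lambda>_. 0)" "s1 ''H'' = (\<lambda>_. 0)"
    using fr1 zero by (simp_all add: D_def input_state_def)
  have G1: "s1 ''G'' [i, j] = of_bool ({i, j} \<in> E)" for i j
    using fr1 by (simp add: input_state_def)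
  show "wp (colour_arcs ;; rounds K ;; Cond (Sub (var ''T'') (var ''D'')) Skip select_colours)
     ((n * ((n * ((31 * n + 21) + 2) + 2) + 2) + 2) + (20 * (K + 1) * (n + 1) +
       Suc (100 * ((2 * n + 1) ^ K + 1) * (n + 1) * (n + 1) * (n + 1) * (K * n + 1))))
     (program_result K n E) s1"
  proof (rule wp_Seq_step[OF wp_colour_arcs[where E = E and n = n and D = D and s = s1, OF s1(1,2) Dn G1 _ s1(3,4)]])
    show "card {v. (u, v) \<in> arcs n E} \<le> D" if "u < n" for u using deg that by (simp add: D_def)
    fix s2 assume col: "arc_colouring n D (arcs n E) (s2 ''M'') (s2 ''N'')"
      and fr2: "\<And>x. x \<notin> written colour_arcs \<Longrightarrow> s2 x = s1 x"
    have s2: "s2 ''n'' [] = n" "s2 ''D'' [] = D"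
      "s2 ''P'' = (\<lambda>_. 0)" "s2 ''U'' = (\<lambda>_. 0)" "s2 ''H'' = (\<lambda>_. 0)"
      using fr2 s1 by simp_all
    show "wp (rounds K ;; Cond (Sub (var ''T'') (var ''D'')) Skip select_colours)
       (20 * (K + 1) * (n + 1) + Suc (100 * ((2 * n + 1) ^ K + 1) * (n + 1) * (n + 1) * (n + 1) * (K * n + 1)))
       (program_result K n E) s2"
    proof (rule wp_Seq_step[OF wp_rounds[where s = s2 and n = n, OF s2(1)]])
      fix s3 assume "\<exists>L\<le>n. n \<le> 2 ^ L \<and> 2 ^ L \<le> 2 * n + 1 \<and> s3 ''T'' [] = K * L \<and> s3 ''B'' [] = 2 ^ (K * L)"
        and fr3: "\<And>x. x \<notin> written (rounds K) \<Longrightarrow> s3 x = s2 x"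
      then obtain L where L: "L \<le> n" "n \<le> 2 ^ L" "2 ^ L \<le> 2 * n + 1" "s3 ''T'' [] = K * L" "s3 ''B'' [] = 2 ^ (K * L)"
        by blast
      have s3: "s3 ''n'' [] = n" "s3 ''D'' [] = D" "s3 ''M'' = s2 ''M''"
        "s3 ''P'' = (\<lambda>_. 0)" "s3 ''U'' = (\<lambda>_. 0)" "s3 ''H'' = (\<lambda>_. 0)"
        using fr3 s2 by simp_all
      have result: "program_result K n E s4" if "K * L \<le> D \<longrightarrow> select_inv n D (s2 ''M'') (K * L) s4" for s4
        unfolding program_result_def using deg col L(2,3) that unfolding D_def by blast
      let ?B = "100 * ((2 * n + 1) ^ K + 1) * (n + 1) * (n + 1) * (n + 1) * (K * n + 1)"
      show "wp (Cond (Sub (var ''T'') (var ''D'')) Skip select_colours) (Suc ?B) (program_result K n E) s3"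
      proof (rule wp_Cond)
        assume "aval s3 (Sub (var ''T'') (var ''D'')) \<noteq> 0"
        then have "\<not> K * L \<le> D" using L(4) s3(2) by simp
        then have "program_result K n E s3" using result by blast
        then show "wp Skip ?B (program_result K n E) s3" by (intro wp_Skip) simp_all
      next
        assume "aval s3 (Sub (var ''T'') (var ''D'')) = 0"
        then have TD: "K * L \<le> D" using L(4) s3(2) by simp
        have "wp select_colours (100 * (2 ^ (K * L) + 1) * (n + 1) * (n + 1) * (n + 1) * (K * L + 1))
           (select_inv n D (s2 ''M'') (K * L)) s3"
          by (rule wp_select_colours[OF s3(1,2) L(5,4) Dn TD s3(3) arc_colouringD(2)[OF col] s3(4-6)])
        then show "wp select_colours ?B (program_result K n E) s3"
        proof (rule wp_mono)
          have "(2::nat) ^ (K * L) = (2 ^ L) ^ K" by (simp add: mult.commute flip: power_mult)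
          also have "\<dots> \<le> (2 * n + 1) ^ K" using L(3) by (rule power_mono) simp
          finally show "100 * (2 ^ (K * L) + 1) * (n + 1) * (n + 1) * (n + 1) * (K * L + 1) \<le> ?B"
            using L(1) by (intro mult_le_mono add_le_mono order_refl) simp_all
        qed (use result in blast)
      qed
    qed
  qed
qed

section \<open>Polynomial bound on the running time\<close>

definition poly_bounded :: "(nat \<Rightarrow> nat) \<Rightarrow> bool" where
  "poly_bounded f \<longleftrightarrow> (\<exists>p. \<forall>n. f n \<le> poly p n)"

lemma poly_bounded_const: "poly_bounded (\<lambda>_. c)"
  unfolding poly_bounded_def by (intro exI[of _ "[:c:]"]) simp

lemma poly_bounded_id: "poly_bounded (\<lambda>n. n)"
  unfolding poly_bounded_def by (intro exI[of _ "[:0, 1:]"]) simp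

lemma poly_bounded_add: "poly_bounded f \<Longrightarrow> poly_bounded g \<Longrightarrow> poly_bounded (\<lambda>n. f n + g n)"
  unfolding poly_bounded_def by (metis add_mono poly_add)

lemma poly_bounded_mult: "poly_bounded f \<Longrightarrow> poly_bounded g \<Longrightarrow> poly_bounded (\<lambda>n. f n * g n)"
  unfolding poly_bounded_def by (metis mult_le_mono poly_mult)

lemma poly_bounded_power: "poly_bounded f \<Longrightarrow> poly_bounded (\<lambda>n. f n ^ k)"
  by (induction k) (auto intro: poly_bounded_const poly_bounded_mult)

lemma poly_bounded_running_time: "poly_bounded (running_time K)"
  unfolding running_time_def Suc_eq_plus1
  by (intro poly_bounded_add poly_bounded_mult poly_bounded_power poly_bounded_const poly_bounded_id)

section \<open>Parameters\<close>

lemma few_rounds: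
  fixes c :: real and K :: nat
  assumes "0 < c"
  shows "\<exists>n0\<ge>16. \<forall>n\<ge>n0. \<forall>L. 2 ^ L \<le> 2 * n + 1 \<longrightarrow>
    real (K * L) \<le> c * n \<and> 2 * real (K * L) \<le> (ln n)\<^sup>2 \<and> 1 \<le> ln (real n)"
proof -
  have "((\<lambda>n::nat. log 2 (2 * real n + 1) / real n) \<longlongrightarrow> 0) sequentially" by real_asymp
  then have 1: "\<forall>\<^sub>F n in sequentially. log 2 (2 * real n + 1) / real n < c / (K + 1)"
    using assms by (intro order_tendstoD(2)) auto
  have "((\<lambda>n::nat. log 2 (2 * real n + 1) / (ln (real n))\<^sup>2) \<longlongrightarrow> 0) sequentially" by real_asymp
  then have 2: "\<forall>\<^sub>F n in sequentially. log 2 (2 * real n + 1) / (ln (real n))\<^sup>2 < 1 / (2 * (K + 1))"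
    by (intro order_tendstoD(2)) auto
  have 3: "\<forall>\<^sub>F n::nat in sequentially. 1 \<le> ln (real n)" by real_asymp
  from 1 2 3 have "\<forall>\<^sub>F n in sequentially. log 2 (2 * real n + 1) / real n < c / (K + 1) \<and>
     log 2 (2 * real n + 1) / (ln (real n))\<^sup>2 < 1 / (2 * (K + 1)) \<and> 1 \<le> ln (real n)"
    by eventually_elim simp
  then obtain n1 where n1: "\<And>n. n1 \<le> n \<Longrightarrow> log 2 (2 * real n + 1) / real n < c / (K + 1) \<and>
     log 2 (2 * real n + 1) / (ln (real n))\<^sup>2 < 1 / (2 * (K + 1)) \<and> 1 \<le> ln (real n)"
    unfolding eventually_sequentially by blast
  show ?thesis
  proof (intro exI[of _ "max n1 16"] conjI allI impI)
    fix n L :: nat assume n: "max n1 16 \<le> n" and L: "2 ^ L \<le> 2 * n + 1"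
    let ?l = "log 2 (2 * real n + 1)"
    have N: "?l / real n < c / (K + 1)" "?l / (ln (real n))\<^sup>2 < 1 / (2 * (K + 1))" "1 \<le> ln (real n)"
      using n1[of n] n by auto
    have n0: "0 < real n" using n by simp
    have "real (2 ^ L) \<le> real (2 * n + 1)" using L by (rule of_nat_mono)
    then have "2 powr L \<le> 2 * real n + 1" by (simp add: powr_realpow)
    then have "L \<le> ?l" by (subst le_log_iff) auto
    then have KL: "real (K * L) \<le> real (K + 1) * ?l" by (simp add: mult_mono)
    have "real (K + 1) * ?l \<le> c * n" using N(1) n0 by (simp add: field_simps)
    with KL show "real (K * L) \<le> c * n" by linarith
    have "2 * (real (K + 1) * ?l) \<le> (ln n)\<^sup>2" using N(2,3) by (simp add: field_simps)
    with KL show "2 * real (K * L) \<le> (ln n)\<^sup>2" by linarith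
    show "1 \<le> ln (real n)" by (rule N)
  qed simp
qed

text \<open>\<open>K\<close> steps gain a factor \<open>1 / 16 = 2 ^ -4\<close>, hence
  \<open>K * L\<close> steps gain \<open>n ^ -4\<close>. The initial spread costs one power of
  \<open>n\<close>, and \<open>16 <= n\<close> trades another one for the constant.\<close>

lemma inverse_power_le:
  fixes g :: real
  assumes g: "0 < g" "g < 1" "(1 - g) ^ K \<le> 1 / 16" and L: "n \<le> 2 ^ L" and n: "16 \<le> n"
  shows "(1 - g) ^ (K * L) * n \<le> 1 / (16 * (real n)\<^sup>2)"
proof -
  have "(1 - g) ^ (K * L) = ((1 - g) ^ K) ^ L" by (simp add: power_mult)
  also have "\<dots> \<le> (1 / 16) ^ L" using g by (intro power_mono) auto
  also have "\<dots> = 1 / (2 ^ L) ^ 4"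
  proof -
    have "((2::real) ^ L) ^ 4 = (2 ^ 4) ^ L" by (simp only: power_mult[symmetric] mult.commute)
    then show ?thesis by (simp add: power_one_over)
  qed
  also have "\<dots> \<le> 1 / real n ^ 4"
  proof (intro divide_left_mono power_mono)
    have "real n \<le> real (2 ^ L)" using L by (rule of_nat_mono)
    then show "real n \<le> 2 ^ L" by simp
  qed (use n in auto)
  finally have "(1 - g) ^ (K * L) * n \<le> 1 / real n ^ 4 * n" by (intro mult_right_mono) auto
  also have "\<dots> = 1 / (real n * (real n)\<^sup>2)" using n by (simp add: power2_eq_square power4_eq_xxxx)
  also have "\<dots> \<le> 1 / (16 * (real n)\<^sup>2)" using n by (intro divide_left_mono mult_right_mono) auto
  finally show ?thesis .
qed

lemma program_result_correct:
  fixes \<beta> \<gamma> g :: real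
  assumes result: "program_result K n E s"
    and G: "dense_expander \<beta> \<gamma> {..<n} E" and pos: "0 < \<beta>" "0 < \<gamma>"
    and g: "0 < g" "g < 1" "32 * g \<le> \<gamma>\<^sup>2" "(1 - g) ^ K \<le> 1 / 16"
    and n: "16 \<le> n" and few: "\<And>L. 2 ^ L \<le> 2 * n + 1 \<Longrightarrow>
       real (K * L) \<le> g * \<beta> * n \<and> 2 * real (K * L) \<le> (ln n)\<^sup>2 \<and> 1 \<le> ln (real n)"
  shows "regular_expander_subgraph (ln (real n) powr (2 / (\<beta> * \<gamma>\<^sup>2))) {..<n} E (output_edges n s) (output_weight s)"
proof -
  obtain D where E: "simple_graph {..<n} E" and reg: "weighted_regular {..<n} E (\<lambda>_. 1) (real D)"
    and dense: "\<beta> * n \<le> D" and exp: "\<gamma> * D \<le> edge_expansion {..<n} E (\<lambda>_. 1)"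
    using G unfolding dense_expander_def by auto
  note deg = card_out_arcs[OF E reg]
  have n0: "0 < n" using n by simp
  have D0: "0 < D" using dense pos n0 by (metis less_le_trans mult_pos_pos of_nat_0_less_iff)
  have \<kappa>: "0 \<le> \<gamma> * D" using pos by simp
  obtain D' L M N where D': "\<forall>u<n. card {v. (u, v) \<in> arcs n E} \<le> D'"
      "D' = 0 \<or> (\<exists>u<n. D' = card {v. (u, v) \<in> arcs n E})"
    and col': "arc_colouring n D' (arcs n E) M N" and L: "n \<le> 2 ^ L" "2 ^ L \<le> 2 * n + 1"
    and sel': "K * L \<le> D' \<longrightarrow> select_inv n D' M (K * L) s"
    using result unfolding program_result_def by blast
  have "D' = D" using D' deg n0 D0 by (metis not_gr_zero le_zero_eq)
  with col' sel' have col: "arc_colouring n D (arcs n E) M N" and sel: "K * L \<le> D \<longrightarrow> select_inv n D M (K * L) s"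
    by simp_all
  interpret expanding_relation "{..<n}" "arcs n E" D "\<gamma> * D"
    by (rule expanding_relation_arcs[OF E reg exp \<kappa>])
  interpret matching_decomposition n "arcs n E" D "\<gamma> * D" M
    by (rule matching_decomposition_arcs[OF E reg exp \<kappa> col n0 D0])
  \<comment> \<open>A single vertex is left by at most \<open>D\<close> arcs, so an instance exists
    only if \<gamma> is at most 1; below, \<open>D <= n\<close> likewise bounds \<beta>.\<close>
  have "\<gamma> * D * 1 \<le> real (card {p \<in> arcs n E. fst p = 0})"
  proof -
    have "\<gamma> * D * card {0::nat} \<le> card {(u, v) \<in> arcs n E. u \<in> {0} \<and> v \<notin> {0}}"
      using n by (intro cut) auto
    moreover have "card {(u, v) \<in> arcs n E. u \<in> {0} \<and> v \<notin> {0}} \<le> card {p \<in> arcs n E. fst p = 0}"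
      using finite_arcs by (intro card_mono) auto
    ultimately show ?thesis by simp
  qed
  moreover have "card {p \<in> arcs n E. fst p = 0} \<le> D" using out_degree n0 by simp
  ultimately have "\<gamma> * real D \<le> 1 * real D" by simp
  then have \<gamma>1: "\<gamma> \<le> 1" using D0 by (subst (asm) mult_le_cancel_right_pos) auto
  have "card {v. (0, v) \<in> arcs n E} \<le> n"
    using card_mono[of "{..<n}" "{v. (0, v) \<in> arcs n E}"] by (auto simp: arcs_def)
  then have "real D \<le> real n" using deg[OF n0] by simp
  with dense have "\<beta> * real n \<le> 1 * real n" by linarith
  then have \<beta>1: "\<beta> \<le> 1" using n0 by (subst (asm) mult_le_cancel_right_pos) auto
  have KL: "real (K * L) \<le> g * D"
  proof -
    have "real (K * L) \<le> g * (\<beta> * n)" using few[OF L(2)] by (simp add: mult.assoc)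
    also have "\<dots> \<le> g * real D" using dense g by (intro mult_left_mono) auto
    finally show ?thesis .
  qed
  also have "\<dots> \<le> 1 * real D" using g by (intro mult_right_mono) auto
  finally have "K * L \<le> D" by (simp only: of_nat_le_iff mult_1)
  with sel obtain sel where greedy: "greedy n D M sel (K * L)"
    and H: "\<forall>u<n. \<forall>w<n. s ''H'' [u, w] = (\<Sum>i<K * L. of_bool (M [sel i, u] - 1 = w) + of_bool (M [sel i, w] - 1 = u))"
    unfolding select_inv_def by blast
  have g': "32 * g * D\<^sup>2 \<le> (\<gamma> * D)\<^sup>2"
    unfolding power_mult_distrib of_nat_power using g(3) by (intro mult_right_mono) auto
  have "spread (centred sel (K * L)) \<le> (1 - g) ^ (K * L) * n"
    by (rule spread_le[OF greedy g(1,2) KL g' order_refl])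
  also have "\<dots> \<le> 1 / (16 * (real n)\<^sup>2)"
    by (rule inverse_power_le[OF g(1,2,4) L(1) n])
  finally have mixed: "spread (centred sel (K * L)) \<le> 1 / (16 * n\<^sup>2)" by simp
  show ?thesis
  proof (rule selection_expander[OF greedy mixed _ refl E])
    \<comment> \<open>The exponent is thus at least 2, and since the logarithm is at least 1 the
      squared logarithm suffices as a bound. This is why \<open>C = 2\<close> can be chosen.\<close>
    have "\<beta> * \<gamma>\<^sup>2 \<le> 1 * 1\<^sup>2" using \<beta>1 \<gamma>1 pos by (intro mult_mono power_mono) auto
    then have "2 \<le> 2 / (\<beta> * \<gamma>\<^sup>2)" using pos by (simp add: field_simps)
    then have "ln (real n) powr 2 \<le> ln (real n) powr (2 / (\<beta> * \<gamma>\<^sup>2))"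
      using few[OF L(2)] by (intro powr_mono) auto
    moreover have "ln (real n) powr 2 = (ln n)\<^sup>2" using few[OF L(2)] by (subst powr_numeral) auto
    ultimately show "2 * real (K * L) \<le> ln (real n) powr (2 / (\<beta> * \<gamma>\<^sup>2))"
      using few[OF L(2)] by linarith
  qed (use H n in auto)
qed

theorem theorem2:
  "\<exists>C::real. C > 0 \<and> (\<forall>\<beta>::real. \<forall>\<gamma>::real. \<beta> > 0 \<and> \<gamma> > 0 \<longrightarrow>
     (\<exists>n0::nat.
        (\<forall>n\<ge>n0. \<forall>(V::nat set) E. card V = n \<and> dense_expander \<beta> \<gamma> V E \<longrightarrow>
           (\<exists>F w. regular_expander_subgraph (ln (real n) powr (C / (\<beta> * \<gamma>\<^sup>2))) V E F w)) \<and>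
        (\<exists>c. randomized_poly_time_search c
               (\<lambda>n E. n \<ge> n0 \<and> dense_expander \<beta> \<gamma> {..<n} E)
               (\<lambda>n E F w. regular_expander_subgraph (ln (real n) powr (C / (\<beta> * \<gamma>\<^sup>2))) {..<n} E F w))))"
proof (intro exI[of _ "2::real"] conjI allI impI)
  fix \<beta> \<gamma> :: real assume pos: "\<beta> > 0 \<and> \<gamma> > 0"
  \<comment> \<open>The first term makes \<open>32 * g * D^2\<close> at most the square of
    \<open>\<gamma> * D\<close>, as \<open>spread_Suc_le\<close> requires; the second keeps
    \<open>g\<close> below 1.\<close>
  define g where "g = min (\<gamma>\<^sup>2 / 32) (1 / 2)"
  have g: "0 < g" "g < 1" "32 * g \<le> \<gamma>\<^sup>2" using pos by (auto simp: g_def min_def)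
  \<comment> \<open>\<open>K\<close> depends on \<gamma> only, so the power \<open>K\<close> in the
    running time is a fixed exponent.\<close>
  obtain K where K: "(1 - g) ^ K \<le> 1 / 16"
    using real_arch_pow_inv[of "1 / 16" "1 - g"] g by (auto intro: less_imp_le)
  obtain n0 where n0: "16 \<le> n0" and few: "\<And>n L. n0 \<le> n \<Longrightarrow> 2 ^ L \<le> 2 * n + 1 \<Longrightarrow>
     real (K * L) \<le> g * \<beta> * n \<and> 2 * real (K * L) \<le> (ln n)\<^sup>2 \<and> 1 \<le> ln (real n)"
    using few_rounds[of "g * \<beta>" K] g(1) pos by auto
  let ?b = "\<lambda>n. ln (real n) powr (2 / (\<beta> * \<gamma>\<^sup>2))"
  have correct: "regular_expander_subgraph (?b n) {..<n} E (output_edges n s) (output_weight s)"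
    if "n0 \<le> n" "dense_expander \<beta> \<gamma> {..<n} E" "program_result K n E s" for n E s
    using program_result_correct[OF that(3,2) _ _ g K _ few[OF that(1)]] pos n0 that(1) by simp
  have runs: "\<exists>t s. t \<le> running_time K n \<and> (\<forall>r. exec (expander_program K) (input_state n E, r) t (s, r)) \<and>
     program_result K n E s" for n E
    using wp_expander_program[of K n E] unfolding wp_def .
  show "\<exists>n0. (\<forall>n\<ge>n0. \<forall>(V::nat set) E. card V = n \<and> dense_expander \<beta> \<gamma> V E \<longrightarrow>
           (\<exists>F w. regular_expander_subgraph (?b n) V E F w)) \<and>
        (\<exists>c. randomized_poly_time_search c
               (\<lambda>n E. n \<ge> n0 \<and> dense_expander \<beta> \<gamma> {..<n} E)
               (\<lambda>n E F w. regular_expander_subgraph (?b n) {..<n} E F w))"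
  proof (intro exI[of _ n0] conjI allI impI)
    fix n and V :: "nat set" and E
    assume n: "n0 \<le> n" and V: "card V = n \<and> dense_expander \<beta> \<gamma> V E"
    then have G: "simple_graph V E" and fin: "finite V" by (auto simp: dense_expander_def simple_graph_def)
    \<comment> \<open>The input format fixes the vertices to be 0, ..., n - 1. For other vertex
      sets, existence follows by running the program on a relabelled copy and pulling the result
      back.\<close>
    obtain k where k: "bij_betw k V {..<n}"
      using ex_bij_betw_finite_nat[OF fin] V by (auto simp: lessThan_atLeast0)
    then have inj: "inj_on k V" and im: "k ` V = {..<n}" by (auto simp: bij_betw_def)
    have "dense_expander \<beta> \<gamma> {..<n} ((`) k ` E)"
      using dense_expander_image[OF inj] V im by metis
    then have "\<exists>F w. regular_expander_subgraph (?b n) (k ` V) ((`) k ` E) F w"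
      using runs[of n "(`) k ` E"] correct[OF n] unfolding im by blast
    then show "\<exists>F w. regular_expander_subgraph (?b n) V E F w"
      using regular_expander_subgraph_preimage[OF inj G] by blast
  next
    obtain p where p: "\<And>n. running_time K n \<le> poly p n"
      using poly_bounded_running_time[of K] unfolding poly_bounded_def by blast
    show "\<exists>c. randomized_poly_time_search c
               (\<lambda>n E. n \<ge> n0 \<and> dense_expander \<beta> \<gamma> {..<n} E)
               (\<lambda>n E F w. regular_expander_subgraph (?b n) {..<n} E F w)"
      unfolding randomized_poly_time_search_def
    proof (intro exI[of _ "expander_program K"] exI[of _ p] conjI allI impI)
      show "\<exists>t \<sigma>. exec (expander_program K) (input_state n E, r) t \<sigma> \<and> t \<le> poly p n" for n E r
        using runs[of n E] p[of n] by (meson order_trans)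
      fix n E assume "simple_graph {..<n} E \<and> n0 \<le> n \<and> dense_expander \<beta> \<gamma> {..<n} E"
      then have n: "n0 \<le> n" "dense_expander \<beta> \<gamma> {..<n} E" by auto
      \<comment> \<open>Every coin sequence leads to the same correct output, so the success event
        is everything and its probability is 1.\<close>
      have all: "{r. \<exists>t s r'. exec (expander_program K) (input_state n E, r) t (s, r') \<and>
          regular_expander_subgraph (?b n) {..<n} E (output_edges n s) (output_weight s)} = UNIV"
        using runs[of n E] correct[OF n] by blast
      show "2 / 3 \<le> measure_pmf.prob (pmf_of_set {r :: bool list. length r = poly p n})
         {r. \<exists>t s r'. exec (expander_program K) (input_state n E, r) t (s, r') \<and>
            regular_expander_subgraph (?b n) {..<n} E (output_edges n s) (output_weight s)}"
        unfolding all by simp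
    qed
  qed
qed simp

end
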